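(* Let $\sigma\ge1$, $\delta=\frac{\sigma}{2}$ and $m\in[1,2)$. For every space dimension $n\ge1$, every $a\ge0$ and $j\in\{0,1\}$, the Sobolev solutions $w$ to $$w_{tt}+(-\Delta)^\sigma w+(-\Delta)^\delta w_t=0,\quad w(0,x)=w_0(x),\quad w_t(0,x)=w_1(x)\qquad (t\ge0,\ x\in\mathbb{R}^n)$$ satisfy the $(L^m\cap L^2)-L^2$ estimates $$\big\|\partial_t^j|D|^aw(t,\cdot)\big\|_{L^2}\lesssim(1+t)^{-\frac n\sigma(\frac1m-\frac12)-\frac a\sigma-j}\|w_0\|_{L^m\cap H^{a+j\sigma}}+(1+t)^{1-\frac n\sigma(\frac1m-\frac12)-\frac a\sigma-j}\|w_1\|_{L^m\cap H^{[a+(j-1)\sigma]^+}},$$ and the $L^2-L^2$ estimates $$\big\|\partial_t^j|D|^aw(t,\cdot)\big\|_{L^2}\lesssim(1+t)^{-\frac a\sigma-j}\|w_0\|_{H^{a+j\sigma}}+(1+t)^{1-\frac a\sigma-j}\|w_1\|_{H^{[a+(j-1)\sigma]^+}}.$$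
   Context: $[s]^+:=\max\{s,0\}$; $H^a$ is the $L^2$-based Bessel potential space on $\mathbb{R}^n$; $|D|^a$ and $(-\Delta)^a$ are the Fourier multipliers with symbols $|\xi|^a$ and $|\xi|^{2a}$; $\|\cdot\|_{L^m\cap H^s}=\|\cdot\|_{L^m}+\|\cdot\|_{H^s}$; $f\lesssim g$ means $f\le Cg$ with $C>0$ independent of $t\ge0$ and of the data. The solution is the one given on the Fourier side by $\hat w=\frac{\lambda_1e^{\lambda_2t}-\lambda_2e^{\lambda_1t}}{\lambda_1-\lambda_2}\hat w_0+\frac{e^{\lambda_1t}-e^{\lambda_2t}}{\lambda_1-\lambda_2}\hat w_1$, $\lambda_{1,2}=\frac12\big(-|\xi|^{2\delta}\pm\sqrt{|\xi|^{4\delta}-4|\xi|^{2\sigma}}\big)$; the data are any functions for which the norms on the right-hand side are finite. *)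

theory Defs
  imports "HOL-Analysis.Analysis"
begin

section \<open>Lebesgue spaces\<close>

definition Lp :: "real \<Rightarrow> ('a::euclidean_space \<Rightarrow> complex) set" where
  "Lp p = {f \<in> borel_measurable lebesgue. integrable lebesgue (\<lambda>x. norm (f x) powr p)}"

definition Lp_norm :: "real \<Rightarrow> ('a::euclidean_space \<Rightarrow> complex) \<Rightarrow> real" where
  "Lp_norm p f = (integral\<^sup>L lebesgue (\<lambda>x. norm (f x) powr p)) powr (1 / p)"

text \<open>The membership requirement is needed because the Bochner integral of a non-integrable
  function is \<open>0\<close>, so that \<open>Lp_norm\<close> alone does not detect functions outside \<open>Lp\<close>.\<close>

definition tendsto_Lp ::
  "real \<Rightarrow> ('i \<Rightarrow> 'a::euclidean_space \<Rightarrow> complex) \<Rightarrow> ('a \<Rightarrow> complex) \<Rightarrow> 'i filter \<Rightarrow> bool" where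
  "tendsto_Lp p u l F \<longleftrightarrow>
     (\<forall>\<^sub>F k in F. (\<lambda>x. u k x - l x) \<in> Lp p) \<and>
     ((\<lambda>k. Lp_norm p (\<lambda>x. u k x - l x)) \<longlongrightarrow> 0) F"


section \<open>Fourier transform on \<open>L\<^sup>2\<close> and Sobolev spaces\<close>

definition fourier_integral :: "('a::euclidean_space \<Rightarrow> complex) \<Rightarrow> 'a \<Rightarrow> complex" where
  "fourier_integral f \<xi> =
     complex_of_real ((2 * pi) powr (- real DIM('a) / 2)) *
     integral\<^sup>L lebesgue (\<lambda>x. cis (- (x \<bullet> \<xi>)) * f x)"

text \<open>The Fourier--Plancherel transform of \<open>f \<in> Lp 2\<close>: the \<open>L\<^sup>2\<close>-limit, as \<open>R \<rightarrow> \<infinity>\<close>, of the Fourier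
  integrals of the truncations of \<open>f\<close> to balls. By Plancherel's theorem the limit exists; it is
  determined up to a null set, and every use below is insensitive to the representative.\<close>

definition fourier_L2 :: "('a::euclidean_space \<Rightarrow> complex) \<Rightarrow> 'a \<Rightarrow> complex" where
  "fourier_L2 f = (SOME F. F \<in> Lp 2 \<and>
     tendsto_Lp 2 (\<lambda>R. fourier_integral (\<lambda>x. indicator (cball 0 R) x * f x)) F at_top)"

text \<open>The Bessel potential space \<open>H\<^sup>s\<close>, for \<open>s \<ge> 0\<close> (for \<open>s < 0\<close> its elements need not be
  functions in \<open>L\<^sup>2\<close>).\<close>

definition Sobolev :: "real \<Rightarrow> ('a::euclidean_space \<Rightarrow> complex) set" where
  "Sobolev s = {f \<in> Lp 2.
     (\<lambda>\<xi>. complex_of_real ((1 + (norm \<xi>)\<^sup>2) powr (s / 2)) * fourier_L2 f \<xi>) \<in> Lp 2}"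

definition Sobolev_norm :: "real \<Rightarrow> ('a::euclidean_space \<Rightarrow> complex) \<Rightarrow> real" where
  "Sobolev_norm s f =
     Lp_norm 2 (\<lambda>\<xi>. complex_of_real ((1 + (norm \<xi>)\<^sup>2) powr (s / 2)) * fourier_L2 f \<xi>)"

definition Lp_Sobolev_norm :: "real \<Rightarrow> real \<Rightarrow> ('a::euclidean_space \<Rightarrow> complex) \<Rightarrow> real" where
  "Lp_Sobolev_norm m s f = Lp_norm m f + Sobolev_norm s f"

text \<open>\<open>abs_D a u v\<close>: the function \<open>v \<in> L\<^sup>2\<close> is \<open>|D|\<^sup>a u\<close>. The almost-everywhere quantifier also absorbs
  the convention \<open>0 powr 0 = 0\<close>, which affects only \<open>\<xi> = 0\<close>.\<close>

definition abs_D ::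
  "real \<Rightarrow> ('a::euclidean_space \<Rightarrow> complex) \<Rightarrow> ('a \<Rightarrow> complex) \<Rightarrow> bool" where
  "abs_D a u v \<longleftrightarrow> u \<in> Lp 2 \<and> v \<in> Lp 2 \<and>
     (AE \<xi> in lebesgue. fourier_L2 v \<xi> = complex_of_real (norm \<xi> powr a) * fourier_L2 u \<xi>)"

text \<open>\<open>L2_time_deriv j u v\<close>: on \<open>[0,\<infinity>)\<close> the map \<open>v\<close> is the \<open>j\<close>-th derivative of \<open>t \<mapsto> u t\<close> as a map with
  values in \<open>L\<^sup>2\<close> (one-sided at \<open>t = 0\<close>).\<close>

primrec L2_time_deriv ::
  "nat \<Rightarrow> (real \<Rightarrow> 'a::euclidean_space \<Rightarrow> complex) \<Rightarrow> (real \<Rightarrow> 'a \<Rightarrow> complex) \<Rightarrow> bool" where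
  "L2_time_deriv 0 u v \<longleftrightarrow>
     (\<forall>t\<ge>0. v t \<in> Lp 2 \<and> (AE x in lebesgue. v t x = u t x))"
| "L2_time_deriv (Suc j) u v \<longleftrightarrow>
     (\<exists>z. L2_time_deriv j u z \<and>
       (\<forall>t\<ge>0. v t \<in> Lp 2 \<and>
          tendsto_Lp 2 (\<lambda>s x. (z s x - z t x) / complex_of_real (s - t)) (v t) (at t within {0..})))"


section \<open>The damped \<open>\<sigma>\<close>-evolution equation\<close>

text \<open>The roots of \<open>\<lambda>\<^sup>2 + |\<xi>|\<^bsup>2\<delta>\<^esup> \<lambda> + |\<xi>|\<^bsup>2\<sigma>\<^esup> = 0\<close>, the characteristic equation of
  \<open>w\<^sub>t\<^sub>t + (-\<Delta>)\<^sup>\<sigma> w + (-\<Delta>)\<^sup>\<delta> w\<^sub>t = 0\<close> on the Fourier side. The discriminant may be negative, hence the complex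
  square root.\<close>

definition root1 :: "real \<Rightarrow> real \<Rightarrow> 'a::euclidean_space \<Rightarrow> complex" where
  "root1 \<sigma> \<delta> \<xi> = (- complex_of_real (norm \<xi> powr (2 * \<delta>)) +
     csqrt (complex_of_real (norm \<xi> powr (4 * \<delta>) - 4 * norm \<xi> powr (2 * \<sigma>)))) / 2"

definition root2 :: "real \<Rightarrow> real \<Rightarrow> 'a::euclidean_space \<Rightarrow> complex" where
  "root2 \<sigma> \<delta> \<xi> = (- complex_of_real (norm \<xi> powr (2 * \<delta>)) -
     csqrt (complex_of_real (norm \<xi> powr (4 * \<delta>) - 4 * norm \<xi> powr (2 * \<sigma>)))) / 2"

definition kernel0 :: "real \<Rightarrow> real \<Rightarrow> real \<Rightarrow> 'a::euclidean_space \<Rightarrow> complex" where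
  "kernel0 \<sigma> \<delta> t \<xi> =
     (root1 \<sigma> \<delta> \<xi> * exp (root2 \<sigma> \<delta> \<xi> * of_real t) - root2 \<sigma> \<delta> \<xi> * exp (root1 \<sigma> \<delta> \<xi> * of_real t))
       / (root1 \<sigma> \<delta> \<xi> - root2 \<sigma> \<delta> \<xi>)"

definition kernel1 :: "real \<Rightarrow> real \<Rightarrow> real \<Rightarrow> 'a::euclidean_space \<Rightarrow> complex" where
  "kernel1 \<sigma> \<delta> t \<xi> =
     (exp (root1 \<sigma> \<delta> \<xi> * of_real t) - exp (root2 \<sigma> \<delta> \<xi> * of_real t))
       / (root1 \<sigma> \<delta> \<xi> - root2 \<sigma> \<delta> \<xi>)"

text \<open>The Sobolev solution with data \<open>w0\<close>, \<open>w1\<close>, given by its Fourier representation. For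
  \<open>\<delta> = \<sigma>/2\<close> the two roots coincide only at \<open>\<xi> = 0\<close>, a null set.\<close>

definition Sobolev_solution ::
  "real \<Rightarrow> real \<Rightarrow> ('a::euclidean_space \<Rightarrow> complex) \<Rightarrow> ('a \<Rightarrow> complex) \<Rightarrow>
   (real \<Rightarrow> 'a \<Rightarrow> complex) \<Rightarrow> bool" where
  "Sobolev_solution \<sigma> \<delta> w0 w1 w \<longleftrightarrow>
     (\<forall>t\<ge>0. w t \<in> Lp 2 \<and>
        (AE \<xi> in lebesgue. fourier_L2 (w t) \<xi> =
           kernel0 \<sigma> \<delta> t \<xi> * fourier_L2 w0 \<xi> + kernel1 \<sigma> \<delta> t \<xi> * fourier_L2 w1 \<xi>))"

text \<open>\<open>is_dt_abs_D j a w z\<close>: \<open>z = \<partial>\<^sub>t\<^sup>j |D|\<^sup>a w\<close> (in particular this exists in \<open>L\<^sup>2\<close> for every \<open>t \<ge> 0\<close>).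
  For given \<open>w\<close>, each \<open>z t\<close> with \<open>t \<ge> 0\<close> is determined up to a null set.\<close>

definition is_dt_abs_D ::
  "nat \<Rightarrow> real \<Rightarrow> (real \<Rightarrow> 'a::euclidean_space \<Rightarrow> complex) \<Rightarrow> (real \<Rightarrow> 'a \<Rightarrow> complex) \<Rightarrow> bool" where
  "is_dt_abs_D j a w z \<longleftrightarrow>
     (\<exists>v. (\<forall>t\<ge>0. abs_D a (w t) (v t)) \<and> L2_time_deriv j v z)"

end

theory Submission
  imports Defs "HOL-Probability.Characteristic_Functions"
begin

text \<open>
  On the Fourier side the equation is, for each frequency, a damped oscillator whose only parameter is
  \<open>r = |\<xi>|\<^bsup>\<sigma>\<^esup>\<close>: because \<open>\<delta> = \<sigma> / 2\<close>, both roots are multiples of \<open>r\<close>, with real part \<open>- r / 2\<close>. The kernels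
  therefore decay like \<open>exp (- r t / 2)\<close> at every frequency, and everything follows from trading powers of \<open>r\<close>
  for powers of \<open>1 / (1 + t)\<close>. The inequality \<open>(1 + t) r \<le> (1 + r) (1 + r t)\<close> does this: \<open>|\<xi>| powr b\<close> costs \<open>b\<close>
  derivatives of the data and yields \<open>(1 + t) powr (- b / \<sigma>)\<close>, while part of the exponential absorbs
  \<open>1 + r t\<close> (\<open>norm_powr_damping\<close>, \<open>mult0_bound\<close>, \<open>mult1_bound\<close>). With Plancherel's theorem this already gives the
  \<open>L\<^sup>2\<close>-\<open>L\<^sup>2\<close> estimates.

  The additional decay for data in \<open>L\<^sup>m\<close> comes from low frequencies, where the remaining factor
  \<open>exp (- r t / 4)\<close> concentrates on \<open>|\<xi>| \<le> t powr (- 1 / \<sigma>)\<close>. The usual argument combines the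
  Hausdorff--Young inequality with Hoelder's. Here the target space is always \<open>L\<^sup>2\<close>, so a cruder interpolation
  loses nothing: the datum is split at a height \<open>h\<close>, the large part is estimated from \<open>L\<^sup>1\<close> to
  \<open>L\<^sup>2\<close> with the \<open>L\<^sup>2\<close>-norm of the damping factor, the small part from \<open>L\<^sup>2\<close> to \<open>L\<^sup>2\<close> with its
  supremum, and \<open>h\<close> is chosen to balance the two (\<open>damping_fourier_split\<close>, \<open>damping_fourier_Lm\<close>).

  The first half of the text develops the Fourier transform on \<open>L\<^sup>2\<close>. A Gaussian weight and Fubini's theorem give
  the isometry for bounded continuous integrable functions; dominated limits extend it to \<open>L\<^sup>1 \<inter> L\<^sup>2\<close>
  (\<open>plancherel_L1_L2\<close>), and completeness of \<open>L\<^sup>2\<close> to the Fourier--Plancherel transform (\<open>fourier_L2_norm\<close>).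
  Surjectivity, which is needed to produce \<open>\<partial>\<^sub>t\<^sup>j |D|\<^sup>a w\<close> as a function, follows from the isometry and the
  multiplication formula alone (\<open>fourier_L2_inverse\<close>). The time derivative in \<open>L\<^sup>2\<close> is dominated convergence
  on the Fourier side (\<open>solution_hat_time_derivative\<close>).
\<close>

section \<open>The space of square-integrable functions\<close>

lemma Lp2_iff:
  "f \<in> Lp 2 \<longleftrightarrow> f \<in> borel_measurable lebesgue \<and> integrable lebesgue (\<lambda>x. (norm (f x))\<^sup>2)"
  by (simp add: Lp_def)

lemma Lp2_measurable [measurable_dest]: "f \<in> Lp p \<Longrightarrow> f \<in> borel_measurable lebesgue"
  by (simp add: Lp_def)

lemma Lp_norm_nonneg: "0 \<le> Lp_norm p f"
  by (simp add: Lp_norm_def)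

lemma Lp_norm2_eq: "Lp_norm 2 f = sqrt (integral\<^sup>L lebesgue (\<lambda>x. (norm (f x))\<^sup>2))"
  by (simp add: Lp_norm_def powr_half_sqrt)

lemma Lp_norm2_sq: "(Lp_norm 2 f)\<^sup>2 = integral\<^sup>L lebesgue (\<lambda>x. (norm (f x))\<^sup>2)"
  by (simp add: Lp_norm2_eq)

lemma nn_integral_Lp2:
  assumes "f \<in> Lp 2"
  shows "(\<integral>\<^sup>+x. ennreal ((norm (f x))\<^sup>2) \<partial>lebesgue) = ennreal ((Lp_norm 2 f)\<^sup>2)"
  using assms by (simp add: Lp2_iff Lp_norm2_sq nn_integral_eq_integral)

lemma Lp2_nn_integralI:
  assumes "f \<in> borel_measurable lebesgue" "0 \<le> B"
    and "(\<integral>\<^sup>+x. ennreal ((norm (f x))\<^sup>2) \<partial>lebesgue) \<le> ennreal (B\<^sup>2)"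
  shows "f \<in> Lp 2" "Lp_norm 2 f \<le> B"
proof -
  show f: "f \<in> Lp 2"
    unfolding Lp2_iff
  proof (intro conjI assms(1) integrableI_nonneg)
    show "(\<integral>\<^sup>+x. ennreal ((norm (f x))\<^sup>2) \<partial>lebesgue) < \<infinity>"
      using assms(3) by (rule le_less_trans) simp
  qed (use assms(1) in auto)
  show "Lp_norm 2 f \<le> B"
    using assms(3) unfolding nn_integral_Lp2[OF f]
    by (simp add: Lp_norm_nonneg assms(2))
qed

lemma Lp2_bound:
  assumes "f \<in> Lp 2" "g \<in> borel_measurable lebesgue" "0 \<le> c"
    and "AE x in lebesgue. norm (g x) \<le> c * norm (f x)"
  shows "g \<in> Lp 2" "Lp_norm 2 g \<le> c * Lp_norm 2 f"
proof -
  have "(\<integral>\<^sup>+x. ennreal ((norm (g x))\<^sup>2) \<partial>lebesgue)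
      \<le> (\<integral>\<^sup>+x. ennreal (c\<^sup>2) * ennreal ((norm (f x))\<^sup>2) \<partial>lebesgue)"
    by (rule nn_integral_mono_AE, rule AE_mp[OF assms(4)])
       (auto intro!: AE_I2 ennreal_leI simp: power_mono power_mult_distrib[symmetric]
          ennreal_mult[symmetric])
  also have "\<dots> = ennreal (c\<^sup>2) * ennreal ((Lp_norm 2 f)\<^sup>2)"
    using assms(1) by (subst nn_integral_cmult) (auto simp: nn_integral_Lp2 dest: Lp2_measurable)
  also have "\<dots> = ennreal ((c * Lp_norm 2 f)\<^sup>2)"
    by (simp add: ennreal_mult[symmetric] power_mult_distrib)
  finally have *: "(\<integral>\<^sup>+x. ennreal ((norm (g x))\<^sup>2) \<partial>lebesgue) \<le> ennreal ((c * Lp_norm 2 f)\<^sup>2)" .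
  show "g \<in> Lp 2" "Lp_norm 2 g \<le> c * Lp_norm 2 f"
    using Lp2_nn_integralI[OF assms(2) _ *] assms(3) by (auto simp: Lp_norm_nonneg)
qed

lemma Lp2_cong_AE:
  assumes "f \<in> Lp 2" "g \<in> borel_measurable lebesgue" "AE x in lebesgue. g x = f x"
  shows "g \<in> Lp 2" "Lp_norm 2 g = Lp_norm 2 f"
proof -
  show g: "g \<in> Lp 2"
    by (rule Lp2_bound[OF assms(1,2), of 1]) (use assms(3) in auto)
  show "Lp_norm 2 g = Lp_norm 2 f"
  proof (rule antisym)
    show "Lp_norm 2 g \<le> Lp_norm 2 f"
      using Lp2_bound(2)[OF assms(1,2), of 1] AE_mp[OF assms(3)] by simp
    show "Lp_norm 2 f \<le> Lp_norm 2 g"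
      using Lp2_bound(2)[OF g Lp2_measurable[OF assms(1)], of 1] AE_mp[OF assms(3)] by simp
  qed
qed

lemma Lp2_cmult:
  assumes "f \<in> Lp 2"
  shows "(\<lambda>x. c * f x) \<in> Lp 2" "Lp_norm 2 (\<lambda>x. c * f x) = norm c * Lp_norm 2 f"
proof -
  have [measurable]: "f \<in> borel_measurable lebesgue" using assms by (rule Lp2_measurable)
  show "(\<lambda>x. c * f x) \<in> Lp 2"
    by (rule Lp2_bound(1)[OF assms, of _ "norm c"]) (auto simp: norm_mult)
  show "Lp_norm 2 (\<lambda>x. c * f x) = norm c * Lp_norm 2 f"
    by (simp add: Lp_norm2_eq norm_mult power_mult_distrib real_sqrt_mult)
qed

lemma Lp2_add_mem:
  assumes "f \<in> Lp 2" "g \<in> Lp 2"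
  shows "(\<lambda>x. f x + g x) \<in> Lp 2"
proof -
  have [measurable]: "f \<in> borel_measurable lebesgue" "g \<in> borel_measurable lebesgue"
    using assms by (auto dest: Lp2_measurable)
  have "integrable lebesgue (\<lambda>x. 2 * (norm (f x))\<^sup>2 + 2 * (norm (g x))\<^sup>2)"
    using assms by (auto simp: Lp2_iff)
  then have "integrable lebesgue (\<lambda>x. (norm (f x + g x))\<^sup>2)"
  proof (rule Bochner_Integration.integrable_bound)
    show "AE x in lebesgue. norm ((norm (f x + g x))\<^sup>2) \<le> norm (2 * (norm (f x))\<^sup>2 + 2 * (norm (g x))\<^sup>2)"
    proof (rule AE_I2)
      fix x
      have "(norm (f x + g x))\<^sup>2 \<le> (norm (f x) + norm (g x))\<^sup>2"
        by (intro power_mono norm_triangle_ineq) auto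
      also have "\<dots> \<le> 2 * (norm (f x))\<^sup>2 + 2 * (norm (g x))\<^sup>2"
        using sum_squares_bound[of "norm (f x)" "norm (g x)"] by (simp add: power2_sum)
      finally show "norm ((norm (f x + g x))\<^sup>2) \<le> norm (2 * (norm (f x))\<^sup>2 + 2 * (norm (g x))\<^sup>2)"
        by simp
    qed
  qed auto
  then show ?thesis by (simp add: Lp2_iff)
qed

lemma Lp2_diff_mem:
  assumes "f \<in> Lp 2" "g \<in> Lp 2"
  shows "(\<lambda>x. f x - g x) \<in> Lp 2"
  using Lp2_add_mem[OF assms(1) Lp2_cmult(1)[OF assms(2), of "-1"]] by simp

lemma Lp_norm_minus_commute: "Lp_norm p (\<lambda>x. f x - g x) = Lp_norm p (\<lambda>x. g x - f x)"
  by (simp add: Lp_norm_def norm_minus_commute)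

text \<open>The integral of \<open>(|f| - s |g|)\<^sup>2\<close> is a quadratic polynomial in \<open>s\<close> without negative values, so
  its discriminant is not positive.\<close>

lemma Lp2_Cauchy_Schwarz:
  assumes "f \<in> Lp 2" "g \<in> Lp 2"
  shows "integrable lebesgue (\<lambda>x. f x * g x)"
    and "integral\<^sup>L lebesgue (\<lambda>x. norm (f x) * norm (g x)) \<le> Lp_norm 2 f * Lp_norm 2 g"
    and "norm (integral\<^sup>L lebesgue (\<lambda>x. f x * g x)) \<le> Lp_norm 2 f * Lp_norm 2 g"
proof -
  have [measurable]: "f \<in> borel_measurable lebesgue" "g \<in> borel_measurable lebesgue"
    using assms by (auto dest: Lp2_measurable)
  have sq: "integrable lebesgue (\<lambda>x. (norm (f x))\<^sup>2)" "integrable lebesgue (\<lambda>x. (norm (g x))\<^sup>2)"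
    using assms by (auto simp: Lp2_iff)
  have int: "integrable lebesgue (\<lambda>x. norm (f x) * norm (g x))"
  proof (rule Bochner_Integration.integrable_bound)
    show "integrable lebesgue (\<lambda>x. (norm (f x))\<^sup>2 + (norm (g x))\<^sup>2)" using sq by auto
    show "AE x in lebesgue. norm (norm (f x) * norm (g x)) \<le> norm ((norm (f x))\<^sup>2 + (norm (g x))\<^sup>2)"
    proof (rule AE_I2)
      fix x
      have "norm (f x) * norm (g x) \<le> (norm (f x))\<^sup>2 + (norm (g x))\<^sup>2"
        using sum_squares_bound[of "norm (f x)" "norm (g x)"]
          mult_nonneg_nonneg[OF norm_ge_zero norm_ge_zero, of "f x" "g x"] by linarith
      then show "norm (norm (f x) * norm (g x)) \<le> norm ((norm (f x))\<^sup>2 + (norm (g x))\<^sup>2)"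
        by (simp add: abs_mult)
    qed
  qed auto
  show int': "integrable lebesgue (\<lambda>x. f x * g x)"
    by (rule Bochner_Integration.integrable_bound[OF int]) (auto simp: norm_mult)
  define A C B where "A = (Lp_norm 2 f)\<^sup>2" and "C = (Lp_norm 2 g)\<^sup>2"
    and "B = integral\<^sup>L lebesgue (\<lambda>x. norm (f x) * norm (g x))"
  have B0: "0 \<le> B" unfolding B_def by (rule integral_nonneg_AE) auto
  have quad: "0 \<le> A - 2 * s * B + s\<^sup>2 * C" for s :: real
  proof -
    have "0 \<le> integral\<^sup>L lebesgue (\<lambda>x. (norm (f x) - s * norm (g x))\<^sup>2)"
      by (rule integral_nonneg_AE) auto
    also have "(\<lambda>x. (norm (f x) - s * norm (g x))\<^sup>2)
        = (\<lambda>x. (norm (f x))\<^sup>2 - (2 * s) * (norm (f x) * norm (g x)) + s\<^sup>2 * (norm (g x))\<^sup>2)"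
      by (auto simp: power2_eq_square algebra_simps)
    also have "integral\<^sup>L lebesgue \<dots> = A - 2 * s * B + s\<^sup>2 * C"
      using sq int by (simp add: A_def B_def C_def Lp_norm2_sq)
    finally show ?thesis .
  qed
  have "B\<^sup>2 \<le> A * C"
  proof (cases "C = 0")
    case True
    have "B \<le> 0"
    proof (rule ccontr)
      assume "\<not> B \<le> 0"
      then show False using quad[of "(A + 1) / (2 * B)"] True by (auto simp: field_simps)
    qed
    then show ?thesis using B0 True by simp
  next
    case False
    then have "0 < C" by (simp add: C_def)
    then have "A - 2 * (B / C) * B + (B / C)\<^sup>2 * C = A - B\<^sup>2 / C"
      by (simp add: field_simps power2_eq_square)
    with quad[of "B / C"] have "B\<^sup>2 / C \<le> A" by linarith
    then show ?thesis using \<open>0 < C\<close> by (simp add: field_simps)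
  qed
  then have "B\<^sup>2 \<le> (Lp_norm 2 f * Lp_norm 2 g)\<^sup>2" by (simp add: A_def C_def power_mult_distrib)
  then show *: "integral\<^sup>L lebesgue (\<lambda>x. norm (f x) * norm (g x)) \<le> Lp_norm 2 f * Lp_norm 2 g"
    unfolding B_def by (rule power2_le_imp_le) (auto simp: Lp_norm_nonneg)
  have "norm (integral\<^sup>L lebesgue (\<lambda>x. f x * g x)) \<le> integral\<^sup>L lebesgue (\<lambda>x. norm (f x * g x))"
    by (rule integral_norm_bound)
  then show "norm (integral\<^sup>L lebesgue (\<lambda>x. f x * g x)) \<le> Lp_norm 2 f * Lp_norm 2 g"
    using * by (simp add: norm_mult)
qed

lemma Lp_norm2_triangle:
  assumes "f \<in> Lp 2" "g \<in> Lp 2"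
  shows "Lp_norm 2 (\<lambda>x. f x + g x) \<le> Lp_norm 2 f + Lp_norm 2 g"
proof -
  have [measurable]: "f \<in> borel_measurable lebesgue" "g \<in> borel_measurable lebesgue"
    using assms by (auto dest: Lp2_measurable)
  have sq: "integrable lebesgue (\<lambda>x. (norm (f x))\<^sup>2)" "integrable lebesgue (\<lambda>x. (norm (g x))\<^sup>2)"
    using assms by (auto simp: Lp2_iff)
  have int: "integrable lebesgue (\<lambda>x. norm (f x) * norm (g x))"
    using integrable_norm[OF Lp2_Cauchy_Schwarz(1)[OF assms]] by (simp add: norm_mult)
  have "(Lp_norm 2 (\<lambda>x. f x + g x))\<^sup>2
      \<le> integral\<^sup>L lebesgue (\<lambda>x. (norm (f x))\<^sup>2 + 2 * (norm (f x) * norm (g x)) + (norm (g x))\<^sup>2)"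
    unfolding Lp_norm2_sq
  proof (rule integral_mono)
    show "integrable lebesgue (\<lambda>x. (norm (f x + g x))\<^sup>2)"
      using Lp2_add_mem[OF assms] by (simp add: Lp2_iff)
    show "integrable lebesgue (\<lambda>x. (norm (f x))\<^sup>2 + 2 * (norm (f x) * norm (g x)) + (norm (g x))\<^sup>2)"
      using sq int by auto
    show "(norm (f x + g x))\<^sup>2 \<le> (norm (f x))\<^sup>2 + 2 * (norm (f x) * norm (g x)) + (norm (g x))\<^sup>2" for x
      using power_mono[OF norm_triangle_ineq[of "f x" "g x"], of 2] by (simp add: power2_sum)
  qed
  also have "\<dots> = (Lp_norm 2 f)\<^sup>2 + 2 * integral\<^sup>L lebesgue (\<lambda>x. norm (f x) * norm (g x)) + (Lp_norm 2 g)\<^sup>2"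
    using sq int by (simp add: Lp_norm2_sq)
  also have "\<dots> \<le> (Lp_norm 2 f + Lp_norm 2 g)\<^sup>2"
    using Lp2_Cauchy_Schwarz(2)[OF assms] by (simp add: power2_sum)
  finally show ?thesis by (rule power2_le_imp_le) (simp add: Lp_norm_nonneg)
qed

lemma Lp_norm2_diff_triangle:
  assumes "f \<in> Lp 2" "g \<in> Lp 2" "h \<in> Lp 2"
  shows "Lp_norm 2 (\<lambda>x. f x - h x) \<le> Lp_norm 2 (\<lambda>x. f x - g x) + Lp_norm 2 (\<lambda>x. g x - h x)"
  using Lp_norm2_triangle[OF Lp2_diff_mem[OF assms(1,2)] Lp2_diff_mem[OF assms(2,3)]] by simp

lemma Lp_norm2_le_diff:
  assumes "f \<in> Lp 2" "g \<in> Lp 2"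
  shows "\<bar>Lp_norm 2 f - Lp_norm 2 g\<bar> \<le> Lp_norm 2 (\<lambda>x. f x - g x)"
  using Lp_norm2_triangle[OF Lp2_diff_mem[OF assms] assms(2)]
    Lp_norm2_triangle[OF Lp2_diff_mem[OF assms(2,1)] assms(1)] Lp_norm_minus_commute[of 2 f g]
  by simp

lemma Lp_norm2_tendsto:
  assumes "\<And>n. f n \<in> Lp 2" "g \<in> Lp 2" "((\<lambda>n. Lp_norm 2 (\<lambda>x. f n x - g x)) \<longlongrightarrow> 0) F"
  shows "((\<lambda>n. Lp_norm 2 (f n)) \<longlongrightarrow> Lp_norm 2 g) F"
proof -
  have "((\<lambda>n. Lp_norm 2 (f n) - Lp_norm 2 g) \<longlongrightarrow> 0) F"
    by (rule Lim_null_comparison[OF _ assms(3)])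
       (use Lp_norm2_le_diff[OF assms(1,2)] in \<open>auto intro!: always_eventually\<close>)
  then show ?thesis by (simp add: Lim_null[symmetric])
qed

lemma Lp_norm2_zero_AE:
  assumes "f \<in> Lp 2" "Lp_norm 2 f = 0"
  shows "AE x in lebesgue. f x = 0"
proof -
  have "integral\<^sup>L lebesgue (\<lambda>x. (norm (f x))\<^sup>2) = 0" using assms(2) Lp_norm2_sq[of f] by simp
  then show ?thesis
    using assms(1) by (subst (asm) integral_nonneg_eq_0_iff_AE) (auto simp: Lp2_iff)
qed

lemma Lp2_limit_unique:
  assumes "\<And>n. f n \<in> Lp 2" "g \<in> Lp 2" "h \<in> Lp 2"
    and "((\<lambda>n. Lp_norm 2 (\<lambda>x. f n x - g x)) \<longlongrightarrow> 0) F" "((\<lambda>n. Lp_norm 2 (\<lambda>x. f n x - h x)) \<longlongrightarrow> 0) F"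
    and "F \<noteq> bot"
  shows "AE x in lebesgue. g x = h x"
proof -
  have "((\<lambda>n. Lp_norm 2 (\<lambda>x. f n x - g x) + Lp_norm 2 (\<lambda>x. f n x - h x)) \<longlongrightarrow> 0 + 0) F"
    by (intro tendsto_add assms)
  moreover have "Lp_norm 2 (\<lambda>x. g x - h x) \<le> Lp_norm 2 (\<lambda>x. f n x - g x) + Lp_norm 2 (\<lambda>x. f n x - h x)" for n
    using Lp_norm2_diff_triangle[OF assms(2) assms(1)[of n] assms(3)] Lp_norm_minus_commute[of 2 g]
    by simp
  ultimately have "Lp_norm 2 (\<lambda>x. g x - h x) \<le> 0"
    by (intro tendsto_lowerbound[where F = F]) (auto simp: assms)
  then have "AE x in lebesgue. g x - h x = 0"
    by (intro Lp_norm2_zero_AE Lp2_diff_mem assms) (simp add: Lp_norm_nonneg antisym)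
  then show ?thesis by simp
qed

lemma Lp2_Fatou:
  assumes f: "\<And>n::nat. f n \<in> Lp 2" and g [measurable]: "g \<in> borel_measurable lebesgue"
    and lim: "AE x in lebesgue. (\<lambda>n. f n x) \<longlonglongrightarrow> g x"
    and B: "0 \<le> B" "\<forall>\<^sub>F n in sequentially. Lp_norm 2 (f n) \<le> B"
  shows "g \<in> Lp 2" "Lp_norm 2 g \<le> B"
proof -
  have [measurable]: "f n \<in> borel_measurable lebesgue" for n
    using f by (rule Lp2_measurable)
  have "(\<integral>\<^sup>+x. ennreal ((norm (g x))\<^sup>2) \<partial>lebesgue)
      = (\<integral>\<^sup>+x. liminf (\<lambda>n. ennreal ((norm (f n x))\<^sup>2)) \<partial>lebesgue)"
  proof (rule nn_integral_cong_AE, rule AE_mp[OF lim], rule AE_I2, rule impI)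
    fix x assume "(\<lambda>n. f n x) \<longlonglongrightarrow> g x"
    then have "(\<lambda>n. ennreal ((norm (f n x))\<^sup>2)) \<longlonglongrightarrow> ennreal ((norm (g x))\<^sup>2)"
      by (intro tendsto_ennrealI tendsto_intros)
    then show "ennreal ((norm (g x))\<^sup>2) = liminf (\<lambda>n. ennreal ((norm (f n x))\<^sup>2))"
      by (intro lim_imp_Liminf[symmetric] trivial_limit_sequentially)
  qed
  also have "\<dots> \<le> liminf (\<lambda>n. \<integral>\<^sup>+x. ennreal ((norm (f n x))\<^sup>2) \<partial>lebesgue)"
    by (rule nn_integral_liminf) auto
  also have "\<dots> \<le> ennreal (B\<^sup>2)"
    unfolding nn_integral_Lp2[OF f]
  proof (rule Liminf_le)
    show "\<forall>\<^sub>F n in sequentially. ennreal ((Lp_norm 2 (f n))\<^sup>2) \<le> ennreal (B\<^sup>2)"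
      using B(2) by eventually_elim (intro ennreal_leI power_mono Lp_norm_nonneg)
  qed auto
  finally show "g \<in> Lp 2" "Lp_norm 2 g \<le> B"
    using Lp2_nn_integralI[OF g B(1)] by auto
qed

definition Lp2_Cauchy :: "(nat \<Rightarrow> 'a::euclidean_space \<Rightarrow> complex) \<Rightarrow> bool" where
  "Lp2_Cauchy f \<longleftrightarrow> (\<forall>e>0. \<exists>M. \<forall>m\<ge>M. \<forall>n\<ge>M. Lp_norm 2 (\<lambda>x. f m x - f n x) < e)"

text \<open>Pointwise convergence of a subsequence suffices to identify the \<open>L\<^sup>2\<close>-limit: Fatou's lemma applied to
  \<open>f n - f (r k)\<close> as \<open>k\<close> grows bounds \<open>f n - g\<close> by the Cauchy estimate.\<close>

lemma Lp2_Cauchy_AE_limit: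
  assumes f: "\<And>n. f n \<in> Lp 2" and g [measurable]: "g \<in> borel_measurable lebesgue"
    and C: "Lp2_Cauchy f" and r: "strict_mono r"
    and lim: "AE x in lebesgue. (\<lambda>n. f (r n) x) \<longlonglongrightarrow> g x"
  shows "g \<in> Lp 2" "(\<lambda>n. Lp_norm 2 (\<lambda>x. f n x - g x)) \<longlonglongrightarrow> 0"
proof -
  have [measurable]: "f n \<in> borel_measurable lebesgue" for n
    using f by (rule Lp2_measurable)
  have *: "\<exists>M. \<forall>n\<ge>M. (\<lambda>x. f n x - g x) \<in> Lp 2 \<and> Lp_norm 2 (\<lambda>x. f n x - g x) \<le> e" if "0 < e" for e
  proof -
    from C that obtain M where M: "\<And>m n. m \<ge> M \<Longrightarrow> n \<ge> M \<Longrightarrow> Lp_norm 2 (\<lambda>x. f m x - f n x) < e"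
      unfolding Lp2_Cauchy_def by blast
    show ?thesis
    proof (intro exI[of _ M] allI impI)
      fix n assume "n \<ge> M"
      have "\<forall>\<^sub>F k in sequentially. Lp_norm 2 (\<lambda>x. f n x - f (r k) x) \<le> e"
        using eventually_ge_at_top[of M]
        by eventually_elim (use M \<open>n \<ge> M\<close> seq_suble[OF r] order_trans in \<open>blast intro: less_imp_le\<close>)
      moreover have "AE x in lebesgue. (\<lambda>k. f n x - f (r k) x) \<longlonglongrightarrow> f n x - g x"
        using lim by eventually_elim (intro tendsto_intros)
      ultimately show "(\<lambda>x. f n x - g x) \<in> Lp 2 \<and> Lp_norm 2 (\<lambda>x. f n x - g x) \<le> e"
        using Lp2_Fatou[of "\<lambda>k x. f n x - f (r k) x" "\<lambda>x. f n x - g x" e] that Lp2_diff_mem[OF f f]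
        by simp
    qed
  qed
  from *[of 1] obtain n where "(\<lambda>x. f n x - g x) \<in> Lp 2" by auto
  from Lp2_diff_mem[OF f[of n] this] show "g \<in> Lp 2" by simp
  show "(\<lambda>n. Lp_norm 2 (\<lambda>x. f n x - g x)) \<longlonglongrightarrow> 0"
  proof (rule LIMSEQ_I)
    fix e :: real assume "0 < e"
    with *[of "e/2"] obtain M where "\<forall>n\<ge>M. Lp_norm 2 (\<lambda>x. f n x - g x) \<le> e / 2" by auto
    with \<open>0 < e\<close> show "\<exists>M. \<forall>n\<ge>M. norm (Lp_norm 2 (\<lambda>x. f n x - g x) - 0) < e"
      by (intro exI[of _ M]) (force simp: Lp_norm_nonneg)
  qed
qed

text \<open>Along a subsequence with increments \<open>d\<^sub>k\<close> of norm at most \<open>2 ^ - k\<close> the weighted sum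
  \<open>\<Sum>k. 2 ^ k * |d\<^sub>k|\<^sup>2\<close> has finite integral, so it is finite almost everywhere; then \<open>|d\<^sub>k|\<close> is
  bounded by a multiple of \<open>2 ^ (- k / 2)\<close> and the subsequence converges pointwise.\<close>

theorem Lp2_complete:
  assumes f: "\<And>n. f n \<in> Lp 2" and C: "Lp2_Cauchy f"
  obtains g where "g \<in> Lp 2" "(\<lambda>n. Lp_norm 2 (\<lambda>x. f n x - g x)) \<longlonglongrightarrow> 0"
proof -
  have [measurable]: "f n \<in> borel_measurable lebesgue" for n
    using f by (rule Lp2_measurable)
  have "\<exists>M. \<forall>m\<ge>M. \<forall>n\<ge>M. Lp_norm 2 (\<lambda>x. f m x - f n x) < (1/2)^k" for k :: nat
    using C unfolding Lp2_Cauchy_def by simp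
  then obtain M where M: "\<And>k m n. m \<ge> M k \<Longrightarrow> n \<ge> M k \<Longrightarrow> Lp_norm 2 (\<lambda>x. f m x - f n x) < (1/2)^k"
    by metis
  define r where "r = rec_nat (M 0) (\<lambda>k p. max (Suc p) (M (Suc k)))"
  have r_Suc: "r (Suc k) = max (Suc (r k)) (M (Suc k))" for k by (simp add: r_def)
  have r: "strict_mono r" by (rule strict_monoI_Suc) (simp add: r_Suc)
  have rM: "r k \<ge> M k" for k by (cases k) (simp_all add: r_Suc, simp add: r_def)
  define d where "d k x = f (r (Suc k)) x - f (r k) x" for k x
  have [measurable]: "d k \<in> borel_measurable lebesgue" for k
    unfolding d_def by measurable
  have dL: "d k \<in> Lp 2" for k unfolding d_def by (intro Lp2_diff_mem f)
  have dN: "Lp_norm 2 (d k) \<le> (1/2)^k" for k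
    unfolding d_def using M[of k "r (Suc k)" "r k"] rM[of k] r
    by (meson less_imp_le order_trans strict_mono_less_eq le_SucI order_refl)
  have "(\<integral>\<^sup>+x. (\<Sum>k. ennreal (2^k * (norm (d k x))\<^sup>2)) \<partial>lebesgue)
      = (\<Sum>k. \<integral>\<^sup>+x. ennreal (2^k * (norm (d k x))\<^sup>2) \<partial>lebesgue)"
    by (rule nn_integral_suminf) auto
  also have "\<dots> \<le> (\<Sum>k. ennreal ((1/2)^k))"
  proof (intro suminf_le)
    fix k
    have "(\<integral>\<^sup>+x. ennreal (2^k * (norm (d k x))\<^sup>2) \<partial>lebesgue) = 2^k * ennreal ((Lp_norm 2 (d k))\<^sup>2)"
      using nn_integral_Lp2[OF dL[of k]]
      by (simp add: ennreal_mult nn_integral_cmult ennreal_power[symmetric])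
    also have "\<dots> \<le> 2^k * ennreal (((1/2)^k)\<^sup>2)"
      by (intro mult_left_mono ennreal_leI power_mono dN Lp_norm_nonneg) auto
    also have "\<dots> = ennreal (2^k * ((1/2)^k)\<^sup>2)"
      by (simp add: ennreal_mult ennreal_power[symmetric])
    also have "2^k * ((1/2::real)^k)\<^sup>2 = (1/2)^k"
      by (simp add: power2_eq_square power_divide)
    finally show "(\<integral>\<^sup>+x. ennreal (2^k * (norm (d k x))\<^sup>2) \<partial>lebesgue) \<le> ennreal ((1/2)^k)" .
  qed auto
  also have "\<dots> = ennreal (\<Sum>k. (1/2)^k)" by (intro suminf_ennreal2) auto
  also have "\<dots> < \<infinity>" by simp
  finally have "(\<integral>\<^sup>+x. (\<Sum>k. ennreal (2^k * (norm (d k x))\<^sup>2)) \<partial>lebesgue) \<noteq> \<infinity>" by simp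
  then have "AE x in lebesgue. (\<Sum>k. ennreal (2^k * (norm (d k x))\<^sup>2)) \<noteq> \<infinity>"
    by (intro nn_integral_noteq_infinite) auto
  then have conv: "AE x in lebesgue. convergent (\<lambda>k. f (r k) x)"
  proof eventually_elim
    case (elim x)
    then have "summable (\<lambda>k. 2^k * (norm (d k x))\<^sup>2)"
      by (intro summable_suminf_not_top) auto
    then have "Bseq (\<lambda>k. 2^k * (norm (d k x))\<^sup>2)"
      by (intro convergent_imp_Bseq) (auto simp: convergent_def dest: summable_LIMSEQ_zero)
    then obtain K where K: "0 < K" "\<And>k. norm (2^k * (norm (d k x))\<^sup>2) \<le> K"
      by (auto elim: BseqE)
    have "norm (d k x) \<le> sqrt K * (sqrt (1/2))^k" for k
    proof (rule power2_le_imp_le)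
      have "(sqrt K * (sqrt (1/2))^k)\<^sup>2 = K * (1/2)^k"
        using K(1) by (simp add: power_mult_distrib power2_eq_square flip: real_sqrt_power)
           (simp flip: real_sqrt_mult power_add)
      moreover have "(norm (d k x))\<^sup>2 \<le> K * (1/2)^k"
        using K(2)[of k] by (simp add: abs_mult field_simps power_divide)
      ultimately show "(norm (d k x))\<^sup>2 \<le> (sqrt K * (sqrt (1/2))^k)\<^sup>2" by simp
    qed (use K(1) in auto)
    moreover have "summable (\<lambda>k. sqrt K * (sqrt (1/2))^k)"
      by (intro summable_mult summable_geometric) (simp add: real_sqrt_divide)
    ultimately have "summable (\<lambda>k. d k x)"
      using summable_comparison_test'[of "\<lambda>k. sqrt K * (sqrt (1/2))^k" 0 "\<lambda>k. d k x"] by blast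
    then have "convergent (\<lambda>n. \<Sum>k<n. d k x)" by (simp add: summable_iff_convergent)
    moreover have "(\<Sum>k<n. d k x) = f (r n) x - f (r 0) x" for n
      unfolding d_def by (rule sum_lessThan_telescope)
    ultimately have "convergent (\<lambda>n. (f (r n) x - f (r 0) x) + f (r 0) x)"
      by (intro convergent_add convergent_const) simp
    then show "convergent (\<lambda>k. f (r k) x)" by simp
  qed
  define g where "g x = lim (\<lambda>k. f (r k) x)" for x
  have g: "g \<in> borel_measurable lebesgue"
    unfolding g_def by (rule borel_measurable_lim_metric) auto
  have "AE x in lebesgue. (\<lambda>k. f (r k) x) \<longlonglongrightarrow> g x"
    using conv by eventually_elim (simp add: g_def convergent_LIMSEQ_iff)
  from Lp2_Cauchy_AE_limit[OF f g C r this] that show thesis by blast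
qed

lemma Lp2_dominated_convergence:
  assumes f: "\<And>n::nat. f n \<in> borel_measurable lebesgue" and g: "g \<in> borel_measurable lebesgue"
    and h: "h \<in> Lp 2" and bound: "\<And>n. AE x in lebesgue. norm (f n x) \<le> norm (h x)"
    and lim: "AE x in lebesgue. (\<lambda>n. f n x) \<longlonglongrightarrow> g x"
  shows "g \<in> Lp 2" "(\<lambda>n. Lp_norm 2 (\<lambda>x. f n x - g x)) \<longlonglongrightarrow> 0"
proof -
  note [measurable] = f g Lp2_measurable[OF h]
  have "AE x in lebesgue. \<forall>n. norm (f n x) \<le> norm (h x)" using bound by (simp add: AE_all_countable)
  with lim have gh: "AE x in lebesgue. norm (g x) \<le> norm (h x)"
  proof eventually_elim
    case (elim x)
    then show ?case by (intro LIMSEQ_le_const2[OF tendsto_norm[OF elim(1)]]) auto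
  qed
  then show "g \<in> Lp 2" by (intro Lp2_bound(1)[OF h g, of 1]) auto
  have "(\<lambda>n. integral\<^sup>L lebesgue (\<lambda>x. (norm (f n x - g x))\<^sup>2)) \<longlonglongrightarrow> integral\<^sup>L lebesgue (\<lambda>x::'a. 0::real)"
  proof (rule integral_dominated_convergence[where w = "\<lambda>x. 4 * (norm (h x))\<^sup>2"])
    show "integrable lebesgue (\<lambda>x. 4 * (norm (h x))\<^sup>2)" using h by (auto simp: Lp2_iff)
    show "AE x in lebesgue. (\<lambda>n. (norm (f n x - g x))\<^sup>2) \<longlonglongrightarrow> 0"
      using lim by eventually_elim (auto intro!: tendsto_eq_intros simp: LIM_zero)
    show "AE x in lebesgue. norm ((norm (f n x - g x))\<^sup>2) \<le> 4 * (norm (h x))\<^sup>2" for n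
      using bound[of n] gh
    proof eventually_elim
      case (elim x)
      then have "norm (f n x - g x) \<le> 2 * norm (h x)"
        using norm_triangle_ineq4[of "f n x" "g x"] by linarith
      then show ?case using power_mono[of "norm (f n x - g x)" "2 * norm (h x)" 2] by (simp add: power_mult_distrib)
    qed
  qed auto
  then have "(\<lambda>n. sqrt (integral\<^sup>L lebesgue (\<lambda>x. (norm (f n x - g x))\<^sup>2))) \<longlonglongrightarrow> sqrt 0"
    by (intro tendsto_real_sqrt) simp
  then show "(\<lambda>n. Lp_norm 2 (\<lambda>x. f n x - g x)) \<longlonglongrightarrow> 0" by (simp add: Lp_norm2_eq)
qed

lemma Lp2_integral_mult_tendsto:
  assumes "\<And>n. f n \<in> Lp 2" "g \<in> Lp 2" "h \<in> Lp 2"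
    and "((\<lambda>n. Lp_norm 2 (\<lambda>x. f n x - g x)) \<longlongrightarrow> 0) F"
  shows "((\<lambda>n. integral\<^sup>L lebesgue (\<lambda>x. f n x * h x)) \<longlongrightarrow> integral\<^sup>L lebesgue (\<lambda>x. g x * h x)) F"
proof -
  have "((\<lambda>n. integral\<^sup>L lebesgue (\<lambda>x. f n x * h x) - integral\<^sup>L lebesgue (\<lambda>x. g x * h x)) \<longlongrightarrow> 0) F"
  proof (rule Lim_null_comparison)
    show "((\<lambda>n. Lp_norm 2 (\<lambda>x. f n x - g x) * Lp_norm 2 h) \<longlongrightarrow> 0) F"
      using tendsto_mult_left_zero[OF assms(4)] .
    show "\<forall>\<^sub>F n in F. norm (integral\<^sup>L lebesgue (\<lambda>x. f n x * h x) - integral\<^sup>L lebesgue (\<lambda>x. g x * h x))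
       \<le> Lp_norm 2 (\<lambda>x. f n x - g x) * Lp_norm 2 h"
    proof (rule always_eventually, rule allI)
      fix n
      have "integral\<^sup>L lebesgue (\<lambda>x. f n x * h x) - integral\<^sup>L lebesgue (\<lambda>x. g x * h x)
          = integral\<^sup>L lebesgue (\<lambda>x. (f n x - g x) * h x)"
        using Lp2_Cauchy_Schwarz(1)[OF assms(1)[of n] assms(3)] Lp2_Cauchy_Schwarz(1)[OF assms(2,3)]
        by (simp add: left_diff_distrib)
      then show "norm (integral\<^sup>L lebesgue (\<lambda>x. f n x * h x) - integral\<^sup>L lebesgue (\<lambda>x. g x * h x))
       \<le> Lp_norm 2 (\<lambda>x. f n x - g x) * Lp_norm 2 h"
        using Lp2_Cauchy_Schwarz(3)[OF Lp2_diff_mem[OF assms(1)[of n] assms(2)] assms(3)] by simp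
    qed
  qed
  then show ?thesis by (simp add: Lim_null[symmetric])
qed

lemma tendsto_Lp2I:
  assumes "\<And>k. u k \<in> Lp 2" "l \<in> Lp 2" "((\<lambda>k. Lp_norm 2 (\<lambda>x. u k x - l x)) \<longlongrightarrow> 0) F"
  shows "tendsto_Lp 2 u l F"
  unfolding tendsto_Lp_def using Lp2_diff_mem[OF assms(1,2)] assms(3) by simp

section \<open>Gaussian integrals and the Fubini theorem for bounded kernels\<close>

lemma lborel_nn_integral_affine:
  fixes f :: "'a::euclidean_space \<Rightarrow> ennreal"
  assumes [measurable]: "f \<in> borel_measurable borel" and "c \<noteq> 0"
  shows "(\<integral>\<^sup>+x. f x \<partial>lborel) = ennreal (\<bar>c\<bar> ^ DIM('a)) * (\<integral>\<^sup>+x. f (t + c *\<^sub>R x) \<partial>lborel)"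
  by (subst lborel_affine[OF assms(2), of t])
     (simp add: nn_integral_density nn_integral_distr nn_integral_cmult)

lemma lborel_integral_affine:
  fixes f :: "'a::euclidean_space \<Rightarrow> complex"
  assumes [measurable]: "f \<in> borel_measurable borel" and "c \<noteq> 0"
  shows "integral\<^sup>L lborel f = of_real (\<bar>c\<bar> ^ DIM('a)) * (\<integral>x. f (t + c *\<^sub>R x) \<partial>lborel)"
  by (subst lborel_affine[OF assms(2), of t])
     (simp add: integral_density integral_distr scaleR_conv_of_real)

text \<open>Lebesgue measure is the image of a product measure indexed by the basis, so integrals of products of
  one-variable functions factorise.\<close>

lemma lborel_integral_prod:
  fixes f :: "'a::euclidean_space \<Rightarrow> real \<Rightarrow> complex"
  assumes "\<And>b. b \<in> Basis \<Longrightarrow> integrable lborel (f b)"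
  shows "integrable lborel (\<lambda>x. \<Prod>b\<in>Basis. f b (x \<bullet> b))"
    and "(\<integral>x. (\<Prod>b\<in>Basis. f b (x \<bullet> b)) \<partial>lborel) = (\<Prod>b\<in>Basis. integral\<^sup>L lborel (f b))"
proof -
  interpret product_sigma_finite "\<lambda>b::'a. lborel :: real measure" ..
  have [measurable]: "b \<in> Basis \<Longrightarrow> f b \<in> borel_measurable borel" for b
    using assms[of b] by (auto dest: borel_measurable_integrable)
  have T: "(\<lambda>g. \<Sum>b\<in>Basis. g b *\<^sub>R b) \<in> measurable (\<Pi>\<^sub>M b\<in>(Basis::'a set). lborel) (borel :: 'a measure)"
    by measurable
  have P: "(\<lambda>x::'a. \<Prod>b\<in>Basis. f b (x \<bullet> b)) \<in> borel_measurable borel" by measurable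
  have eq: "(\<Prod>b\<in>Basis. f b ((\<Sum>b'\<in>Basis. g b' *\<^sub>R b') \<bullet> b)) = (\<Prod>b\<in>Basis. f b (g b))" for g :: "'a \<Rightarrow> real"
    by (intro prod.cong) (simp_all add: inner_sum_left_Basis)
  show "integrable lborel (\<lambda>x. \<Prod>b\<in>Basis. f b (x \<bullet> b))"
    unfolding lborel_eq[where 'a='a] integrable_distr_eq[OF T P] eq
    by (rule product_integrable_prod) (use assms in auto)
  show "(\<integral>x. (\<Prod>b\<in>Basis. f b (x \<bullet> b)) \<partial>lborel) = (\<Prod>b\<in>Basis. integral\<^sup>L lborel (f b))"
    unfolding lborel_eq[where 'a='a] integral_distr[OF T P] eq
    by (rule product_integral_prod) (use assms in auto)
qed

text \<open>This is the characteristic function of the standard normal distribution without its normalisation.\<close>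

lemma gaussian_fourier_1d:
  fixes z :: real
  shows "integrable lborel (\<lambda>x. cis (z * x) * of_real (exp (- x\<^sup>2 / 2)))"
    and "(\<integral>x. cis (z * x) * of_real (exp (- x\<^sup>2 / 2)) \<partial>lborel) = of_real (sqrt (2 * pi) * exp (- z\<^sup>2 / 2))"
proof -
  have "integrable lborel (\<lambda>x. sqrt (2 * pi) * std_normal_density x)"
    by (intro integrable_mult_right) simp
  then have *: "integrable lborel (\<lambda>x::real. exp (- x\<^sup>2 / 2))" by (simp add: std_normal_density_def)
  show "integrable lborel (\<lambda>x. cis (z * x) * of_real (exp (- x\<^sup>2 / 2)))"
    by (rule Bochner_Integration.integrable_bound[OF *])
       (auto simp: norm_mult cis_conv_exp)
  have "(\<integral>x. cis (z * x) * of_real (exp (- x\<^sup>2 / 2)) \<partial>lborel)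
      = (\<integral>x. of_real (sqrt (2 * pi)) * (std_normal_density x *\<^sub>R iexp (z * x)) \<partial>lborel)"
    by (rule Bochner_Integration.integral_cong)
       (auto simp: std_normal_density_def scaleR_conv_of_real cis_conv_exp mult_ac)
  also have "\<dots> = of_real (sqrt (2 * pi)) * (\<integral>x. std_normal_density x *\<^sub>R iexp (z * x) \<partial>lborel)"
    by (rule integral_mult_right_zero)
  also have "\<dots> = of_real (sqrt (2 * pi)) * char std_normal_distribution z"
    unfolding char_def by (subst integral_density) (auto simp: normal_density_nonneg)
  finally show "(\<integral>x. cis (z * x) * of_real (exp (- x\<^sup>2 / 2)) \<partial>lborel) = of_real (sqrt (2 * pi) * exp (- z\<^sup>2 / 2))"
    by (simp add: char_std_normal_distribution)
qed

lemma gaussian_fourier: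
  fixes z :: "'a::euclidean_space"
  shows "integrable lborel (\<lambda>x. cis (z \<bullet> x) * of_real (exp (- (norm x)\<^sup>2 / 2)))"
    and "(\<integral>x. cis (z \<bullet> x) * of_real (exp (- (norm x)\<^sup>2 / 2)) \<partial>lborel)
          = of_real (sqrt (2 * pi) ^ DIM('a) * exp (- (norm z)\<^sup>2 / 2))"
proof -
  have sq: "(norm x)\<^sup>2 = (\<Sum>b\<in>Basis. (x \<bullet> b)\<^sup>2)" for x :: 'a
    unfolding power2_norm_eq_inner euclidean_inner[of x x] by (simp add: power2_eq_square)
  have eq: "cis (z \<bullet> x) * of_real (exp (- (norm x)\<^sup>2 / 2))
      = (\<Prod>b\<in>Basis. cis ((z \<bullet> b) * (x \<bullet> b)) * of_real (exp (- (x \<bullet> b)\<^sup>2 / 2)))" for x :: 'a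
    unfolding sq euclidean_inner[of z x] cis_conv_exp
    by (simp add: prod.distrib sum_distrib_left exp_sum sum_negf[symmetric] sum_divide_distrib)
  show "integrable lborel (\<lambda>x. cis (z \<bullet> x) * of_real (exp (- (norm x)\<^sup>2 / 2)))"
    unfolding eq by (rule lborel_integral_prod(1)[where f="\<lambda>b x. cis ((z \<bullet> b) * x) * of_real (exp (- x\<^sup>2 / 2))"])
       (rule gaussian_fourier_1d)
  have "(\<integral>x. cis (z \<bullet> x) * of_real (exp (- (norm x)\<^sup>2 / 2)) \<partial>lborel)
      = (\<Prod>b\<in>Basis. of_real (sqrt (2 * pi) * exp (- (z \<bullet> b)\<^sup>2 / 2)))"
    unfolding eq
    by (subst lborel_integral_prod(2)[where f="\<lambda>b x. cis ((z \<bullet> b) * x) * of_real (exp (- x\<^sup>2 / 2))"])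
       (simp_all only: gaussian_fourier_1d)
  also have "\<dots> = of_real (sqrt (2 * pi) ^ DIM('a) * exp (- (norm z)\<^sup>2 / 2))"
    unfolding sq by (simp add: prod.distrib exp_sum sum_negf[symmetric] sum_divide_distrib)
  finally show "(\<integral>x. cis (z \<bullet> x) * of_real (exp (- (norm x)\<^sup>2 / 2)) \<partial>lborel)
          = of_real (sqrt (2 * pi) ^ DIM('a) * exp (- (norm z)\<^sup>2 / 2))" .
qed

lemma gaussian_integrable:
  "integrable lborel (\<lambda>x::'a::euclidean_space. complex_of_real (exp (- (norm x)\<^sup>2 / 2)))"
  using gaussian_fourier(1)[of 0] by simp

lemma gaussian_integrable_scaled:
  assumes "k > 0"
  shows "integrable lborel (\<lambda>x::'a::euclidean_space. complex_of_real (exp (- (norm x / k)\<^sup>2 / 2)))"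
proof -
  have "(\<integral>\<^sup>+x. ennreal (exp (- (norm (x::'a))\<^sup>2 / 2)) \<partial>lborel) < \<infinity>"
    using gaussian_integrable[where 'a='a] unfolding integrable_iff_bounded by simp
  then have "(\<integral>\<^sup>+x. ennreal (exp (- (norm (x::'a) / k)\<^sup>2 / 2)) \<partial>lborel) < \<infinity>"
    using lborel_nn_integral_affine[of "\<lambda>x::'a. ennreal (exp (- (norm x / k)\<^sup>2 / 2))" k 0] assms
    by (simp add: ennreal_mult_less_top)
  then show ?thesis unfolding integrable_iff_bounded by simp
qed

lemma gaussian_fourier_scaled:
  fixes z :: "'a::euclidean_space"
  assumes "k > 0"
  shows "(\<integral>x. cis (z \<bullet> x) * of_real (exp (- (norm x / k)\<^sup>2 / 2)) \<partial>lborel)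
          = of_real (k ^ DIM('a) * (sqrt (2 * pi) ^ DIM('a) * exp (- (k * norm z)\<^sup>2 / 2)))"
  using lborel_integral_affine[of "\<lambda>x. cis (z \<bullet> x) * of_real (exp (- (norm x / k)\<^sup>2 / 2))" k 0]
    gaussian_fourier(2)[of "k *\<^sub>R z"] assms
  by (simp add: cis_conv_exp)

lemma Fubini_bounded_kernel:
  fixes f g :: "'a::euclidean_space \<Rightarrow> complex"
  assumes f: "integrable lborel f" and g: "integrable lborel g"
    and K [measurable]: "case_prod K \<in> borel_measurable (lborel \<Otimes>\<^sub>M lborel)" and K1: "\<And>x y. norm (K x y) \<le> 1"
  shows "(\<integral>x. f x * (\<integral>y. K x y * g y \<partial>lborel) \<partial>lborel) = (\<integral>y. g y * (\<integral>x. K x y * f x \<partial>lborel) \<partial>lborel)"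
proof -
  note [measurable] = borel_measurable_integrable[OF f] borel_measurable_integrable[OF g]
  have "integrable (lborel \<Otimes>\<^sub>M lborel) (\<lambda>(x, y). f x * g y)"
  proof (rule lborel_pair.Fubini_integrable)
    show "integrable lborel (\<lambda>x. \<integral>y. norm (case (x, y) of (x, y) \<Rightarrow> f x * g y) \<partial>lborel)"
      using f by (simp add: norm_mult)
    show "AE x in lborel. integrable lborel (\<lambda>y. case (x, y) of (x, y) \<Rightarrow> f x * g y)"
      using g by simp
  qed simp
  then have int: "integrable (lborel \<Otimes>\<^sub>M lborel) (\<lambda>(x, y). f x * (K x y * g y))"
  proof (rule Bochner_Integration.integrable_bound)
    show "AE p in lborel \<Otimes>\<^sub>M lborel. norm (case p of (x, y) \<Rightarrow> f x * (K x y * g y))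
        \<le> norm (case p of (x, y) \<Rightarrow> f x * g y)"
      using K1 by (auto intro!: AE_I2 mult_left_mono mult_left_le_one_le simp: norm_mult)
  qed measurable
  have "(\<integral>x. f x * (\<integral>y. K x y * g y \<partial>lborel) \<partial>lborel) = (\<integral>x. (\<integral>y. f x * (K x y * g y) \<partial>lborel) \<partial>lborel)"
    by simp
  also have "\<dots> = (\<integral>y. (\<integral>x. f x * (K x y * g y) \<partial>lborel) \<partial>lborel)"
    by (rule lborel_pair.Fubini_integral[OF int, symmetric])
  also have "\<dots> = (\<integral>y. (\<integral>x. g y * (K x y * f x) \<partial>lborel) \<partial>lborel)"
    by (simp add: mult_ac)
  finally show ?thesis by simp
qed

section \<open>The Fourier integral of integrable functions\<close>

definition fourier_const :: "nat \<Rightarrow> real" where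
  "fourier_const n = 1 / sqrt (2 * pi) ^ n"

lemma fourier_const_pos: "0 < fourier_const n"
  by (simp add: fourier_const_def)

lemma fourier_const_eq: "(2 * pi) powr (- real n / 2) = fourier_const n"
proof -
  have "(2 * pi) powr (- real n / 2) = ((2 * pi) powr (1/2)) powr (- real n)"
    by (simp add: powr_powr)
  also have "(2 * pi) powr (1/2) = sqrt (2 * pi)" by (rule powr_half_sqrt) simp
  also have "sqrt (2 * pi) powr (- real n) = inverse (sqrt (2 * pi) ^ n)"
    unfolding powr_minus by (subst powr_realpow) simp_all
  also have "\<dots> = fourier_const n" by (simp only: fourier_const_def inverse_eq_divide)
  finally show ?thesis .
qed

lemma fourier_integral_def':
  "fourier_integral f \<xi> = of_real (fourier_const DIM('a)) *
     integral\<^sup>L lebesgue (\<lambda>x. cis (- (x \<bullet> \<xi>)) * f (x::'a::euclidean_space))"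
  unfolding fourier_integral_def fourier_const_eq ..

lemma cis_inner_measurable [measurable]:
  "(\<lambda>x::'a::euclidean_space. cis (- (x \<bullet> \<xi>))) \<in> borel_measurable borel"
  "(\<lambda>x::'a::euclidean_space. cis (x \<bullet> \<xi>)) \<in> borel_measurable borel"
  "(\<lambda>x::'a::euclidean_space. cis (\<xi> \<bullet> x)) \<in> borel_measurable borel"
  "(\<lambda>(x::'a::euclidean_space, y::'a). cis (- (x \<bullet> y))) \<in> borel_measurable (borel \<Otimes>\<^sub>M borel)"
  "(\<lambda>(x::'a::euclidean_space, y::'a). cis (x \<bullet> y)) \<in> borel_measurable (borel \<Otimes>\<^sub>M borel)"
  unfolding cis_conv_exp by measurable

lemma fourier_integrand_integrable:
  fixes f :: "'a::euclidean_space \<Rightarrow> complex"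
  assumes "integrable lebesgue f"
  shows "integrable lebesgue (\<lambda>x. cis (- (x \<bullet> \<xi>)) * f x)"
proof (rule Bochner_Integration.integrable_bound[OF assms])
  have "(\<lambda>x. cis (- (x \<bullet> \<xi>))) \<in> borel_measurable lebesgue"
    by (rule measurable_completion) simp
  then show "(\<lambda>x. cis (- (x \<bullet> \<xi>)) * f x) \<in> borel_measurable lebesgue"
    using borel_measurable_integrable[OF assms] by (rule borel_measurable_times)
qed (simp add: norm_mult)

lemma fourier_integral_diff:
  fixes f g :: "'a::euclidean_space \<Rightarrow> complex"
  assumes "integrable lebesgue f" "integrable lebesgue g"
  shows "fourier_integral (\<lambda>x. f x - g x) = (\<lambda>\<xi>. fourier_integral f \<xi> - fourier_integral g \<xi>)"
  using fourier_integrand_integrable[OF assms(1)] fourier_integrand_integrable[OF assms(2)]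
  by (auto simp: fourier_integral_def' right_diff_distrib)

lemma fourier_integral_bound:
  fixes f :: "'a::euclidean_space \<Rightarrow> complex"
  shows "norm (fourier_integral f \<xi>) \<le> fourier_const DIM('a) * (\<integral>x. norm (f x) \<partial>lebesgue)"
proof -
  have "norm (integral\<^sup>L lebesgue (\<lambda>x. cis (- (x \<bullet> \<xi>)) * f x)) \<le> (\<integral>x. norm (cis (- (x \<bullet> \<xi>)) * f x) \<partial>lebesgue)"
    by (rule integral_norm_bound)
  then show ?thesis
    using fourier_const_pos[of "DIM('a)"] by (simp add: fourier_integral_def' norm_mult)
qed

text \<open>Fubini's theorem asks for measurability on the product of the Borel algebras. Passing to a Borel
  representative makes it applicable to Lebesgue measurable functions.\<close>

lemma borel_representative:
  fixes f :: "'a::euclidean_space \<Rightarrow> complex"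
  assumes "f \<in> borel_measurable lebesgue"
  obtains g where "g \<in> borel_measurable borel" "AE x in lebesgue. f x = g x"
proof -
  have "(\<lambda>x. Re (f x)) \<in> borel_measurable lebesgue" "(\<lambda>x. Im (f x)) \<in> borel_measurable lebesgue"
    using assms by auto
  then obtain u v where u: "u \<in> borel_measurable lborel" "AE x in lborel. Re (f x) = u x"
    and v: "v \<in> borel_measurable lborel" "AE x in lborel. Im (f x) = v x"
    by (blast dest: completion_ex_borel_measurable_real)
  show thesis
  proof (rule that[of "\<lambda>x. Complex (u x) (v x)"])
    show "(\<lambda>x. Complex (u x) (v x)) \<in> borel_measurable borel"
      using u(1) v(1) by (subst borel_measurable_complex_iff) simp
    have "AE x in lborel. f x = Complex (u x) (v x)"
      using u(2) v(2) by eventually_elim (simp add: complex_eq_iff)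
    then show "AE x in lebesgue. f x = Complex (u x) (v x)" by (rule AE_completion)
  qed
qed

lemma fourier_integral_cong_AE:
  fixes f :: "'a::euclidean_space \<Rightarrow> complex"
  assumes "f \<in> borel_measurable lebesgue" "g \<in> borel_measurable lebesgue" "AE x in lebesgue. f x = g x"
  shows "fourier_integral f = fourier_integral g"
proof -
  have "(\<lambda>x. cis (- (x \<bullet> \<xi>))) \<in> borel_measurable lebesgue" for \<xi> :: 'a
    by (rule measurable_completion) simp
  moreover have "AE x in lebesgue. cis (- (x \<bullet> \<xi>)) * f x = cis (- (x \<bullet> \<xi>)) * g x" for \<xi> :: 'a
    using assms(3) by eventually_elim simp
  ultimately have "integral\<^sup>L lebesgue (\<lambda>x. cis (- (x \<bullet> \<xi>)) * f x) = integral\<^sup>L lebesgue (\<lambda>x. cis (- (x \<bullet> \<xi>)) * g x)" for \<xi> :: 'a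
    by (intro integral_cong_AE borel_measurable_times assms)
  then show ?thesis by (simp add: fourier_integral_def' fun_eq_iff)
qed

lemma fourier_integral_borel:
  fixes f :: "'a::euclidean_space \<Rightarrow> complex"
  assumes [measurable]: "f \<in> borel_measurable borel"
  shows "fourier_integral f \<xi> = of_real (fourier_const DIM('a)) * (\<integral>x. cis (- (x \<bullet> \<xi>)) * f x \<partial>lborel)"
  unfolding fourier_integral_def' by (subst integral_completion) auto

lemma fourier_integral_measurable:
  fixes f :: "'a::euclidean_space \<Rightarrow> complex"
  assumes "f \<in> borel_measurable lebesgue"
  shows "fourier_integral f \<in> borel_measurable borel"
proof -
  obtain g where [measurable]: "g \<in> borel_measurable borel" and g: "AE x in lebesgue. f x = g x"
    using borel_representative[OF assms] .
  have [measurable]: "(\<lambda>(\<xi>, x). cis (- (x \<bullet> \<xi>)) * g x) \<in> borel_measurable (borel \<Otimes>\<^sub>M lborel)"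
    unfolding cis_conv_exp by measurable
  have "fourier_integral f = fourier_integral g"
    by (rule fourier_integral_cong_AE[OF assms measurable_completion g]) simp
  also have "\<dots> = (\<lambda>\<xi>. of_real (fourier_const DIM('a)) * (\<integral>x. cis (- (x \<bullet> \<xi>)) * g x \<partial>lborel))"
    by (rule ext, rule fourier_integral_borel) simp
  also have "\<dots> \<in> borel_measurable borel"
    by (intro borel_measurable_times borel_measurable_const lborel.borel_measurable_lebesgue_integral) simp
  finally show ?thesis .
qed

lemma fourier_integral_measurable_lebesgue:
  fixes f :: "'a::euclidean_space \<Rightarrow> complex"
  assumes "f \<in> borel_measurable lebesgue"
  shows "fourier_integral f \<in> borel_measurable lebesgue"
  using fourier_integral_measurable[OF assms] by (intro measurable_completion) simp

lemma integrable_borel_representative: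
  fixes f :: "'a::euclidean_space \<Rightarrow> complex"
  assumes "integrable lebesgue f"
  obtains g where "integrable lborel g" "g \<in> borel_measurable borel" "AE x in lebesgue. f x = g x"
    "fourier_integral f = fourier_integral g"
proof -
  have f: "f \<in> borel_measurable lebesgue" using assms by auto
  obtain g where g: "g \<in> borel_measurable borel" "AE x in lebesgue. f x = g x"
    using borel_representative[OF f] .
  have gl: "g \<in> borel_measurable lebesgue" using g(1) by (intro measurable_completion) simp
  have "integrable lebesgue g"
    using integrable_cong_AE[OF f gl g(2)] assms by simp
  then have "integrable lborel g" using integrable_completion[of g lborel] g(1) by simp
  with that g fourier_integral_cong_AE[OF f gl g(2)] show thesis by blast
qed

lemma fourier_multiplication_formula:
  fixes f g :: "'a::euclidean_space \<Rightarrow> complex"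
  assumes f: "integrable lebesgue f" and g: "integrable lebesgue g"
  shows "integral\<^sup>L lebesgue (\<lambda>x. fourier_integral f x * g x) = integral\<^sup>L lebesgue (\<lambda>x. f x * fourier_integral g x)"
proof -
  obtain f' where f': "integrable lborel f'" "f' \<in> borel_measurable borel" "AE x in lebesgue. f x = f' x"
    and Ff: "fourier_integral f = fourier_integral f'" using integrable_borel_representative[OF f] .
  obtain g' where g': "integrable lborel g'" "g' \<in> borel_measurable borel" "AE x in lebesgue. g x = g' x"
    and Fg: "fourier_integral g = fourier_integral g'" using integrable_borel_representative[OF g] .
  note [measurable] = f'(2) g'(2)
  have l: "f \<in> borel_measurable lebesgue" "g \<in> borel_measurable lebesgue"
    "f' \<in> borel_measurable lebesgue" "g' \<in> borel_measurable lebesgue"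
    using f g f'(2) g'(2) by (auto intro: measurable_completion)
  have m [measurable]: "fourier_integral f' \<in> borel_measurable borel" "fourier_integral g' \<in> borel_measurable borel"
    using fourier_integral_measurable l by auto
  have "integral\<^sup>L lebesgue (\<lambda>x. fourier_integral f x * g x) = integral\<^sup>L lebesgue (\<lambda>x. fourier_integral f' x * g' x)"
    unfolding Ff using l fourier_integral_measurable_lebesgue[of f'] g'(3)
    by (intro integral_cong_AE borel_measurable_times) auto
  also have "\<dots> = (\<integral>x. g' x * fourier_integral f' x \<partial>lborel)"
    by (subst integral_completion) (simp_all add: mult.commute)
  also have "\<dots> = (\<integral>\<xi>. of_real (fourier_const DIM('a)) * (g' \<xi> * (\<integral>x. cis (- (\<xi> \<bullet> x)) * f' x \<partial>lborel)) \<partial>lborel)"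
    by (intro Bochner_Integration.integral_cong refl) (simp add: fourier_integral_borel inner_commute)
  also have "\<dots> = of_real (fourier_const DIM('a)) * (\<integral>\<xi>. g' \<xi> * (\<integral>x. cis (- (\<xi> \<bullet> x)) * f' x \<partial>lborel) \<partial>lborel)"
    by (rule integral_mult_right_zero)
  also have "(\<integral>\<xi>. g' \<xi> * (\<integral>x. cis (- (\<xi> \<bullet> x)) * f' x \<partial>lborel) \<partial>lborel)
      = (\<integral>x. f' x * (\<integral>\<xi>. cis (- (\<xi> \<bullet> x)) * g' \<xi> \<partial>lborel) \<partial>lborel)"
    by (rule Fubini_bounded_kernel[OF g'(1) f'(1)]) auto
  also have "of_real (fourier_const DIM('a)) * \<dots>
      = (\<integral>x. of_real (fourier_const DIM('a)) * (f' x * (\<integral>\<xi>. cis (- (\<xi> \<bullet> x)) * g' \<xi> \<partial>lborel)) \<partial>lborel)"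
    by (rule integral_mult_right_zero[symmetric])
  also have "\<dots> = (\<integral>x. f' x * fourier_integral g' x \<partial>lborel)"
    by (intro Bochner_Integration.integral_cong refl) (simp add: fourier_integral_borel)
  also have "\<dots> = integral\<^sup>L lebesgue (\<lambda>x. f' x * fourier_integral g' x)"
    by (subst integral_completion) simp_all
  also have "\<dots> = integral\<^sup>L lebesgue (\<lambda>x. f x * fourier_integral g x)"
    unfolding Fg using l fourier_integral_measurable_lebesgue[of g'] f'(3)
    by (intro integral_cong_AE borel_measurable_times) auto
  finally show ?thesis .
qed

lemma fourier_integral_tendsto:
  fixes f :: "nat \<Rightarrow> 'a::euclidean_space \<Rightarrow> complex" and h :: "'a \<Rightarrow> complex"
  assumes f: "\<And>n. f n \<in> borel_measurable lebesgue" and g: "g \<in> borel_measurable lebesgue"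
    and h: "integrable lebesgue h" and bound: "\<And>n. AE x in lebesgue. norm (f n x) \<le> norm (h x)"
    and lim: "AE x in lebesgue. (\<lambda>n. f n x) \<longlonglongrightarrow> g x"
  shows "(\<lambda>n. fourier_integral (f n) \<xi>) \<longlonglongrightarrow> fourier_integral g \<xi>"
  unfolding fourier_integral_def'
proof (intro tendsto_mult tendsto_const integral_dominated_convergence[where w = "\<lambda>x. norm (h x)"])
  have *: "(\<lambda>x. cis (- (x \<bullet> \<xi>))) \<in> borel_measurable lebesgue"
    by (rule measurable_completion) simp
  show "(\<lambda>x. cis (- (x \<bullet> \<xi>)) * g x) \<in> borel_measurable lebesgue"
    "(\<lambda>x. cis (- (x \<bullet> \<xi>)) * f n x) \<in> borel_measurable lebesgue" for n
    using * f g by (auto intro: borel_measurable_times)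
  show "AE x in lebesgue. (\<lambda>n. cis (- (x \<bullet> \<xi>)) * f n x) \<longlonglongrightarrow> cis (- (x \<bullet> \<xi>)) * g x"
    using lim by eventually_elim (intro tendsto_intros)
qed (use h bound in \<open>auto simp: norm_mult\<close>)

section \<open>Plancherel's theorem\<close>

lemma borel_measurable_cnj [measurable (raw)]:
  "f \<in> borel_measurable M \<Longrightarrow> (\<lambda>x. cnj (f x)) \<in> borel_measurable M"
  by (rule borel_measurable_continuous_on[where f = cnj]) (auto intro: continuous_intros)

text \<open>Weighting \<open>|F f|\<^sup>2\<close> with a wide Gaussian makes Fubini's theorem applicable, and turns the
  integral into an average of \<open>\<integral>x. f x * cnj (f (x + z / k))\<close> over Gaussian \<open>z\<close>.\<close>

lemma fourier_integral_gaussian_weight: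
  fixes f :: "'a::euclidean_space \<Rightarrow> complex"
  assumes f [measurable]: "f \<in> borel_measurable borel" and int: "integrable lborel f" and k: "k > 0"
  shows "integrable lborel (\<lambda>\<xi>. (norm (fourier_integral f \<xi>))\<^sup>2 * exp (- (norm \<xi> / k)\<^sup>2 / 2))"
    and "complex_of_real (\<integral>\<xi>. (norm (fourier_integral f \<xi>))\<^sup>2 * exp (- (norm \<xi> / k)\<^sup>2 / 2) \<partial>lborel)
      = of_real (fourier_const DIM('a)) *
        (\<integral>x. f x * (\<integral>z. cnj (f (x + (1 / k) *\<^sub>R z)) * of_real (exp (- (norm z)\<^sup>2 / 2)) \<partial>lborel) \<partial>lborel)"
proof -
  let ?F = "fourier_integral f"
  let ?G = "sqrt (2 * pi) ^ DIM('a)"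
  let ?c = "complex_of_real (fourier_const DIM('a))"
  define \<gamma> where "\<gamma> \<xi> = complex_of_real (exp (- (norm \<xi> / k)\<^sup>2 / 2))" for \<xi> :: 'a
  have [measurable]: "\<gamma> \<in> borel_measurable borel" unfolding \<gamma>_def by measurable
  have \<gamma>: "integrable lborel \<gamma>" unfolding \<gamma>_def by (rule gaussian_integrable_scaled[OF k])
  have fl: "f \<in> borel_measurable lebesgue" by (rule measurable_completion) simp
  have Fm [measurable]: "?F \<in> borel_measurable borel"
    by (rule fourier_integral_measurable[OF fl])
  define B where "B = fourier_const DIM('a) * (\<integral>x. norm (f x) \<partial>lebesgue)"
  have B: "norm (?F \<xi>) \<le> B" for \<xi>
    unfolding B_def by (rule fourier_integral_bound)
  then have B0: "0 \<le> B" using norm_ge_zero order_trans by blast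
  show 1: "integrable lborel (\<lambda>\<xi>. (norm (?F \<xi>))\<^sup>2 * exp (- (norm \<xi> / k)\<^sup>2 / 2))"
  proof (rule Bochner_Integration.integrable_bound)
    show "integrable lborel (\<lambda>\<xi>. of_real (B\<^sup>2) * \<gamma> \<xi>)" using \<gamma> by simp
    show "AE \<xi> in lborel. norm ((norm (?F \<xi>))\<^sup>2 * exp (- (norm \<xi> / k)\<^sup>2 / 2)) \<le> norm (of_real (B\<^sup>2) * \<gamma> \<xi>)"
      using B by (intro AE_I2) (simp add: \<gamma>_def norm_mult norm_power power_mono)
  qed simp
  have F\<gamma>: "integrable lborel (\<lambda>\<xi>. cnj (?F \<xi>) * \<gamma> \<xi>)"
  proof (rule Bochner_Integration.integrable_bound)
    show "integrable lborel (\<lambda>\<xi>. of_real B * \<gamma> \<xi>)" using \<gamma> by simp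
    show "AE \<xi> in lborel. norm (cnj (?F \<xi>) * \<gamma> \<xi>) \<le> norm (of_real B * \<gamma> \<xi>)"
      using B B0 by (intro AE_I2) (simp add: norm_mult mult_right_mono)
  qed simp
  have cis\<gamma>: "integrable lborel (\<lambda>\<xi>. cis (- (x \<bullet> \<xi>)) * \<gamma> \<xi>)" for x
    by (rule Bochner_Integration.integrable_bound[OF \<gamma>]) (auto simp: norm_mult inner_commute)
  have cnjf: "integrable lborel (\<lambda>x. cnj (f x))" using int by simp
  have cnjF: "cnj (?F \<xi>) = ?c * (\<integral>y. cis (y \<bullet> \<xi>) * cnj (f y) \<partial>lborel)" for \<xi>
  proof -
    have "(\<integral>y. cis (y \<bullet> \<xi>) * cnj (f y) \<partial>lborel) = (\<integral>x. cnj (cis (- (x \<bullet> \<xi>)) * f x) \<partial>lborel)"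
      by (simp add: cis_cnj)
    also have "\<dots> = cnj (\<integral>x. cis (- (x \<bullet> \<xi>)) * f x \<partial>lborel)" by (rule Bochner_Integration.integral_cnj)
    finally show ?thesis by (simp add: fourier_integral_borel[OF f])
  qed
  have inner: "(\<integral>\<xi>. cis (- (x \<bullet> \<xi>)) * (cnj (?F \<xi>) * \<gamma> \<xi>) \<partial>lborel)
      = (\<integral>z. cnj (f (x + (1 / k) *\<^sub>R z)) * of_real (exp (- (norm z)\<^sup>2 / 2)) \<partial>lborel)" for x
  proof -
    have "(\<integral>\<xi>. cis (- (x \<bullet> \<xi>)) * (cnj (?F \<xi>) * \<gamma> \<xi>) \<partial>lborel)
        = (\<integral>\<xi>. ?c * ((cis (- (x \<bullet> \<xi>)) * \<gamma> \<xi>) * (\<integral>y. cis (y \<bullet> \<xi>) * cnj (f y) \<partial>lborel)) \<partial>lborel)"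
      by (intro Bochner_Integration.integral_cong refl) (simp add: cnjF)
    also have "\<dots> = ?c * (\<integral>\<xi>. (cis (- (x \<bullet> \<xi>)) * \<gamma> \<xi>) * (\<integral>y. cis (y \<bullet> \<xi>) * cnj (f y) \<partial>lborel) \<partial>lborel)"
      by (rule integral_mult_right_zero)
    also have "(\<integral>\<xi>. (cis (- (x \<bullet> \<xi>)) * \<gamma> \<xi>) * (\<integral>y. cis (y \<bullet> \<xi>) * cnj (f y) \<partial>lborel) \<partial>lborel)
        = (\<integral>y. cnj (f y) * (\<integral>\<xi>. cis (y \<bullet> \<xi>) * (cis (- (x \<bullet> \<xi>)) * \<gamma> \<xi>) \<partial>lborel) \<partial>lborel)"
      by (rule Fubini_bounded_kernel[OF cis\<gamma> cnjf]) (simp_all add: cis_conv_exp split_beta')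
    also have "(\<lambda>y. \<integral>\<xi>. cis (y \<bullet> \<xi>) * (cis (- (x \<bullet> \<xi>)) * \<gamma> \<xi>) \<partial>lborel)
        = (\<lambda>y. of_real (k ^ DIM('a) * (?G * exp (- (k * norm (y - x))\<^sup>2 / 2))))"
      unfolding gaussian_fourier_scaled[OF k, symmetric] \<gamma>_def
      by (simp add: mult.assoc[symmetric] cis_mult inner_diff_left)
    also have "(\<integral>y. cnj (f y) * of_real (k ^ DIM('a) * (?G * exp (- (k * norm (y - x))\<^sup>2 / 2))) \<partial>lborel)
        = of_real (\<bar>1 / k\<bar> ^ DIM('a)) * (\<integral>z. cnj (f (x + (1 / k) *\<^sub>R z)) *
            of_real (k ^ DIM('a) * (?G * exp (- (k * norm (x + (1 / k) *\<^sub>R z - x))\<^sup>2 / 2))) \<partial>lborel)"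
      using k by (intro lborel_integral_affine) simp_all
    also have "(\<lambda>z. cnj (f (x + (1 / k) *\<^sub>R z)) *
            of_real (k ^ DIM('a) * (?G * exp (- (k * norm (x + (1 / k) *\<^sub>R z - x))\<^sup>2 / 2))))
        = (\<lambda>z. of_real (k ^ DIM('a) * ?G) *
            (cnj (f (x + (1 / k) *\<^sub>R z)) * of_real (exp (- (norm z)\<^sup>2 / 2))))"
      using k by (auto simp: fun_eq_iff)
    also have "integral\<^sup>L lborel \<dots> = of_real (k ^ DIM('a) * ?G) *
        (\<integral>z. cnj (f (x + (1 / k) *\<^sub>R z)) * of_real (exp (- (norm z)\<^sup>2 / 2)) \<partial>lborel)"
      by (rule integral_mult_right_zero)
    also have "?c * (of_real (\<bar>1 / k\<bar> ^ DIM('a)) * \<dots>)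
        = of_real (fourier_const DIM('a) * \<bar>1 / k\<bar> ^ DIM('a) * (k ^ DIM('a) * ?G)) *
        (\<integral>z. cnj (f (x + (1 / k) *\<^sub>R z)) * of_real (exp (- (norm z)\<^sup>2 / 2)) \<partial>lborel)"
      by simp
    also have "fourier_const DIM('a) * \<bar>1 / k\<bar> ^ DIM('a) * (k ^ DIM('a) * ?G) = 1"
      using k by (simp add: fourier_const_def power_divide)
    finally show ?thesis by simp
  qed
  have "complex_of_real (\<integral>\<xi>. (norm (?F \<xi>))\<^sup>2 * exp (- (norm \<xi> / k)\<^sup>2 / 2) \<partial>lborel)
      = (\<integral>\<xi>. complex_of_real ((norm (?F \<xi>))\<^sup>2 * exp (- (norm \<xi> / k)\<^sup>2 / 2)) \<partial>lborel)"
    by (rule integral_complex_of_real[symmetric])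
  also have "\<dots> = (\<integral>\<xi>. ?c * ((cnj (?F \<xi>) * \<gamma> \<xi>) * (\<integral>x. cis (- (x \<bullet> \<xi>)) * f x \<partial>lborel)) \<partial>lborel)"
  proof (intro Bochner_Integration.integral_cong refl)
    fix \<xi> :: 'a
    have "complex_of_real ((norm (?F \<xi>))\<^sup>2 * exp (- (norm \<xi> / k)\<^sup>2 / 2))
        = ?F \<xi> * cnj (?F \<xi>) * \<gamma> \<xi>"
      unfolding \<gamma>_def by (simp only: of_real_mult complex_norm_square)
    then show "complex_of_real ((norm (?F \<xi>))\<^sup>2 * exp (- (norm \<xi> / k)\<^sup>2 / 2))
      = ?c * ((cnj (?F \<xi>) * \<gamma> \<xi>) * (\<integral>x. cis (- (x \<bullet> \<xi>)) * f x \<partial>lborel))"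
      using fourier_integral_borel[OF f, of \<xi>] by (simp only: mult_ac)
  qed
  also have "\<dots> = ?c * (\<integral>\<xi>. (cnj (?F \<xi>) * \<gamma> \<xi>) * (\<integral>x. cis (- (x \<bullet> \<xi>)) * f x \<partial>lborel) \<partial>lborel)"
    by (rule integral_mult_right_zero)
  also have "(\<integral>\<xi>. (cnj (?F \<xi>) * \<gamma> \<xi>) * (\<integral>x. cis (- (x \<bullet> \<xi>)) * f x \<partial>lborel) \<partial>lborel)
      = (\<integral>x. f x * (\<integral>\<xi>. cis (- (x \<bullet> \<xi>)) * (cnj (?F \<xi>) * \<gamma> \<xi>) \<partial>lborel) \<partial>lborel)"
    by (rule Fubini_bounded_kernel[OF F\<gamma> int]) (simp_all add: cis_conv_exp split_beta')
  finally show "complex_of_real (\<integral>\<xi>. (norm (?F \<xi>))\<^sup>2 * exp (- (norm \<xi> / k)\<^sup>2 / 2) \<partial>lborel)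
      = of_real (fourier_const DIM('a)) *
        (\<integral>x. f x * (\<integral>z. cnj (f (x + (1 / k) *\<^sub>R z)) * of_real (exp (- (norm z)\<^sup>2 / 2)) \<partial>lborel) \<partial>lborel)"
    unfolding inner .
qed

text \<open>As \<open>k\<close> grows, the left-hand side of the weighted identity increases to \<open>\<parallel>F f\<parallel>\<^sup>2\<close>. Continuity of \<open>f\<close> makes
  the Gaussian average on the right converge to \<open>f x * cnj (f x)\<close>.\<close>

lemma plancherel_bounded_continuous:
  fixes f :: "'a::euclidean_space \<Rightarrow> complex"
  assumes cont: "continuous_on UNIV f" and M: "\<And>x. norm (f x) \<le> M" and int: "integrable lebesgue f"
  shows "f \<in> Lp 2" "fourier_integral f \<in> Lp 2" "Lp_norm 2 (fourier_integral f) = Lp_norm 2 f"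
proof -
  let ?F = "fourier_integral f"
  let ?G = "sqrt (2 * pi) ^ DIM('a)"
  have f [measurable]: "f \<in> borel_measurable borel" by (rule borel_measurable_continuous_onI[OF cont])
  have fl: "f \<in> borel_measurable lebesgue" by (rule measurable_completion) simp
  have int': "integrable lborel f" using int integrable_completion[of f lborel] by simp
  have M0: "0 \<le> M" using M norm_ge_zero order_trans by blast
  show fL: "f \<in> Lp 2"
    unfolding Lp2_iff
  proof (rule conjI[OF fl], rule Bochner_Integration.integrable_bound)
    show "integrable lebesgue (\<lambda>x. of_real M * f x)" using int by simp
    show "(\<lambda>x. (norm (f x))\<^sup>2) \<in> borel_measurable lebesgue"
      using fl by measurable
    show "AE x in lebesgue. norm ((norm (f x))\<^sup>2) \<le> norm (of_real M * f x)"
      using M M0 by (intro AE_I2) (simp add: norm_mult power2_eq_square mult_right_mono)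
  qed
  define e where "e k = (\<integral>\<xi>. (norm (?F \<xi>))\<^sup>2 * exp (- (norm \<xi> / k)\<^sup>2 / 2) \<partial>lborel)" for k :: real
  define \<gamma> where "\<gamma> z = complex_of_real (exp (- (norm z)\<^sup>2 / 2))" for z :: 'a
  have [measurable]: "\<gamma> \<in> borel_measurable borel" unfolding \<gamma>_def by measurable
  have \<gamma>: "integrable lborel \<gamma>" unfolding \<gamma>_def by (rule gaussian_integrable)
  define H where "H i x = (\<integral>z. cnj (f (x + (1 / real (Suc i)) *\<^sub>R z)) * \<gamma> z \<partial>lborel)" for i x
  have \<gamma>int: "(\<integral>z. \<gamma> z \<partial>lborel) = of_real ?G"
    using gaussian_fourier(2)[of "0::'a"] by (simp add: \<gamma>_def)
  have Hlim: "(\<lambda>i. H i x) \<longlonglongrightarrow> cnj (f x) * of_real ?G" for x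
  proof -
    have "(\<lambda>i. H i x) \<longlonglongrightarrow> (\<integral>z. cnj (f x) * \<gamma> z \<partial>lborel)"
      unfolding H_def
    proof (rule integral_dominated_convergence[where w = "\<lambda>z. M * norm (\<gamma> z)"])
      show "integrable lborel (\<lambda>z. M * norm (\<gamma> z))" using \<gamma> by simp
      show "AE z in lborel. (\<lambda>i. cnj (f (x + (1 / real (Suc i)) *\<^sub>R z)) * \<gamma> z) \<longlonglongrightarrow> cnj (f x) * \<gamma> z"
      proof (rule AE_I2)
        fix z :: 'a
        have "(\<lambda>i. x + (1 / real (Suc i)) *\<^sub>R z) \<longlonglongrightarrow> x + 0 *\<^sub>R z"
          by (intro tendsto_intros LIMSEQ_Suc lim_1_over_n)
        then have "(\<lambda>i. f (x + (1 / real (Suc i)) *\<^sub>R z)) \<longlonglongrightarrow> f x"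
          using cont by (intro continuous_on_tendsto_compose[OF cont]) simp_all
        then show "(\<lambda>i. cnj (f (x + (1 / real (Suc i)) *\<^sub>R z)) * \<gamma> z) \<longlonglongrightarrow> cnj (f x) * \<gamma> z"
          by (intro tendsto_intros)
      qed
      show "AE z in lborel. norm (cnj (f (x + (1 / real (Suc i)) *\<^sub>R z)) * \<gamma> z) \<le> M * norm (\<gamma> z)" for i
        using M by (intro AE_I2) (simp add: norm_mult mult_right_mono)
    qed simp_all
    then show ?thesis using \<gamma>int by simp
  qed
  have Hbound: "norm (H i x) \<le> M * (\<integral>z. norm (\<gamma> z) \<partial>lborel)" for i x
  proof -
    have "norm (H i x) \<le> (\<integral>z. M * norm (\<gamma> z) \<partial>lborel)"
      unfolding H_def
    proof (rule Bochner_Integration.integral_norm_bound_integral)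
      show int2: "integrable lborel (\<lambda>z. M * norm (\<gamma> z))" using \<gamma> by simp
      show bd: "norm (cnj (f (x + (1 / real (Suc i)) *\<^sub>R z)) * \<gamma> z) \<le> M * norm (\<gamma> z)" for z
        using M by (simp add: norm_mult mult_right_mono)
      show "integrable lborel (\<lambda>z. cnj (f (x + (1 / real (Suc i)) *\<^sub>R z)) * \<gamma> z)"
      proof (rule Bochner_Integration.integrable_bound[OF int2])
        show "AE z in lborel. norm (cnj (f (x + (1 / real (Suc i)) *\<^sub>R z)) * \<gamma> z) \<le> norm (M * norm (\<gamma> z))"
          using bd M0 by (intro AE_I2) simp
      qed simp
    qed
    then show ?thesis by simp
  qed
  have [measurable]: "H i \<in> borel_measurable borel" for i
    unfolding H_def by (rule lborel.borel_measurable_lebesgue_integral) simp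
  have "(\<lambda>i. \<integral>x. f x * H i x \<partial>lborel) \<longlonglongrightarrow> (\<integral>x. f x * (cnj (f x) * of_real ?G) \<partial>lborel)"
  proof (rule integral_dominated_convergence[where w = "\<lambda>x. norm (f x) * (M * (\<integral>z. norm (\<gamma> z) \<partial>lborel))"])
    show "integrable lborel (\<lambda>x. norm (f x) * (M * (\<integral>z. norm (\<gamma> z) \<partial>lborel)))" using int' by simp
    show "AE x in lborel. (\<lambda>i. f x * H i x) \<longlonglongrightarrow> f x * (cnj (f x) * of_real ?G)"
      using Hlim by (intro AE_I2 tendsto_intros) 
    show "AE x in lborel. norm (f x * H i x) \<le> norm (f x) * (M * (\<integral>z. norm (\<gamma> z) \<partial>lborel))" for i
      using Hbound by (intro AE_I2) (simp add: norm_mult mult_left_mono)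
  qed simp_all
  also have "(\<lambda>x. f x * (cnj (f x) * of_real ?G))
      = (\<lambda>x. complex_of_real ((norm (f x))\<^sup>2 * ?G))"
    by (simp only: mult.assoc[symmetric] complex_norm_square[symmetric] of_real_mult)
  also have "integral\<^sup>L lborel \<dots> = of_real ((\<integral>x. (norm (f x))\<^sup>2 \<partial>lborel) * ?G)"
    unfolding integral_complex_of_real by simp
  also have "(\<integral>x. (norm (f x))\<^sup>2 \<partial>lborel) = (Lp_norm 2 f)\<^sup>2"
    unfolding Lp_norm2_sq by (rule integral_completion[symmetric]) simp
  finally have "(\<lambda>i. of_real (fourier_const DIM('a)) * (\<integral>x. f x * H i x \<partial>lborel))
      \<longlonglongrightarrow> of_real (fourier_const DIM('a)) * of_real ((Lp_norm 2 f)\<^sup>2 * ?G)"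
    by (intro tendsto_intros)
  moreover have "of_real (fourier_const DIM('a)) * (\<integral>x. f x * H i x \<partial>lborel) = of_real (e (real (Suc i)))" for i
    unfolding e_def H_def \<gamma>_def
    by (rule fourier_integral_gaussian_weight(2)[OF f int', symmetric]) simp
  moreover have "complex_of_real (fourier_const DIM('a)) * of_real ((Lp_norm 2 f)\<^sup>2 * ?G)
      = of_real ((Lp_norm 2 f)\<^sup>2)"
    by (simp add: fourier_const_def)
  ultimately have "(\<lambda>i. e (real (Suc i))) \<longlonglongrightarrow> (Lp_norm 2 f)\<^sup>2"
    by (simp only: tendsto_of_real_iff)
  then have lim1: "(\<lambda>i. ennreal (e (real (Suc i)))) \<longlonglongrightarrow> ennreal ((Lp_norm 2 f)\<^sup>2)"
    by (rule tendsto_ennrealI)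
  have Fm [measurable]: "?F \<in> borel_measurable borel"
    by (rule fourier_integral_measurable[OF fl])
  have Fl: "?F \<in> borel_measurable lebesgue"
    by (rule fourier_integral_measurable_lebesgue[OF fl])
  have "(\<lambda>i. \<integral>\<^sup>+\<xi>. ennreal ((norm (?F \<xi>))\<^sup>2 * exp (- (norm \<xi> / real (Suc i))\<^sup>2 / 2)) \<partial>lborel)
      \<longlonglongrightarrow> (\<integral>\<^sup>+\<xi>. ennreal ((norm (?F \<xi>))\<^sup>2) \<partial>lborel)"
  proof (rule nn_integral_LIMSEQ)
    show "incseq (\<lambda>i \<xi>. ennreal ((norm (?F \<xi>))\<^sup>2 * exp (- (norm \<xi> / real (Suc i))\<^sup>2 / 2)))"
      by (intro incseq_SucI le_funI ennreal_leI mult_left_mono)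
         (auto intro!: divide_left_mono power_mono)
    fix \<xi> :: 'a
    have "(\<lambda>i. norm \<xi> * (1 / real (Suc i))) \<longlonglongrightarrow> norm \<xi> * 0"
      by (intro tendsto_intros LIMSEQ_Suc lim_1_over_n)
    then have "(\<lambda>i. (norm (?F \<xi>))\<^sup>2 * exp (- (norm \<xi> / real (Suc i))\<^sup>2 / 2))
        \<longlonglongrightarrow> (norm (?F \<xi>))\<^sup>2 * exp (- 0\<^sup>2 / 2)"
      by (intro tendsto_intros) simp_all
    then show "(\<lambda>i. ennreal ((norm (?F \<xi>))\<^sup>2 * exp (- (norm \<xi> / real (Suc i))\<^sup>2 / 2)))
        \<longlonglongrightarrow> ennreal ((norm (?F \<xi>))\<^sup>2)"
      by (intro tendsto_ennrealI) simp
  qed simp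
  moreover have "(\<integral>\<^sup>+\<xi>. ennreal ((norm (?F \<xi>))\<^sup>2 * exp (- (norm \<xi> / real (Suc i))\<^sup>2 / 2)) \<partial>lborel)
      = ennreal (e (real (Suc i)))" for i
    unfolding e_def
    by (intro nn_integral_eq_integral fourier_integral_gaussian_weight(1)[OF f int']) simp_all
  ultimately have "(\<integral>\<^sup>+\<xi>. ennreal ((norm (?F \<xi>))\<^sup>2) \<partial>lborel) = ennreal ((Lp_norm 2 f)\<^sup>2)"
    using LIMSEQ_unique[OF lim1] by simp
  then have eq: "(\<integral>\<^sup>+\<xi>. ennreal ((norm (?F \<xi>))\<^sup>2) \<partial>lebesgue) = ennreal ((Lp_norm 2 f)\<^sup>2)"
    by (simp add: nn_integral_completion)
  show FL: "?F \<in> Lp 2"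
    by (rule Lp2_nn_integralI(1)[OF Fl Lp_norm_nonneg[of 2 f]]) (use eq in simp)
  show "Lp_norm 2 (?F) = Lp_norm 2 f"
    using eq nn_integral_Lp2[OF FL] by (simp add: Lp_norm_nonneg)
qed

lemma Lp2_convergent_imp_Cauchy:
  assumes "\<And>n. f n \<in> Lp 2" "g \<in> Lp 2" "(\<lambda>n. Lp_norm 2 (\<lambda>x. f n x - g x)) \<longlonglongrightarrow> 0"
  shows "Lp2_Cauchy f"
  unfolding Lp2_Cauchy_def
proof (intro allI impI)
  fix e :: real assume "0 < e"
  then obtain M where M: "\<And>n. n \<ge> M \<Longrightarrow> norm (Lp_norm 2 (\<lambda>x. f n x - g x) - 0) < e / 2"
    using LIMSEQ_D[OF assms(3), of "e / 2"] by auto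
  have "Lp_norm 2 (\<lambda>x. f m x - f n x) < e" if "m \<ge> M" "n \<ge> M" for m n
    using Lp_norm2_diff_triangle[OF assms(1)[of m] assms(2) assms(1)[of n]] M[OF that(1)] M[OF that(2)]
      Lp_norm_minus_commute[of 2 g "f n"] by (simp add: Lp_norm_nonneg)
  then show "\<exists>M. \<forall>m\<ge>M. \<forall>n\<ge>M. Lp_norm 2 (\<lambda>x. f m x - f n x) < e" by blast
qed

text \<open>The isometry as a property of a single function, to be propagated from continuous functions
  to all of \<open>L\<^sup>1 \<inter> L\<^sup>2\<close> by dominated limits.\<close>

definition plancherel_fun :: "('a::euclidean_space \<Rightarrow> complex) \<Rightarrow> bool" where
  "plancherel_fun f \<longleftrightarrow> integrable lebesgue f \<and> f \<in> Lp 2 \<and>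
     fourier_integral f \<in> Lp 2 \<and> Lp_norm 2 (fourier_integral f) = Lp_norm 2 f"

text \<open>Isometry on the differences turns the Cauchy property of \<open>f n\<close> into that of its transforms, and the
  transforms converge pointwise to the transform of \<open>g\<close> because \<open>h\<close> is integrable.\<close>

lemma plancherel_fun_limit:
  fixes f :: "nat \<Rightarrow> 'a::euclidean_space \<Rightarrow> complex"
  assumes f: "\<And>n. plancherel_fun (f n)" and diff: "\<And>m n. plancherel_fun (\<lambda>x. f m x - f n x)"
    and g: "g \<in> borel_measurable lebesgue"
    and h: "integrable lebesgue h" "h \<in> Lp 2" and bound: "\<And>n. AE x in lebesgue. norm (f n x) \<le> norm (h x)"
    and lim: "AE x in lebesgue. (\<lambda>n. f n x) \<longlonglongrightarrow> g x"
  shows "plancherel_fun g"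
proof -
  have fi: "integrable lebesgue (f n)" and fL: "f n \<in> Lp 2" and FL: "fourier_integral (f n) \<in> Lp 2"
    and FN: "Lp_norm 2 (fourier_integral (f n)) = Lp_norm 2 (f n)" for n
    using f unfolding plancherel_fun_def by auto
  have fm: "f n \<in> borel_measurable lebesgue" for n using fi by auto
  note conv = Lp2_dominated_convergence[OF fm g h(2) bound lim]
  have "AE x in lebesgue. \<forall>n. norm (f n x) \<le> norm (h x)" using bound by (simp add: AE_all_countable)
  with lim have "AE x in lebesgue. norm (g x) \<le> norm (h x)"
  proof eventually_elim
    case (elim x)
    then show ?case by (intro LIMSEQ_le_const2[OF tendsto_norm[OF elim(1)]]) auto
  qed
  then have gi: "integrable lebesgue g"
    by (rule Bochner_Integration.integrable_bound[OF h(1) g])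
  have "Lp2_Cauchy f" by (rule Lp2_convergent_imp_Cauchy[OF fL conv])
  moreover have "Lp_norm 2 (\<lambda>\<xi>. fourier_integral (f m) \<xi> - fourier_integral (f n) \<xi>)
      = Lp_norm 2 (\<lambda>x. f m x - f n x)" for m n
    using diff[of m n] fourier_integral_diff[OF fi[of m] fi[of n]] by (simp add: plancherel_fun_def)
  ultimately have C: "Lp2_Cauchy (\<lambda>n. fourier_integral (f n))"
    by (simp add: Lp2_Cauchy_def)
  have "AE \<xi> in lebesgue. (\<lambda>n. fourier_integral (f (id n)) \<xi>) \<longlonglongrightarrow> fourier_integral g \<xi>"
    using fourier_integral_tendsto[OF fm g h(1) bound lim] by simp
  note F = Lp2_Cauchy_AE_limit[OF FL fourier_integral_measurable_lebesgue[OF g] C strict_mono_id this]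
  have "(\<lambda>n. Lp_norm 2 (fourier_integral (f n))) \<longlonglongrightarrow> Lp_norm 2 (fourier_integral g)"
    by (rule Lp_norm2_tendsto[OF FL F])
  moreover have "(\<lambda>n. Lp_norm 2 (f n)) \<longlonglongrightarrow> Lp_norm 2 g"
    by (rule Lp_norm2_tendsto[OF fL conv])
  ultimately have "Lp_norm 2 (fourier_integral g) = Lp_norm 2 g"
    unfolding FN by (rule LIMSEQ_unique)
  with gi conv(1) F(1) show ?thesis by (simp add: plancherel_fun_def)
qed

lemma indicator_cball_integrable:
  "integrable lebesgue (indicator (cball 0 R) :: 'a::euclidean_space \<Rightarrow> complex)"
  "(indicator (cball 0 R) :: 'a::euclidean_space \<Rightarrow> complex) \<in> Lp 2"
proof -
  have *: "emeasure lebesgue (cball (0::'a) R) < \<infinity>"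
    using emeasure_bounded_finite[OF bounded_cball[of "0::'a" R]] by simp
  then show 1: "integrable lebesgue (indicator (cball 0 R) :: 'a \<Rightarrow> complex)"
    by (intro integrable_real_indicator[THEN integrable_of_real, where 'a=complex, simplified of_real_indicator]) auto
  have "(\<lambda>x::'a. (norm (indicator (cball 0 R) x :: complex))\<^sup>2) = indicator (cball 0 R)"
    by (auto simp: indicator_def)
  then show "(indicator (cball 0 R) :: 'a \<Rightarrow> complex) \<in> Lp 2"
    unfolding Lp2_iff using * 1 by (auto intro!: integrable_real_indicator)
qed

text \<open>Every measurable function is an almost everywhere limit of continuous ones; cutting these off
  in height and in space makes the convergence dominated.\<close>

lemma plancherel_fun_bounded:
  fixes f :: "'a::euclidean_space \<Rightarrow> complex"
  assumes f: "f \<in> borel_measurable lebesgue" and M: "\<And>x. norm (f x) \<le> M" "0 < M"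
    and R: "\<And>x. norm x > R \<Longrightarrow> f x = 0"
  shows "plancherel_fun f"
proof -
  have "f measurable_on UNIV"
    using f by (intro lebesgue_measurable_imp_measurable_on) auto
  then obtain N g where N: "negligible N" and g: "\<And>n::nat. continuous_on UNIV (g n)"
    and lim: "\<And>x. x \<notin> N \<Longrightarrow> (\<lambda>n. g n x) \<longlonglongrightarrow> f x"
    unfolding measurable_on_def by auto
  \<comment> \<open>\<open>clamp\<close> is continuous and fixes the disc of radius \<open>M\<close>, which contains the values of \<open>f\<close>\<close>
  define clamp where "clamp w = w * of_real (M / max M (norm w))" for w :: complex
  define cut where "cut x = complex_of_real (max 0 (min 1 (R + 1 - norm x)))" for x :: 'a
  define u where "u n x = cut x * clamp (g n x)" for n x
  have pos: "max M (norm w) > 0" for w :: complex using M(2) by simp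
  have clamp: "continuous_on UNIV clamp"
    unfolding clamp_def using pos by (intro continuous_intros) (simp add: less_imp_neq[symmetric])
  have clampM: "norm (clamp w) \<le> M" for w
  proof -
    have "norm w * M \<le> M * max M (norm w)" using M(2) by (simp add: mult.commute mult_left_mono)
    then have "norm w * (M / max M (norm w)) \<le> M" using pos[of w] by (simp add: pos_divide_le_eq)
    then show ?thesis unfolding clamp_def using M(2) pos[of w] by (simp add: norm_mult norm_divide)
  qed
  have cont: "continuous_on UNIV (u n)" for n
    unfolding u_def cut_def
    by (intro continuous_intros continuous_on_compose2[OF clamp g]) auto
  have cut: "norm (cut x) \<le> norm (indicator (cball 0 (R + 1)) x :: complex)" for x
    by (auto simp: cut_def indicator_def)
  define h where "h x = of_real M * (indicator (cball 0 (R + 1)) x :: complex)" for x :: 'a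
  have h: "integrable lebesgue h" "h \<in> Lp 2"
    unfolding h_def using indicator_cball_integrable[of "R + 1", where 'a='a] Lp2_cmult(1) by auto
  have uh: "norm (u n x) \<le> norm (h x)" for n x
    unfolding u_def h_def norm_mult using mult_mono[OF cut[of x] clampM[of "g n x"]] M(2)
    by (simp add: mult.commute)
  have um: "u n \<in> borel_measurable lebesgue" for n
    using borel_measurable_continuous_onI[OF cont] by (intro measurable_completion) simp
  have ui: "integrable lebesgue (u n)" for n
    by (rule Bochner_Integration.integrable_bound[OF h(1) um]) (use uh in auto)
  have uM: "norm (u n x) \<le> M" for n x
    using uh[of n x] M(2) by (cases "norm x \<le> R + 1") (auto simp: h_def norm_mult)
  have 1: "plancherel_fun (u n)" for n
    unfolding plancherel_fun_def using plancherel_bounded_continuous[OF cont uM ui] ui by blast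
  have 2: "plancherel_fun (\<lambda>x. u m x - u n x)" for m n
  proof -
    have "norm (u m x - u n x) \<le> 2 * M" for x
      using norm_triangle_ineq4[of "u m x" "u n x"] uM[of m x] uM[of n x] by simp
    then show ?thesis
      unfolding plancherel_fun_def
      using plancherel_bounded_continuous[of "\<lambda>x. u m x - u n x" "2 * M"] ui[of m] ui[of n]
        continuous_on_diff[OF cont[of m] cont[of n]] by simp
  qed
  have "AE x in lebesgue. x \<notin> N"
    using N by (intro AE_not_in) (simp add: negligible_iff_null_sets)
  then have "AE x in lebesgue. (\<lambda>n. u n x) \<longlonglongrightarrow> f x"
  proof eventually_elim
    case (elim x)
    have "(\<lambda>n. clamp (g n x)) \<longlonglongrightarrow> clamp (f x)"
      by (rule continuous_on_tendsto_compose[OF clamp lim[OF elim]]) auto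
    then have "(\<lambda>n. u n x) \<longlonglongrightarrow> cut x * clamp (f x)"
      unfolding u_def by (intro tendsto_intros)
    moreover have "clamp (f x) = f x" using M by (simp add: clamp_def max_absorb1)
    moreover have "cut x * f x = f x" using R[of x] by (cases "norm x > R") (auto simp: cut_def)
    ultimately show "(\<lambda>n. u n x) \<longlonglongrightarrow> f x" by simp
  qed
  with 1 2 f h uh show ?thesis by (intro plancherel_fun_limit[of u f h]) auto
qed

text \<open>Cutting \<open>f\<close> off in height and space reduces this to the bounded case; \<open>f\<close> itself dominates.\<close>

theorem plancherel_L1_L2:
  fixes f :: "'a::euclidean_space \<Rightarrow> complex"
  assumes "integrable lebesgue f" "f \<in> Lp 2"
  shows "fourier_integral f \<in> Lp 2" "Lp_norm 2 (fourier_integral f) = Lp_norm 2 f"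
proof -
  have f [measurable]: "f \<in> borel_measurable lebesgue" using assms by auto
  have [measurable]: "(\<lambda>x::'a. norm x) \<in> borel_measurable lebesgue"
    by (rule measurable_completion) simp
  define A where "A n = {x. norm x \<le> real n \<and> norm (f x) \<le> real n}" for n :: nat
  have [measurable]: "A n \<in> sets lebesgue" for n
  proof -
    have "{x \<in> space lebesgue. norm x \<le> real n \<and> norm (f x) \<le> real n} \<in> sets lebesgue" by measurable
    then show ?thesis by (simp add: A_def)
  qed
  define u where "u n x = indicator (A n) x * f x" for n x
  have [measurable]: "u n \<in> borel_measurable lebesgue" for n unfolding u_def by measurable
  have un: "norm (u n x) \<le> real n" for n x by (auto simp: u_def A_def indicator_def)
  have uR: "u n x = 0" if "norm x > real n" for n x using that by (auto simp: u_def A_def indicator_def)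
  have uf: "norm (u n x) \<le> norm (f x)" for n x by (auto simp: u_def indicator_def)
  have 1: "plancherel_fun (u n)" for n
    using order_trans[OF un] uR by (intro plancherel_fun_bounded[of _ "real n + 1" "real n"]) auto
  have 2: "plancherel_fun (\<lambda>x. u m x - u n x)" for m n
  proof (rule plancherel_fun_bounded)
    show "norm (u m x - u n x) \<le> real m + real n + 1" for x
      using norm_triangle_ineq4[of "u m x" "u n x"] un[of m x] un[of n x] by simp
    show "u m x - u n x = 0" if "norm x > max (real m) (real n)" for x
      using that uR by simp
  qed auto
  have "(\<lambda>n. u n x) \<longlonglongrightarrow> f x" for x
  proof (rule tendsto_eventually)
    obtain M :: nat where M: "max (norm x) (norm (f x)) \<le> real M" using real_arch_simple by blast
    show "\<forall>\<^sub>F n in sequentially. u n x = f x"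
    proof (rule eventually_sequentiallyI)
      fix n assume "M \<le> n"
      then have "real M \<le> real n" by simp
      with M have "x \<in> A n" by (simp add: A_def)
      then show "u n x = f x" by (simp add: u_def)
    qed
  qed
  then have "plancherel_fun f"
    using 1 2 f assms uf by (intro plancherel_fun_limit[of u f f]) auto
  then show "fourier_integral f \<in> Lp 2" "Lp_norm 2 (fourier_integral f) = Lp_norm 2 f"
    by (auto simp: plancherel_fun_def)
qed

section \<open>The Fourier--Plancherel transform\<close>

abbreviation truncate :: "real \<Rightarrow> ('a::euclidean_space \<Rightarrow> complex) \<Rightarrow> 'a \<Rightarrow> complex" where
  "truncate R f \<equiv> \<lambda>x. indicator (cball 0 R) x * f x"

lemma truncate_measurable:
  fixes f :: "'a::euclidean_space \<Rightarrow> complex"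
  assumes "f \<in> borel_measurable lebesgue"
  shows "truncate R f \<in> borel_measurable lebesgue"
  using assms by (intro borel_measurable_times borel_measurable_indicator) auto

lemma truncate_mem:
  fixes f :: "'a::euclidean_space \<Rightarrow> complex"
  assumes "f \<in> Lp 2"
  shows "integrable lebesgue (truncate R f)" "truncate R f \<in> Lp 2"
proof -
  show "integrable lebesgue (truncate R f)"
    by (rule Lp2_Cauchy_Schwarz(1)[OF indicator_cball_integrable(2) assms])
  show "truncate R f \<in> Lp 2"
    by (rule Lp2_bound(1)[OF assms truncate_measurable[OF Lp2_measurable[OF assms]], of 1])
       (auto simp: indicator_def)
qed

lemma truncate_tendsto:
  fixes f :: "'a::euclidean_space \<Rightarrow> complex"
  assumes "f \<in> Lp 2"
  shows "((\<lambda>R. Lp_norm 2 (\<lambda>x. truncate R f x - f x)) \<longlongrightarrow> 0) at_top"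
proof (rule tendsto_at_topI_sequentially)
  fix X :: "nat \<Rightarrow> real" assume X: "filterlim X at_top sequentially"
  have f: "f \<in> borel_measurable lebesgue" using assms by (rule Lp2_measurable)
  have "(\<lambda>n. truncate (X n) f x) \<longlonglongrightarrow> f x" for x
  proof (rule tendsto_eventually)
    have "\<forall>\<^sub>F n in sequentially. norm x \<le> X n" using X by (simp add: filterlim_at_top)
    then show "\<forall>\<^sub>F n in sequentially. truncate (X n) f x = f x"
      by eventually_elim (simp add: indicator_def)
  qed
  then show "(\<lambda>n. Lp_norm 2 (\<lambda>x. truncate (X n) f x - f x)) \<longlonglongrightarrow> 0"
    by (intro Lp2_dominated_convergence(2)[OF truncate_measurable[OF f] f assms])
       (auto simp: indicator_def)
qed

lemma plancherel_diff:
  fixes u v :: "'a::euclidean_space \<Rightarrow> complex"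
  assumes "integrable lebesgue u" "u \<in> Lp 2" "integrable lebesgue v" "v \<in> Lp 2"
  shows "Lp_norm 2 (\<lambda>\<xi>. fourier_integral u \<xi> - fourier_integral v \<xi>) = Lp_norm 2 (\<lambda>x. u x - v x)"
  using plancherel_L1_L2(2)[of "\<lambda>x. u x - v x"] fourier_integral_diff[OF assms(1,3)]
    Lp2_diff_mem[OF assms(2,4)] assms by simp

text \<open>The isometry on \<open>L\<^sup>1 \<inter> L\<^sup>2\<close> makes the transforms of the truncations a Cauchy family. Completeness gives a limit
  along integer radii; the isometry extends the convergence to real radii.\<close>

lemma fourier_L2_exists:
  fixes f :: "'a::euclidean_space \<Rightarrow> complex"
  assumes f: "f \<in> Lp 2"
  shows "\<exists>F. F \<in> Lp 2 \<and> tendsto_Lp 2 (\<lambda>R. fourier_integral (truncate R f)) F at_top"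
proof -
  have FL: "fourier_integral (truncate R f) \<in> Lp 2" for R
    by (rule plancherel_L1_L2(1)[OF truncate_mem[OF f]])
  have seq: "(\<lambda>n. Lp_norm 2 (\<lambda>x. truncate (real n) f x - f x)) \<longlonglongrightarrow> 0"
    using truncate_tendsto[OF f] filterlim_real_sequentially by (rule filterlim_compose)
  have "Lp2_Cauchy (\<lambda>n. truncate (real n) f)"
    by (rule Lp2_convergent_imp_Cauchy[OF truncate_mem(2)[OF f] f seq])
  then have "Lp2_Cauchy (\<lambda>n. fourier_integral (truncate (real n) f))"
    unfolding Lp2_Cauchy_def plancherel_diff[OF truncate_mem[OF f] truncate_mem[OF f]] .
  then obtain G where G: "G \<in> Lp 2" "(\<lambda>n. Lp_norm 2 (\<lambda>\<xi>. fourier_integral (truncate (real n) f) \<xi> - G \<xi>)) \<longlonglongrightarrow> 0"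
    using Lp2_complete[of "\<lambda>n. fourier_integral (truncate (real n) f)"] FL by blast
  have le: "Lp_norm 2 (\<lambda>\<xi>. fourier_integral (truncate R f) \<xi> - G \<xi>) \<le> Lp_norm 2 (\<lambda>x. truncate R f x - f x)" for R
  proof (rule tendsto_lowerbound[where F = sequentially])
    show "(\<lambda>n. Lp_norm 2 (\<lambda>x. truncate R f x - f x) + Lp_norm 2 (\<lambda>x. truncate (real n) f x - f x)
        + Lp_norm 2 (\<lambda>\<xi>. fourier_integral (truncate (real n) f) \<xi> - G \<xi>))
        \<longlonglongrightarrow> Lp_norm 2 (\<lambda>x. truncate R f x - f x)"
      using tendsto_add[OF tendsto_add[OF tendsto_const seq] G(2)] by simp
    show "\<forall>\<^sub>F n in sequentially. Lp_norm 2 (\<lambda>\<xi>. fourier_integral (truncate R f) \<xi> - G \<xi>)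
        \<le> Lp_norm 2 (\<lambda>x. truncate R f x - f x) + Lp_norm 2 (\<lambda>x. truncate (real n) f x - f x)
        + Lp_norm 2 (\<lambda>\<xi>. fourier_integral (truncate (real n) f) \<xi> - G \<xi>)"
    proof (intro always_eventually allI)
      fix n :: nat
      show "Lp_norm 2 (\<lambda>\<xi>. fourier_integral (truncate R f) \<xi> - G \<xi>)
        \<le> Lp_norm 2 (\<lambda>x. truncate R f x - f x) + Lp_norm 2 (\<lambda>x. truncate (real n) f x - f x)
        + Lp_norm 2 (\<lambda>\<xi>. fourier_integral (truncate (real n) f) \<xi> - G \<xi>)"
        using Lp_norm2_diff_triangle[OF FL[of R] FL[of "real n"] G(1)]
          plancherel_diff[OF truncate_mem[OF f, of R] truncate_mem[OF f, of "real n"]]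
          Lp_norm2_diff_triangle[OF truncate_mem(2)[OF f, of R] f truncate_mem(2)[OF f, of "real n"]]
          Lp_norm_minus_commute[of 2 f "truncate (real n) f"] by linarith
    qed
  qed simp
  have "((\<lambda>R. Lp_norm 2 (\<lambda>\<xi>. fourier_integral (truncate R f) \<xi> - G \<xi>)) \<longlongrightarrow> 0) at_top"
    by (rule Lim_null_comparison[OF _ truncate_tendsto[OF f]])
       (use le in \<open>auto intro!: always_eventually simp: Lp_norm_nonneg\<close>)
  with G(1) show ?thesis using tendsto_Lp2I[of "\<lambda>R. fourier_integral (truncate R f)", OF FL G(1)] by blast
qed

lemma fourier_L2_spec:
  assumes "f \<in> Lp 2"
  shows "fourier_L2 f \<in> Lp 2"
    "((\<lambda>R. Lp_norm 2 (\<lambda>\<xi>. fourier_integral (truncate R f) \<xi> - fourier_L2 f \<xi>)) \<longlongrightarrow> 0) at_top"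
  using someI_ex[OF fourier_L2_exists[OF assms]] unfolding fourier_L2_def tendsto_Lp_def by auto

text \<open>For the truncations of \<open>f\<close> in place of \<open>f\<close> this is the isometry on \<open>L\<^sup>1 \<inter> L\<^sup>2\<close>; both sides pass to the limit.
  It shows that any approximating sequence computes the transform, not only the truncations.\<close>

lemma fourier_L2_approx:
  fixes f :: "'a::euclidean_space \<Rightarrow> complex"
  assumes u: "integrable lebesgue u" "u \<in> Lp 2" and f: "f \<in> Lp 2"
  shows "Lp_norm 2 (\<lambda>\<xi>. fourier_integral u \<xi> - fourier_L2 f \<xi>) \<le> Lp_norm 2 (\<lambda>x. u x - f x)"
proof (rule tendsto_lowerbound[where F = "at_top :: real filter"])
  show "((\<lambda>R. Lp_norm 2 (\<lambda>x. u x - f x) + Lp_norm 2 (\<lambda>x. truncate R f x - f x)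
      + Lp_norm 2 (\<lambda>\<xi>. fourier_integral (truncate R f) \<xi> - fourier_L2 f \<xi>))
      \<longlongrightarrow> Lp_norm 2 (\<lambda>x. u x - f x)) at_top"
    using tendsto_add[OF tendsto_add[OF tendsto_const truncate_tendsto[OF f]] fourier_L2_spec(2)[OF f]] by simp
  show "\<forall>\<^sub>F R in at_top. Lp_norm 2 (\<lambda>\<xi>. fourier_integral u \<xi> - fourier_L2 f \<xi>)
      \<le> Lp_norm 2 (\<lambda>x. u x - f x) + Lp_norm 2 (\<lambda>x. truncate R f x - f x)
      + Lp_norm 2 (\<lambda>\<xi>. fourier_integral (truncate R f) \<xi> - fourier_L2 f \<xi>)"
  proof (intro always_eventually allI)
    fix R :: real
    show "Lp_norm 2 (\<lambda>\<xi>. fourier_integral u \<xi> - fourier_L2 f \<xi>)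
      \<le> Lp_norm 2 (\<lambda>x. u x - f x) + Lp_norm 2 (\<lambda>x. truncate R f x - f x)
      + Lp_norm 2 (\<lambda>\<xi>. fourier_integral (truncate R f) \<xi> - fourier_L2 f \<xi>)"
      using Lp_norm2_diff_triangle[OF plancherel_L1_L2(1)[OF u] plancherel_L1_L2(1)[OF truncate_mem[OF f, of R]] fourier_L2_spec(1)[OF f]]
        plancherel_diff[OF u truncate_mem[OF f, of R]]
        Lp_norm2_diff_triangle[OF u(2) f truncate_mem(2)[OF f, of R]]
        Lp_norm_minus_commute[of 2 f "truncate R f"] by linarith
  qed
qed simp

lemma fourier_L2_limit:
  fixes f :: "'a::euclidean_space \<Rightarrow> complex"
  assumes "\<And>n. integrable lebesgue (u n)" "\<And>n. u n \<in> Lp 2" "f \<in> Lp 2"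
    and "((\<lambda>n. Lp_norm 2 (\<lambda>x. u n x - f x)) \<longlongrightarrow> 0) F"
  shows "((\<lambda>n. Lp_norm 2 (\<lambda>\<xi>. fourier_integral (u n) \<xi> - fourier_L2 f \<xi>)) \<longlongrightarrow> 0) F"
  by (rule Lim_null_comparison[OF _ assms(4)])
     (use fourier_L2_approx[OF assms(1-3)] in \<open>auto intro!: always_eventually simp: Lp_norm_nonneg\<close>)

lemma fourier_L2_eq_integral:
  fixes f :: "'a::euclidean_space \<Rightarrow> complex"
  assumes "integrable lebesgue f" "f \<in> Lp 2"
  shows "AE \<xi> in lebesgue. fourier_L2 f \<xi> = fourier_integral f \<xi>"
proof -
  have "Lp_norm 2 (\<lambda>\<xi>. fourier_integral f \<xi> - fourier_L2 f \<xi>) \<le> 0"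
    using fourier_L2_approx[OF assms assms(2)] by (simp add: Lp_norm_def)
  then have "AE \<xi> in lebesgue. fourier_integral f \<xi> - fourier_L2 f \<xi> = 0"
    by (intro Lp_norm2_zero_AE Lp2_diff_mem plancherel_L1_L2 fourier_L2_spec assms)
       (simp add: Lp_norm_nonneg antisym)
  then show ?thesis by eventually_elim simp
qed

theorem fourier_L2_norm:
  fixes f :: "'a::euclidean_space \<Rightarrow> complex"
  assumes "f \<in> Lp 2"
  shows "Lp_norm 2 (fourier_L2 f) = Lp_norm 2 f"
proof (rule tendsto_unique[where F = "at_top :: real filter"])
  show "((\<lambda>R. Lp_norm 2 (fourier_integral (truncate R f))) \<longlongrightarrow> Lp_norm 2 (fourier_L2 f)) at_top"
    by (rule Lp_norm2_tendsto[OF plancherel_L1_L2(1)[OF truncate_mem[OF assms]] fourier_L2_spec[OF assms]])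
  show "((\<lambda>R. Lp_norm 2 (fourier_integral (truncate R f))) \<longlongrightarrow> Lp_norm 2 f) at_top"
    unfolding plancherel_L1_L2(2)[OF truncate_mem[OF assms]]
    by (rule Lp_norm2_tendsto[OF truncate_mem(2)[OF assms] assms truncate_tendsto[OF assms]])
qed simp

lemma Lp2_lincomb:
  assumes "f \<in> Lp 2" "g \<in> Lp 2"
  shows "(\<lambda>x. c * f x + d * g x) \<in> Lp 2"
    "Lp_norm 2 (\<lambda>x. c * f x + d * g x) \<le> norm c * Lp_norm 2 f + norm d * Lp_norm 2 g"
  using Lp2_add_mem[OF Lp2_cmult(1)[OF assms(1)] Lp2_cmult(1)[OF assms(2)]]
    Lp_norm2_triangle[OF Lp2_cmult(1)[OF assms(1)] Lp2_cmult(1)[OF assms(2)]]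
    Lp2_cmult(2)[OF assms(1)] Lp2_cmult(2)[OF assms(2)] by simp_all

lemma Lp2_lincomb_tendsto:
  assumes "\<And>n. f n \<in> Lp 2" "f' \<in> Lp 2" "\<And>n. g n \<in> Lp 2" "g' \<in> Lp 2"
    and "((\<lambda>n. Lp_norm 2 (\<lambda>x. f n x - f' x)) \<longlongrightarrow> 0) F" "((\<lambda>n. Lp_norm 2 (\<lambda>x. g n x - g' x)) \<longlongrightarrow> 0) F"
  shows "((\<lambda>n. Lp_norm 2 (\<lambda>x. (c * f n x + d * g n x) - (c * f' x + d * g' x))) \<longlongrightarrow> 0) F"
proof (rule Lim_null_comparison)
  show "((\<lambda>n. norm c * Lp_norm 2 (\<lambda>x. f n x - f' x) + norm d * Lp_norm 2 (\<lambda>x. g n x - g' x)) \<longlongrightarrow> 0) F"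
    using tendsto_add[OF tendsto_mult_left[OF assms(5)] tendsto_mult_left[OF assms(6)]] by simp
  have "(\<lambda>x. (c * f n x + d * g n x) - (c * f' x + d * g' x)) = (\<lambda>x. c * (f n x - f' x) + d * (g n x - g' x))" for n
    by (simp add: algebra_simps)
  then show "\<forall>\<^sub>F n in F. norm (Lp_norm 2 (\<lambda>x. (c * f n x + d * g n x) - (c * f' x + d * g' x)))
      \<le> norm c * Lp_norm 2 (\<lambda>x. f n x - f' x) + norm d * Lp_norm 2 (\<lambda>x. g n x - g' x)"
    using Lp2_lincomb(2)[OF Lp2_diff_mem[OF assms(1,2)] Lp2_diff_mem[OF assms(3,4)]]
    by (simp add: Lp_norm_nonneg)
qed

lemma fourier_integral_lincomb:
  fixes f g :: "'a::euclidean_space \<Rightarrow> complex"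
  assumes "integrable lebesgue f" "integrable lebesgue g"
  shows "fourier_integral (\<lambda>x. c * f x + d * g x) = (\<lambda>\<xi>. c * fourier_integral f \<xi> + d * fourier_integral g \<xi>)"
proof
  fix \<xi>
  have "(\<integral>x. cis (- (x \<bullet> \<xi>)) * (c * f x + d * g x) \<partial>lebesgue)
      = (\<integral>x. c * (cis (- (x \<bullet> \<xi>)) * f x) + d * (cis (- (x \<bullet> \<xi>)) * g x) \<partial>lebesgue)"
    by (simp add: algebra_simps)
  also have "\<dots> = c * (\<integral>x. cis (- (x \<bullet> \<xi>)) * f x \<partial>lebesgue) + d * (\<integral>x. cis (- (x \<bullet> \<xi>)) * g x \<partial>lebesgue)"
    using fourier_integrand_integrable[OF assms(1)] fourier_integrand_integrable[OF assms(2)] by simp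
  finally show "fourier_integral (\<lambda>x. c * f x + d * g x) \<xi> = c * fourier_integral f \<xi> + d * fourier_integral g \<xi>"
    by (simp add: fourier_integral_def' algebra_simps)
qed

lemma fourier_L2_lincomb:
  fixes f g :: "'a::euclidean_space \<Rightarrow> complex"
  assumes f: "f \<in> Lp 2" and g: "g \<in> Lp 2"
  shows "AE \<xi> in lebesgue. fourier_L2 (\<lambda>x. c * f x + d * g x) \<xi> = c * fourier_L2 f \<xi> + d * fourier_L2 g \<xi>"
proof -
  let ?u = "\<lambda>R x. c * truncate R f x + d * truncate R g x"
  have u: "integrable lebesgue (?u R)" "?u R \<in> Lp 2" for R
    using truncate_mem(1)[OF f] truncate_mem(1)[OF g] Lp2_lincomb(1)[OF truncate_mem(2)[OF f] truncate_mem(2)[OF g]]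
    by auto
  have fg: "(\<lambda>x. c * f x + d * g x) \<in> Lp 2" by (rule Lp2_lincomb(1)[OF f g])
  have "((\<lambda>R. Lp_norm 2 (\<lambda>\<xi>. fourier_integral (?u R) \<xi> - fourier_L2 (\<lambda>x. c * f x + d * g x) \<xi>)) \<longlongrightarrow> 0) at_top"
    using Lp2_lincomb_tendsto[OF truncate_mem(2)[OF f] f truncate_mem(2)[OF g] g truncate_tendsto[OF f] truncate_tendsto[OF g]]
    by (intro fourier_L2_limit[OF u fg])
  moreover have "((\<lambda>R. Lp_norm 2 (\<lambda>\<xi>. fourier_integral (?u R) \<xi> - (c * fourier_L2 f \<xi> + d * fourier_L2 g \<xi>))) \<longlongrightarrow> 0) at_top"
    unfolding fourier_integral_lincomb[OF truncate_mem(1)[OF f] truncate_mem(1)[OF g]]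
    by (intro Lp2_lincomb_tendsto plancherel_L1_L2(1) truncate_mem f g fourier_L2_spec)
  ultimately show ?thesis
    by (rule Lp2_limit_unique[OF plancherel_L1_L2(1)[OF u] fourier_L2_spec(1)[OF fg]
          Lp2_lincomb(1)[OF fourier_L2_spec(1)[OF f] fourier_L2_spec(1)[OF g]]]) simp
qed

lemma fourier_L2_multiplication_formula:
  fixes f g :: "'a::euclidean_space \<Rightarrow> complex"
  assumes f: "f \<in> Lp 2" and g: "g \<in> Lp 2"
  shows "(\<integral>x. fourier_L2 f x * g x \<partial>lebesgue) = (\<integral>x. f x * fourier_L2 g x \<partial>lebesgue)"
proof -
  have half: "(\<integral>x. fourier_L2 f x * v x \<partial>lebesgue) = (\<integral>x. f x * fourier_integral v x \<partial>lebesgue)"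
    if v: "integrable lebesgue v" "v \<in> Lp 2" for v
  proof (rule tendsto_unique[where F = "at_top :: real filter"])
    show "((\<lambda>R. \<integral>x. fourier_integral (truncate R f) x * v x \<partial>lebesgue) \<longlongrightarrow> (\<integral>x. fourier_L2 f x * v x \<partial>lebesgue)) at_top"
      by (intro Lp2_integral_mult_tendsto plancherel_L1_L2(1) truncate_mem f v fourier_L2_spec)
    show "((\<lambda>R. \<integral>x. fourier_integral (truncate R f) x * v x \<partial>lebesgue) \<longlongrightarrow> (\<integral>x. f x * fourier_integral v x \<partial>lebesgue)) at_top"
      unfolding fourier_multiplication_formula[OF truncate_mem(1)[OF f] v(1)]
      by (intro Lp2_integral_mult_tendsto plancherel_L1_L2(1) truncate_mem f v truncate_tendsto)
  qed simp
  show ?thesis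
  proof (rule tendsto_unique[where F = "at_top :: real filter"])
    show "((\<lambda>R. \<integral>x. truncate R g x * fourier_L2 f x \<partial>lebesgue) \<longlongrightarrow> (\<integral>x. fourier_L2 f x * g x \<partial>lebesgue)) at_top"
      unfolding mult.commute[of "fourier_L2 f _"]
      by (intro Lp2_integral_mult_tendsto truncate_mem(2) f g fourier_L2_spec(1) truncate_tendsto)
    have eq: "(\<integral>x. truncate R g x * fourier_L2 f x \<partial>lebesgue) = (\<integral>x. fourier_integral (truncate R g) x * f x \<partial>lebesgue)" for R
      using half[OF truncate_mem[OF g, of R]] by (simp only: mult.commute)
    show "((\<lambda>R. \<integral>x. truncate R g x * fourier_L2 f x \<partial>lebesgue) \<longlongrightarrow> (\<integral>x. f x * fourier_L2 g x \<partial>lebesgue)) at_top"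
      unfolding eq mult.commute[of "f _"]
      by (intro Lp2_integral_mult_tendsto plancherel_L1_L2(1) truncate_mem f g fourier_L2_spec)
  qed simp
qed

text \<open>Conjugating before and after the transform replaces \<open>cis (- (x \<bullet> \<xi>))\<close> by \<open>cis (x \<bullet> \<xi>)\<close>, so this is the
  inverse transform; in this form the multiplication formula applies to it directly.\<close>

definition inverse_fourier_L2 :: "('a::euclidean_space \<Rightarrow> complex) \<Rightarrow> 'a \<Rightarrow> complex" where
  "inverse_fourier_L2 g = (\<lambda>x. cnj (fourier_L2 (\<lambda>\<xi>. cnj (g \<xi>)) x))"

lemma Lp2_cnj: "f \<in> Lp 2 \<Longrightarrow> (\<lambda>x. cnj (f x)) \<in> Lp 2" "Lp_norm 2 (\<lambda>x. cnj (f x)) = Lp_norm 2 f"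
  by (auto simp: Lp2_iff Lp_norm2_eq intro: borel_measurable_cnj)

text \<open>With \<open>u\<close> the inverse transform of \<open>g\<close>, the multiplication formula gives
  \<open>\<langle>F u, g\<rangle> = \<parallel>u\<parallel>\<^sup>2\<close>. Since \<open>F\<close> is isometric, expanding the square yields \<open>\<parallel>F u - g\<parallel>\<^sup>2 = 0\<close>.\<close>

theorem fourier_L2_inverse:
  fixes g :: "'a::euclidean_space \<Rightarrow> complex"
  assumes g: "g \<in> Lp 2"
  shows "inverse_fourier_L2 g \<in> Lp 2" "Lp_norm 2 (inverse_fourier_L2 g) = Lp_norm 2 g"
    "AE \<xi> in lebesgue. fourier_L2 (inverse_fourier_L2 g) \<xi> = g \<xi>"
proof -
  define u where "u = inverse_fourier_L2 g"
  have cg: "(\<lambda>\<xi>. cnj (g \<xi>)) \<in> Lp 2" by (rule Lp2_cnj(1)[OF g])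
  have u: "u \<in> Lp 2"
    unfolding u_def inverse_fourier_L2_def by (rule Lp2_cnj(1)[OF fourier_L2_spec(1)[OF cg]])
  have uN: "Lp_norm 2 u = Lp_norm 2 g"
    unfolding u_def inverse_fourier_L2_def Lp2_cnj(2) fourier_L2_norm[OF cg] ..
  show "inverse_fourier_L2 g \<in> Lp 2" "Lp_norm 2 (inverse_fourier_L2 g) = Lp_norm 2 g"
    using u uN by (simp_all add: u_def)
  note Fu = fourier_L2_spec(1)[OF u]
  have "(\<integral>x. fourier_L2 u x * cnj (g x) \<partial>lebesgue) = (\<integral>x. u x * cnj (u x) \<partial>lebesgue)"
    unfolding fourier_L2_multiplication_formula[OF u cg] by (simp add: u_def inverse_fourier_L2_def)
  also have "\<dots> = of_real ((Lp_norm 2 u)\<^sup>2)"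
    unfolding complex_norm_square[symmetric] integral_complex_of_real Lp_norm2_sq ..
  finally have ip: "(\<integral>x. Re (fourier_L2 u x * cnj (g x)) \<partial>lebesgue) = (Lp_norm 2 g)\<^sup>2"
    using integral_Re[OF Lp2_Cauchy_Schwarz(1)[OF Fu cg]] uN by simp
  define q where "q x = Re (fourier_L2 u x * cnj (g x))" for x
  have q: "integrable lebesgue q" "(\<integral>x. q x \<partial>lebesgue) = (Lp_norm 2 g)\<^sup>2"
    unfolding q_def using ip integrable_Re[OF Lp2_Cauchy_Schwarz(1)[OF Fu cg]] by blast+
  have "(Lp_norm 2 (\<lambda>x. fourier_L2 u x - g x))\<^sup>2
      = (\<integral>x. (norm (fourier_L2 u x))\<^sup>2 - 2 * q x + (norm (g x))\<^sup>2 \<partial>lebesgue)"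
    unfolding Lp_norm2_sq q_def
    by (intro Bochner_Integration.integral_cong refl)
       (simp only: cmod_power2, simp add: power2_eq_square algebra_simps)
  also have "\<dots> = (Lp_norm 2 (fourier_L2 u))\<^sup>2 - 2 * (Lp_norm 2 g)\<^sup>2 + (Lp_norm 2 g)\<^sup>2"
    unfolding q(2)[symmetric] using Fu g q(1) by (simp add: Lp2_iff Lp_norm2_sq[of "fourier_L2 u"])
       (simp add: Lp_norm2_sq[symmetric] q(2))
  also have "\<dots> = 0" using fourier_L2_norm[OF u] uN by simp
  finally have "AE x in lebesgue. fourier_L2 u x - g x = 0"
    by (intro Lp_norm2_zero_AE Lp2_diff_mem Fu g) simp
  then show "AE \<xi> in lebesgue. fourier_L2 (inverse_fourier_L2 g) \<xi> = g \<xi>"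
    by eventually_elim (simp add: u_def)
qed

section \<open>The Fourier multipliers of the equation\<close>

text \<open>With \<open>r = |\<xi>|\<^bsup>\<sigma>\<^esup>\<close> the equation becomes on the Fourier side the damped oscillator
  \<open>y'' + r y' + r\<^sup>2 y = 0\<close>. Its solutions with \<open>(y(0), y'(0)) = (1, 0)\<close> and \<open>(0, 1)\<close> are \<open>osc0\<close> and \<open>osc1\<close>; the
  primed functions are their time derivatives.\<close>

definition osc0 :: "real \<Rightarrow> real \<Rightarrow> real" where
  "osc0 r t = exp (- (r * t / 2)) * (cos (sqrt 3 / 2 * (r * t)) + sin (sqrt 3 / 2 * (r * t)) / sqrt 3)"

definition osc1 :: "real \<Rightarrow> real \<Rightarrow> real" where
  "osc1 r t = exp (- (r * t / 2)) * sin (sqrt 3 / 2 * (r * t)) / (sqrt 3 / 2 * r)"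

definition osc0' :: "real \<Rightarrow> real \<Rightarrow> real" where
  "osc0' r t = - (r * (exp (- (r * t / 2)) * sin (sqrt 3 / 2 * (r * t)) / (sqrt 3 / 2)))"

definition osc1' :: "real \<Rightarrow> real \<Rightarrow> real" where
  "osc1' r t = exp (- (r * t / 2)) * (cos (sqrt 3 / 2 * (r * t)) - sin (sqrt 3 / 2 * (r * t)) / sqrt 3)"

lemma roots_eq:
  fixes \<xi> :: "'a::euclidean_space"
  assumes "\<delta> = \<sigma> / 2" "\<xi> \<noteq> 0"
  defines "r \<equiv> norm \<xi> powr \<sigma>"
  shows "root1 \<sigma> \<delta> \<xi> = of_real r * Complex (- 1 / 2) (sqrt 3 / 2)"
    "root2 \<sigma> \<delta> \<xi> = of_real r * Complex (- 1 / 2) (- (sqrt 3 / 2))"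
proof -
  have r: "r > 0" using assms(2) by (simp add: r_def)
  have e: "norm \<xi> powr (2 * \<delta>) = r" "norm \<xi> powr (4 * \<delta>) = r\<^sup>2" "norm \<xi> powr (2 * \<sigma>) = r\<^sup>2"
  proof -
    have "2 * \<delta> = \<sigma>" using assms(1) by simp
    then show "norm \<xi> powr (2 * \<delta>) = r" by (simp only: r_def)
    show *: "norm \<xi> powr (2 * \<sigma>) = r\<^sup>2"
      unfolding r_def power2_eq_square powr_add[symmetric] by (simp only: mult_2)
    have "4 * \<delta> = 2 * \<sigma>" using assms(1) by simp
    then show "norm \<xi> powr (4 * \<delta>) = r\<^sup>2" using * by (simp only:)
  qed
  have "norm \<xi> powr (4 * \<delta>) - 4 * norm \<xi> powr (2 * \<sigma>) = - (3 * r\<^sup>2)" unfolding e by simp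
  moreover have "csqrt (complex_of_real (- (3 * r\<^sup>2))) = \<i> * of_real (sqrt 3 * r)"
    using r by (subst csqrt_of_real_nonpos) (simp_all add: real_sqrt_mult)
  ultimately have s: "csqrt (complex_of_real (norm \<xi> powr (4 * \<delta>) - 4 * norm \<xi> powr (2 * \<sigma>))) = \<i> * of_real (sqrt 3 * r)"
    by simp
  show "root1 \<sigma> \<delta> \<xi> = of_real r * Complex (- 1 / 2) (sqrt 3 / 2)"
    "root2 \<sigma> \<delta> \<xi> = of_real r * Complex (- 1 / 2) (- (sqrt 3 / 2))"
    unfolding root1_def root2_def s e(1) by (simp_all add: complex_eq_iff)
qed

lemma kernel_eq:
  fixes \<xi> :: "'a::euclidean_space"
  assumes "\<delta> = \<sigma> / 2" "\<xi> \<noteq> 0"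
  shows "kernel0 \<sigma> \<delta> t \<xi> = of_real (osc0 (norm \<xi> powr \<sigma>) t)"
    "kernel1 \<sigma> \<delta> t \<xi> = of_real (osc1 (norm \<xi> powr \<sigma>) t)"
proof -
  define r where "r = norm \<xi> powr \<sigma>"
  define \<omega> where "\<omega> = sqrt 3 / 2 * (r * t)"
  have r: "r > 0" using assms(2) by (simp add: r_def)
  note R = roots_eq[OF assms, folded r_def]
  have e1: "exp (root1 \<sigma> \<delta> \<xi> * of_real t) = of_real (exp (- (r * t / 2))) * Complex (cos \<omega>) (sin \<omega>)"
    unfolding R by (simp add: complex_eq_iff Re_exp Im_exp \<omega>_def algebra_simps)
  have e2: "exp (root2 \<sigma> \<delta> \<xi> * of_real t) = of_real (exp (- (r * t / 2))) * Complex (cos \<omega>) (- sin \<omega>)"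
    unfolding R by (simp add: complex_eq_iff Re_exp Im_exp \<omega>_def algebra_simps)
  have d: "root1 \<sigma> \<delta> \<xi> - root2 \<sigma> \<delta> \<xi> = Complex 0 (sqrt 3 * r)"
    unfolding R by (simp add: complex_eq_iff)
  have nz: "Complex 0 (sqrt 3 * r) \<noteq> 0" using r by (simp add: complex_eq_iff)
  have s3: "sqrt 3 * (sqrt 3 * x) = (3::real) * x" for x by (simp flip: mult.assoc)
  have o0: "osc0 r t = exp (- (r * t / 2)) * (cos \<omega> + sin \<omega> / sqrt 3)"
    unfolding osc0_def \<omega>_def ..
  have o1: "osc1 r t = exp (- (r * t / 2)) * sin \<omega> / (sqrt 3 / 2 * r)"
    unfolding osc1_def \<omega>_def ..
  have "root1 \<sigma> \<delta> \<xi> * exp (root2 \<sigma> \<delta> \<xi> * of_real t) - root2 \<sigma> \<delta> \<xi> * exp (root1 \<sigma> \<delta> \<xi> * of_real t)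
      = of_real (osc0 r t) * Complex 0 (sqrt 3 * r)"
    unfolding e1 e2 unfolding R o0 by (simp add: complex_eq_iff field_simps s3)
  then show "kernel0 \<sigma> \<delta> t \<xi> = of_real (osc0 (norm \<xi> powr \<sigma>) t)"
    unfolding kernel0_def d r_def[symmetric] using nz by simp
  have "exp (root1 \<sigma> \<delta> \<xi> * of_real t) - exp (root2 \<sigma> \<delta> \<xi> * of_real t)
      = of_real (osc1 r t) * Complex 0 (sqrt 3 * r)"
    unfolding e1 e2 o1 using r by (simp add: complex_eq_iff field_simps)
  then show "kernel1 \<sigma> \<delta> t \<xi> = of_real (osc1 (norm \<xi> powr \<sigma>) t)"
    unfolding kernel1_def d r_def[symmetric] using nz by simp
qed

lemma osc_deriv:
  assumes "r > 0"
  shows "((\<lambda>t. osc0 r t) has_real_derivative osc0' r t) (at t within S)"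
    "((\<lambda>t. osc1 r t) has_real_derivative osc1' r t) (at t within S)"
proof -
  have s3: "sqrt 3 * (sqrt 3 * x) = (3::real) * x" for x by (simp flip: mult.assoc)
  show "((\<lambda>t. osc0 r t) has_real_derivative osc0' r t) (at t within S)"
    unfolding osc0_def osc0'_def using assms
    by (auto intro!: derivative_eq_intros simp: field_simps s3)
  show "((\<lambda>t. osc1 r t) has_real_derivative osc1' r t) (at t within S)"
    unfolding osc1_def osc1'_def using assms
    by (auto intro!: derivative_eq_intros simp: field_simps s3)
qed

text \<open>Of the two bounds for \<open>osc1\<close>, the one with \<open>t\<close> is effective for \<open>r t \<le> 1\<close>, the one with \<open>2 / r\<close>
  for large \<open>r t\<close>. The loss of a factor \<open>t\<close> in the estimate for \<open>w1\<close> comes from the former.\<close>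

lemma osc_bounds:
  assumes r: "r > 0" and t: "t \<ge> 0"
  shows "\<bar>osc0 r t\<bar> \<le> 2 * exp (- (r * t / 2))"
    "\<bar>osc0' r t\<bar> \<le> 2 * r * exp (- (r * t / 2))"
    "\<bar>osc1 r t\<bar> \<le> t * exp (- (r * t / 2))"
    "\<bar>osc1 r t\<bar> \<le> 2 / r * exp (- (r * t / 2))"
    "\<bar>osc1' r t\<bar> \<le> 2 * exp (- (r * t / 2))"
proof -
  have s3: "1 \<le> sqrt (3::real)" by simp
  define \<omega> where "\<omega> = sqrt 3 / 2 * (r * t)"
  have \<omega>0: "0 \<le> \<omega>" using assms by (simp add: \<omega>_def)
  have sin3: "\<bar>sin \<omega> / sqrt 3\<bar> \<le> 1"
  proof -
    have "\<bar>sin \<omega>\<bar> \<le> sqrt 3" using s3 abs_sin_le_one[of \<omega>] by linarith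
    then show ?thesis by (simp add: abs_divide)
  qed
  have cos1: "\<bar>cos \<omega>\<bar> \<le> 1" by simp
  have "\<bar>cos \<omega> + sin \<omega> / sqrt 3\<bar> \<le> 2"
    using sin3 cos1 abs_triangle_ineq[of "cos \<omega>" "sin \<omega> / sqrt 3"] by linarith
  then show "\<bar>osc0 r t\<bar> \<le> 2 * exp (- (r * t / 2))"
    unfolding osc0_def \<omega>_def[symmetric] abs_mult by simp
  have "\<bar>cos \<omega> - sin \<omega> / sqrt 3\<bar> \<le> 2"
    using sin3 cos1 abs_triangle_ineq4[of "cos \<omega>" "sin \<omega> / sqrt 3"] by linarith
  then show "\<bar>osc1' r t\<bar> \<le> 2 * exp (- (r * t / 2))"
    unfolding osc1'_def \<omega>_def[symmetric] abs_mult by simp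
  have s2: "\<bar>sin \<omega>\<bar> / (sqrt 3 / 2) \<le> 2"
  proof -
    have "\<bar>sin \<omega>\<bar> \<le> 2 * (sqrt 3 / 2)" using s3 abs_sin_le_one[of \<omega>] by linarith
    then show ?thesis by (subst pos_divide_le_eq) simp_all
  qed
  have "\<bar>osc0' r t\<bar> = r * exp (- (r * t / 2)) * (\<bar>sin \<omega>\<bar> / (sqrt 3 / 2))"
    unfolding osc0'_def \<omega>_def[symmetric] using r by (simp add: abs_mult)
  also have "\<dots> \<le> r * exp (- (r * t / 2)) * 2" using r s2 by (intro mult_left_mono) auto
  finally show "\<bar>osc0' r t\<bar> \<le> 2 * r * exp (- (r * t / 2))" by (simp add: mult_ac)
  have o1: "\<bar>osc1 r t\<bar> = exp (- (r * t / 2)) * (\<bar>sin \<omega>\<bar> / (sqrt 3 / 2) / r)"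
    unfolding osc1_def \<omega>_def[symmetric] using r by (simp add: abs_mult)
  have "\<bar>sin \<omega>\<bar> / (sqrt 3 / 2) / r \<le> 2 / r" using r s2 by (intro divide_right_mono) auto
  then show "\<bar>osc1 r t\<bar> \<le> 2 / r * exp (- (r * t / 2))"
    unfolding o1 by (subst mult.commute) (rule mult_right_mono, auto)
  have "\<bar>sin \<omega>\<bar> \<le> \<omega>" using abs_sin_x_le_abs_x[of \<omega>] \<omega>0 by simp
  then have "\<bar>sin \<omega>\<bar> / (sqrt 3 / 2) / r \<le> \<omega> / (sqrt 3 / 2) / r"
    using r by (intro divide_right_mono) auto
  also have "\<dots> = t" using r by (simp add: \<omega>_def)
  finally show "\<bar>osc1 r t\<bar> \<le> t * exp (- (r * t / 2))"
    unfolding o1 by (subst mult.commute) (rule mult_right_mono, auto)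
qed

text \<open>The elementary inequality \<open>(1 + t) r \<le> (1 + r) (1 + r t)\<close> trades powers of \<open>r\<close> for decay in \<open>t\<close>;
  half of the exponential absorbs the powers of \<open>1 + r t\<close>.\<close>

lemma power_times_exp_decay:
  fixes p r t :: real
  assumes p: "p \<ge> 0" and r: "r > 0" and t: "t \<ge> 0"
  shows "r powr p * exp (- (r * t / 2))
    \<le> (4 * (p + 1)) powr p * (1 + t) powr (- p) * (1 + r) powr p * exp (- (r * t / 4))"
proof -
  define x where "x = r * t"
  \<comment> \<open>large enough for \<open>p * x / s \<le> x / 4\<close>, and at least \<open>1\<close>\<close>
  define s where "s = 4 * (p + 1)"
  have x: "x \<ge> 0" using r t by (simp add: x_def)
  have s: "s \<ge> 1" using p by (simp add: s_def)
  have "1 + x \<le> s * (1 + x / s)" using s by (simp add: field_simps)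
  also have "\<dots> \<le> s * exp (x / s)" using s exp_ge_add_one_self[of "x / s"] by (intro mult_left_mono) auto
  finally have "(1 + x) powr p \<le> (s * exp (x / s)) powr p" using p x by (intro powr_mono2) auto
  also have "\<dots> = s powr p * exp (p * x / s)" using s by (simp add: powr_mult exp_powr_real mult.commute)
  also have "\<dots> \<le> s powr p * exp (x / 4)"
  proof -
    have "p * x / s \<le> x / 4" using p x by (simp add: s_def field_simps)
    then show ?thesis by (intro mult_left_mono) auto
  qed
  finally have 1: "(1 + x) powr p \<le> s powr p * exp (x / 4)" .
  have "(1 + t) * r \<le> (1 + r) * (1 + x)" using r t by (simp add: x_def algebra_simps)
  then have "((1 + t) * r) powr p \<le> ((1 + r) * (1 + x)) powr p" using p r t by (intro powr_mono2) auto
  then have "(1 + t) powr p * r powr p \<le> (1 + r) powr p * (1 + x) powr p"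
    using r t x by (simp add: powr_mult)
  also have "\<dots> \<le> (1 + r) powr p * (s powr p * exp (x / 4))" using 1 by (intro mult_left_mono) auto
  finally have "(1 + t) powr p * r powr p \<le> (1 + r) powr p * (s powr p * exp (x / 4))" .
  then have "r powr p \<le> (1 + r) powr p * (s powr p * exp (x / 4)) / (1 + t) powr p"
    using t by (simp add: pos_le_divide_eq mult.commute)
  then have "r powr p * exp (- (x / 2)) \<le> (1 + r) powr p * (s powr p * exp (x / 4)) / (1 + t) powr p * exp (- (x / 2))"
    by (intro mult_right_mono) auto
  also have "\<dots> = s powr p * (1 + t) powr (- p) * (1 + r) powr p * (exp (x / 4) * exp (- (x / 2)))"
    by (simp add: powr_minus field_simps)
  also have "exp (x / 4) * exp (- (x / 2)) = exp (- (x / 4))" by (simp flip: exp_add)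
  finally show ?thesis by (simp add: x_def s_def)
qed

text \<open>Half of the decay \<open>exp (- r t / 2)\<close> of the kernels. The other half is spent on the powers of \<open>r t\<close>.\<close>

definition damping :: "real \<Rightarrow> real \<Rightarrow> 'a::euclidean_space \<Rightarrow> real" where
  "damping \<sigma> t \<xi> = exp (- (norm \<xi> powr \<sigma> * t / 4))"

definition bessel :: "real \<Rightarrow> 'a::euclidean_space \<Rightarrow> real" where
  "bessel b \<xi> = (1 + (norm \<xi>)\<^sup>2) powr (b / 2)"

lemma one_plus_norm_sq_pos: "0 < 1 + (norm (\<xi>::'a::euclidean_space))\<^sup>2"
  by (simp add: add_pos_nonneg)

lemma bessel_pos: "0 < bessel b \<xi>"
  using one_plus_norm_sq_pos[of \<xi>] by (simp add: bessel_def)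

lemma bessel_0: "bessel 0 \<xi> = 1"
  using one_plus_norm_sq_pos[of \<xi>] by (simp add: bessel_def)

lemma norm_powr_damping:
  fixes \<xi> :: "'a::euclidean_space"
  assumes \<sigma>: "\<sigma> > 0" and b: "b \<ge> 0" and t: "t \<ge> 0" and \<xi>: "\<xi> \<noteq> 0"
  shows "norm \<xi> powr b * exp (- (norm \<xi> powr \<sigma> * t / 2))
    \<le> (8 * (b / \<sigma> + 1)) powr (b / \<sigma>) * (1 + t) powr (- (b / \<sigma>)) * bessel b \<xi> * damping \<sigma> t \<xi>"
proof -
  define r where "r = norm \<xi> powr \<sigma>"
  define p where "p = b / \<sigma>"
  have r: "r > 0" using \<xi> by (simp add: r_def)
  have p: "p \<ge> 0" using b \<sigma> by (simp add: p_def)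
  have B: "1 \<le> 1 + (norm \<xi>)\<^sup>2" by simp
  have "norm \<xi> \<le> (1 + (norm \<xi>)\<^sup>2) powr (1 / 2)"
    using real_sqrt_le_mono[of "(norm \<xi>)\<^sup>2" "1 + (norm \<xi>)\<^sup>2"] B by (simp add: powr_half_sqrt)
  then have "r \<le> ((1 + (norm \<xi>)\<^sup>2) powr (1 / 2)) powr \<sigma>"
    unfolding r_def using \<sigma> by (intro powr_mono2) auto
  then have "r \<le> (1 + (norm \<xi>)\<^sup>2) powr (\<sigma> / 2)" by (simp add: powr_powr)
  moreover have "1 \<le> (1 + (norm \<xi>)\<^sup>2) powr (\<sigma> / 2)" using \<sigma> B by (intro ge_one_powr_ge_zero) auto
  ultimately have "1 + r \<le> 2 * (1 + (norm \<xi>)\<^sup>2) powr (\<sigma> / 2)" by simp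
  then have "(1 + r) powr p \<le> (2 * (1 + (norm \<xi>)\<^sup>2) powr (\<sigma> / 2)) powr p"
    using r p by (intro powr_mono2) auto
  also have "\<dots> = 2 powr p * bessel b \<xi>"
    using \<sigma> by (simp add: powr_mult powr_powr bessel_def p_def)
  finally have 1: "(1 + r) powr p \<le> 2 powr p * bessel b \<xi>" .
  have "norm \<xi> powr b * exp (- (r * t / 2)) = r powr p * exp (- (r * t / 2))"
    using \<sigma> by (simp add: r_def p_def powr_powr)
  also have "\<dots> \<le> (4 * (p + 1)) powr p * (1 + t) powr (- p) * (1 + r) powr p * exp (- (r * t / 4))"
    by (rule power_times_exp_decay[OF p r t])
  also have "\<dots> \<le> (4 * (p + 1)) powr p * (1 + t) powr (- p) * (2 powr p * bessel b \<xi>) * exp (- (r * t / 4))"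
    using 1 by (intro mult_right_mono mult_left_mono) auto
  also have "\<dots> = (2 powr p * (4 * (p + 1)) powr p) * (1 + t) powr (- p) * bessel b \<xi> * exp (- (r * t / 4))"
    by (simp add: mult_ac)
  also have "2 powr p * (4 * (p + 1)) powr p = (8 * (p + 1)) powr p"
    using p by (subst powr_mult[symmetric]) (auto simp: algebra_simps)
  finally show ?thesis by (simp add: r_def p_def damping_def)
qed

text \<open>If \<open>a \<le> \<sigma>\<close>, the interpolated bound \<open>t powr (1 - \<theta>) * (2 / r) powr \<theta>\<close> with \<open>\<theta> = a / \<sigma>\<close> absorbs the factor
  \<open>|\<xi>| powr a = r powr \<theta>\<close> completely, so that no regularity of \<open>w1\<close> is consumed.\<close>

lemma norm_powr_osc1_small:
  fixes \<xi> :: "'a::euclidean_space"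
  assumes \<sigma>: "\<sigma> > 0" and a: "0 \<le> a" "a \<le> \<sigma>" and t: "t \<ge> 0" and \<xi>: "\<xi> \<noteq> 0"
  shows "norm \<xi> powr a * \<bar>osc1 (norm \<xi> powr \<sigma>) t\<bar> \<le> 2 * (1 + t) powr (1 - a / \<sigma>) * damping \<sigma> t \<xi>"
proof -
  define r where "r = norm \<xi> powr \<sigma>"
  define \<theta> where "\<theta> = a / \<sigma>"
  have r: "r > 0" using \<xi> by (simp add: r_def)
  have \<theta>: "0 \<le> \<theta>" "\<theta> \<le> 1" using a \<sigma> by (simp_all add: \<theta>_def)
  define X where "X = \<bar>osc1 r t\<bar> * exp (r * t / 2)"
  have X0: "0 \<le> X" by (simp add: X_def)
  have oX: "\<bar>osc1 r t\<bar> = X * exp (- (r * t / 2))" by (simp add: X_def mult.assoc flip: exp_add)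
  have X1: "X \<le> t" using osc_bounds(3)[OF r t] unfolding oX by (rule mult_right_le_imp_le) simp
  have X2: "X \<le> 2 / r" using osc_bounds(4)[OF r t] unfolding oX by (rule mult_right_le_imp_le) simp
  have "X = X powr (1 - \<theta>) * X powr \<theta>"
    using X0 by (cases "X = 0") (simp_all flip: powr_add)
  also have "\<dots> \<le> (1 + t) powr (1 - \<theta>) * (2 / r) powr \<theta>"
    using X0 X1 X2 \<theta> by (intro mult_mono powr_mono2) auto
  also have "\<dots> = (1 + t) powr (1 - \<theta>) * 2 powr \<theta> / r powr \<theta>" using r by (simp add: powr_divide)
  finally have "r powr \<theta> * X \<le> (1 + t) powr (1 - \<theta>) * 2 powr \<theta>" using r by (simp add: field_simps)
  also have "\<dots> \<le> (1 + t) powr (1 - \<theta>) * 2"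
    using powr_mono[of \<theta> 1 "2::real"] \<theta> by (intro mult_left_mono) auto
  finally have *: "r powr \<theta> * X \<le> 2 * (1 + t) powr (1 - \<theta>)" by simp
  have "norm \<xi> powr a * \<bar>osc1 r t\<bar> = (r powr \<theta> * X) * exp (- (r * t / 2))"
    using \<sigma> unfolding oX by (simp add: r_def \<theta>_def powr_powr)
  also have "\<dots> \<le> 2 * (1 + t) powr (1 - \<theta>) * exp (- (r * t / 4))"
    by (rule mult_mono[OF *]) (use r t in auto)
  finally show ?thesis by (simp add: r_def \<theta>_def damping_def)
qed

text \<open>The symbols of \<open>\<partial>\<^sub>t\<^sup>j |D|\<^sup>a\<close> composed with the two solution operators.\<close>

definition mult0 :: "real \<Rightarrow> nat \<Rightarrow> real \<Rightarrow> real \<Rightarrow> 'a::euclidean_space \<Rightarrow> real" where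
  "mult0 \<sigma> j a t \<xi> = norm \<xi> powr a * (if j = 0 then osc0 else osc0') (norm \<xi> powr \<sigma>) t"

definition mult1 :: "real \<Rightarrow> nat \<Rightarrow> real \<Rightarrow> real \<Rightarrow> 'a::euclidean_space \<Rightarrow> real" where
  "mult1 \<sigma> j a t \<xi> = norm \<xi> powr a * (if j = 0 then osc1 else osc1') (norm \<xi> powr \<sigma>) t"

lemma mult0_bound:
  assumes \<sigma>: "\<sigma> > 0" and a: "a \<ge> 0" and j: "j \<in> {0, 1}"
  shows "\<exists>C>0. \<forall>\<xi>::'a::euclidean_space. \<forall>t. \<xi> \<noteq> 0 \<longrightarrow> t \<ge> 0 \<longrightarrow>
    \<bar>mult0 \<sigma> j a t \<xi>\<bar> \<le> C * (1 + t) powr (- a / \<sigma> - j) * bessel (a + j * \<sigma>) \<xi> * damping \<sigma> t \<xi>"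
proof -
  define b where "b = a + j * \<sigma>"
  have b: "b \<ge> 0" using a \<sigma> by (simp add: b_def)
  have ex: "- (b / \<sigma>) = - a / \<sigma> - j" using \<sigma> by (simp add: b_def field_simps)
  define C where "C = 2 * (8 * (b / \<sigma> + 1)) powr (b / \<sigma>)"
  have "0 \<le> b / \<sigma>" using b \<sigma> by simp
  then have C: "C > 0" by (simp add: C_def)
  have "\<bar>mult0 \<sigma> j a t \<xi>\<bar> \<le> C * (1 + t) powr (- a / \<sigma> - j) * bessel (a + j * \<sigma>) \<xi> * damping \<sigma> t \<xi>"
    if \<xi>: "\<xi> \<noteq> 0" and t: "t \<ge> 0" for \<xi> :: 'a and t
  proof -
    have r: "norm \<xi> powr \<sigma> > 0" using \<xi> by simp
    have "\<bar>mult0 \<sigma> j a t \<xi>\<bar> \<le> 2 * (norm \<xi> powr b * exp (- (norm \<xi> powr \<sigma> * t / 2)))"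
    proof (cases "j = 0")
      case True
      then show ?thesis
        using mult_left_mono[OF osc_bounds(1)[OF r t], of "norm \<xi> powr a"]
        by (simp add: mult0_def b_def abs_mult mult.left_commute)
    next
      case False
      then have [simp]: "j = 1" using j by simp
      show ?thesis
        using mult_left_mono[OF osc_bounds(2)[OF r t], of "norm \<xi> powr a"]
        by (simp add: mult0_def b_def abs_mult powr_add mult_ac)
    qed
    also have "\<dots> \<le> 2 * ((8 * (b / \<sigma> + 1)) powr (b / \<sigma>) * (1 + t) powr (- (b / \<sigma>)) * bessel b \<xi> * damping \<sigma> t \<xi>)"
      using norm_powr_damping[OF \<sigma> b t \<xi>] by (intro mult_left_mono) auto
    finally show ?thesis unfolding ex by (simp add: C_def b_def mult_ac)
  qed
  with C show ?thesis by blast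
qed

text \<open>The case distinction mirrors the positive part in the Sobolev index of \<open>w1\<close>. For \<open>j = 0\<close> and \<open>a < \<sigma>\<close> the index
  is \<open>0\<close> and interpolation is used; otherwise the symbol is dominated by \<open>|\<xi>| powr b\<close> with \<open>b\<close> the index itself.\<close>

lemma mult1_bound:
  assumes \<sigma>: "\<sigma> > 0" and a: "a \<ge> 0" and j: "j \<in> {0, 1}"
  shows "\<exists>C>0. \<forall>\<xi>::'a::euclidean_space. \<forall>t. \<xi> \<noteq> 0 \<longrightarrow> t \<ge> 0 \<longrightarrow>
    \<bar>mult1 \<sigma> j a t \<xi>\<bar> \<le> C * (1 + t) powr (1 - a / \<sigma> - j) * bessel (max (a + (real j - 1) * \<sigma>) 0) \<xi> * damping \<sigma> t \<xi>"
proof (cases "j = 0 \<and> a < \<sigma>")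
  case True
  then have "\<bar>mult1 \<sigma> j a t \<xi>\<bar> \<le> 2 * (1 + t) powr (1 - a / \<sigma> - j) * bessel (max (a + (real j - 1) * \<sigma>) 0) \<xi> * damping \<sigma> t \<xi>"
    if \<xi>: "\<xi> \<noteq> 0" and t: "t \<ge> 0" for \<xi> :: 'a and t
    using norm_powr_osc1_small[OF \<sigma> a _ t \<xi>]
    by (simp add: mult1_def abs_mult max_def bessel_0)
  then show ?thesis by (intro exI[of _ 2]) auto
next
  case False
  define b where "b = a + (real j - 1) * \<sigma>"
  have b: "b \<ge> 0" using False a j by (auto simp: b_def)
  have mx: "max (a + (real j - 1) * \<sigma>) 0 = b" using b by (simp add: b_def)
  have ex: "- (b / \<sigma>) = 1 - a / \<sigma> - j" using \<sigma> by (simp add: b_def field_simps)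
  define C where "C = 2 * (8 * (b / \<sigma> + 1)) powr (b / \<sigma>)"
  have "0 \<le> b / \<sigma>" using b \<sigma> by simp
  then have C: "C > 0" by (simp add: C_def)
  have "\<bar>mult1 \<sigma> j a t \<xi>\<bar> \<le> C * (1 + t) powr (1 - a / \<sigma> - j) * bessel (max (a + (real j - 1) * \<sigma>) 0) \<xi> * damping \<sigma> t \<xi>"
    if \<xi>: "\<xi> \<noteq> 0" and t: "t \<ge> 0" for \<xi> :: 'a and t
  proof -
    have r: "norm \<xi> powr \<sigma> > 0" using \<xi> by simp
    have "\<bar>mult1 \<sigma> j a t \<xi>\<bar> \<le> 2 * (norm \<xi> powr b * exp (- (norm \<xi> powr \<sigma> * t / 2)))"
    proof (cases "j = 0")
      case True
      have "norm \<xi> powr b = norm \<xi> powr a / norm \<xi> powr \<sigma>" using True by (simp add: b_def powr_diff)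
      then show ?thesis
        using mult_left_mono[OF osc_bounds(4)[OF r t], of "norm \<xi> powr a"] True
        by (simp add: mult1_def abs_mult mult_ac)
    next
      case False
      then have [simp]: "j = 1" using j by simp
      show ?thesis
        using mult_left_mono[OF osc_bounds(5)[OF r t], of "norm \<xi> powr a"]
        by (simp add: mult1_def b_def abs_mult mult.left_commute)
    qed
    also have "\<dots> \<le> 2 * ((8 * (b / \<sigma> + 1)) powr (b / \<sigma>) * (1 + t) powr (- (b / \<sigma>)) * bessel b \<xi> * damping \<sigma> t \<xi>)"
      using norm_powr_damping[OF \<sigma> b t \<xi>] by (intro mult_left_mono) auto
    finally show ?thesis unfolding ex mx by (simp add: C_def mult_ac)
  qed
  with C show ?thesis by blast
qed

section \<open>Low frequencies\<close>

lemma borel_imp_lebesgue_measurable: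
  "f \<in> borel_measurable borel \<Longrightarrow> f \<in> borel_measurable (lebesgue :: 'a::euclidean_space measure)"
  by (rule measurable_completion) simp

lemma nn_integral_exp_abs_finite:
  assumes "l > 0"
  shows "(\<integral>\<^sup>+x. ennreal (exp (- (\<bar>x\<bar> * l))) \<partial>lborel) < \<infinity>"
proof -
  have [measurable]: "exponential_density l \<in> borel_measurable borel" by simp
  have 1: "(\<integral>\<^sup>+x. ennreal (exponential_density l x) \<partial>lborel) = 1"
    using prob_space.emeasure_space_1[OF prob_space_exponential_density[OF assms]]
    by (simp add: emeasure_density)
  have 2: "(\<integral>\<^sup>+x. ennreal (exponential_density l (- x)) \<partial>lborel) = 1"
    using lborel_nn_integral_affine[of "\<lambda>x::real. ennreal (exponential_density l x)" "- 1" 0] 1 by simp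
  have "ennreal (exp (- (\<bar>x\<bar> * l)))
      \<le> ennreal (1 / l) * (ennreal (exponential_density l x) + ennreal (exponential_density l (- x)))" for x
  proof -
    have "exp (- (\<bar>x\<bar> * l)) \<le> 1 / l * (exponential_density l x + exponential_density l (- x))"
      using assms by (cases "x \<ge> 0"; cases "x = 0") (auto simp: exponential_density_def)
    then show ?thesis
      using assms exponential_density_nonneg[OF assms]
      by (subst ennreal_plus[symmetric], simp, simp, subst ennreal_mult[symmetric])
         (auto intro!: ennreal_leI add_nonneg_nonneg)
  qed
  then have "(\<integral>\<^sup>+x. ennreal (exp (- (\<bar>x\<bar> * l))) \<partial>lborel)
      \<le> (\<integral>\<^sup>+x. ennreal (1 / l) * (ennreal (exponential_density l x) + ennreal (exponential_density l (- x))) \<partial>lborel)"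
    by (intro nn_integral_mono) auto
  also have "\<dots> = ennreal (1 / l) * (1 + 1)"
    using 1 2 by (simp add: nn_integral_cmult nn_integral_add)
  also have "\<dots> < \<infinity>" by (simp add: ennreal_mult_less_top)
  finally show ?thesis .
qed

text \<open>Since \<open>|\<xi>| powr \<sigma> \<ge> |\<xi>| - 1\<close> and \<open>|\<xi>|\<close> dominates the mean of the \<open>|\<xi> \<bullet> b|\<close>, the integrand is bounded by
  a product of one-variable exponentials.\<close>

lemma nn_integral_exp_norm_powr_finite:
  assumes "\<sigma> \<ge> 1"
  shows "(\<integral>\<^sup>+\<xi>. ennreal (exp (- (norm (\<xi>::'a::euclidean_space) powr \<sigma> / 2))) \<partial>lborel) < \<infinity>"
proof -
  let ?n = "real DIM('a)"
  \<comment> \<open>summing over the basis gives at most \<open>|\<xi>| / 2\<close>\<close>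
  define l where "l = 1 / (2 * ?n)"
  have l: "l > 0" by (simp add: l_def)
  have "ennreal (exp (- (norm \<xi> powr \<sigma> / 2)))
      \<le> ennreal (exp (1 / 2)) * (\<Prod>b\<in>Basis. ennreal (exp (- (\<bar>\<xi> \<bullet> b\<bar> * l))))" for \<xi> :: 'a
  proof -
    have "norm \<xi> - 1 \<le> norm \<xi> powr \<sigma>"
    proof (cases "norm \<xi> \<ge> 1")
      case True
      then show ?thesis using powr_mono[OF assms True] by simp
    next
      case False
      then show ?thesis using powr_ge_zero[of "norm \<xi>" \<sigma>] by linarith
    qed
    moreover have "(\<Sum>b\<in>Basis. \<bar>\<xi> \<bullet> b\<bar>) \<le> ?n * norm \<xi>"
      using sum_bounded_above[of Basis "\<lambda>b. \<bar>\<xi> \<bullet> b\<bar>" "norm \<xi>"] Basis_le_norm[of _ \<xi>] by simp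
    then have "(\<Sum>b\<in>Basis. \<bar>\<xi> \<bullet> b\<bar>) * l \<le> ?n * norm \<xi> * l"
      using l by (intro mult_right_mono) auto
    moreover have "?n * norm \<xi> * l = norm \<xi> / 2" by (simp add: l_def)
    moreover have "(\<Sum>b\<in>Basis. - (\<bar>\<xi> \<bullet> b\<bar> * l)) = - ((\<Sum>b\<in>Basis. \<bar>\<xi> \<bullet> b\<bar>) * l)"
      by (simp add: sum_negf sum_distrib_right)
    ultimately have "- (norm \<xi> powr \<sigma> / 2) \<le> 1 / 2 + (\<Sum>b\<in>Basis. - (\<bar>\<xi> \<bullet> b\<bar> * l))"
      by linarith
    then have "exp (- (norm \<xi> powr \<sigma> / 2)) \<le> exp (1 / 2) * (\<Prod>b\<in>Basis. exp (- (\<bar>\<xi> \<bullet> b\<bar> * l)))"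
      by (subst exp_sum[symmetric]) (simp_all flip: exp_add)
    then show ?thesis
      by (subst prod_ennreal, simp, subst ennreal_mult[symmetric]) (auto intro!: prod_nonneg ennreal_leI)
  qed
  then have "(\<integral>\<^sup>+\<xi>. ennreal (exp (- (norm (\<xi>::'a) powr \<sigma> / 2))) \<partial>lborel)
      \<le> (\<integral>\<^sup>+\<xi>. ennreal (exp (1 / 2)) * (\<Prod>b\<in>Basis. ennreal (exp (- (\<bar>(\<xi>::'a) \<bullet> b\<bar> * l)))) \<partial>lborel)"
    by (intro nn_integral_mono) auto
  also have "\<dots> = ennreal (exp (1 / 2)) * (\<integral>\<^sup>+\<xi>. (\<Prod>b\<in>Basis. ennreal (exp (- (\<bar>(\<xi>::'a) \<bullet> b\<bar> * l)))) \<partial>lborel)"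
    by (intro nn_integral_cmult) measurable
  also have "(\<integral>\<^sup>+\<xi>. (\<Prod>b\<in>Basis. ennreal (exp (- (\<bar>(\<xi>::'a) \<bullet> b\<bar> * l)))) \<partial>lborel)
      = (\<Prod>b\<in>(Basis :: 'a set). \<integral>\<^sup>+x. ennreal (exp (- (\<bar>x\<bar> * l))) \<partial>lborel)"
    by (rule nn_integral_lborel_prod) auto
  also have "ennreal (exp (1 / 2)) * \<dots> < \<infinity>"
    using nn_integral_exp_abs_finite[OF l]
    by (simp add: ennreal_mult_less_top power_less_top_ennreal)
  finally show ?thesis .
qed

lemma damping_measurable [measurable]: "damping \<sigma> t \<in> borel_measurable borel"
  unfolding damping_def by measurable

lemma damping_pos: "0 < damping \<sigma> t \<xi>"
  by (simp add: damping_def)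

lemma damping_le_1: "t \<ge> 0 \<Longrightarrow> damping \<sigma> t \<xi> \<le> 1"
  by (simp add: damping_def)

text \<open>Scaling \<open>\<xi>\<close> by \<open>t powr (- 1 / \<sigma>)\<close> removes \<open>t\<close> from the exponent.\<close>

lemma damping_L2_norm:
  assumes "\<sigma> \<ge> 1"
  shows "\<exists>I\<ge>0. \<forall>t>0. (\<lambda>\<xi>::'a::euclidean_space. complex_of_real (damping \<sigma> t \<xi>)) \<in> Lp 2 \<and>
    Lp_norm 2 (\<lambda>\<xi>::'a. complex_of_real (damping \<sigma> t \<xi>)) \<le> I * t powr (- (real DIM('a) / (2 * \<sigma>)))"
proof -
  let ?n = "real DIM('a)"
  define J where "J = (\<integral>\<^sup>+\<xi>. ennreal (exp (- (norm (\<xi>::'a) powr \<sigma> / 2))) \<partial>lborel)"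
  have "J < \<infinity>" unfolding J_def by (rule nn_integral_exp_norm_powr_finite[OF assms])
  then obtain I where I: "J = ennreal I" "I \<ge> 0" by (cases J) auto
  have "(\<lambda>\<xi>::'a. complex_of_real (damping \<sigma> t \<xi>)) \<in> Lp 2 \<and>
    Lp_norm 2 (\<lambda>\<xi>::'a. complex_of_real (damping \<sigma> t \<xi>)) \<le> sqrt I * t powr (- (?n / (2 * \<sigma>)))"
    if t: "t > 0" for t
  proof -
    define c where "c = t powr (- (1 / \<sigma>))"
    have c: "c > 0" using t by (simp add: c_def)
    have "- (1 / \<sigma>) * \<sigma> = - 1" using assms by simp
    then have c\<sigma>: "c powr \<sigma> = 1 / t" unfolding c_def powr_powr using t by (simp add: powr_minus_divide)
    have "(\<integral>\<^sup>+\<xi>. ennreal ((norm (complex_of_real (damping \<sigma> t (\<xi>::'a))))\<^sup>2) \<partial>lebesgue)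
        = (\<integral>\<^sup>+\<xi>. ennreal (exp (- (norm (\<xi>::'a) powr \<sigma> * t / 2))) \<partial>lborel)"
      unfolding nn_integral_completion
      by (intro nn_integral_cong) (simp add: damping_def flip: exp_double)
    also have "\<dots> = ennreal (c ^ DIM('a)) * (\<integral>\<^sup>+\<xi>. ennreal (exp (- (norm (c *\<^sub>R (\<xi>::'a)) powr \<sigma> * t / 2))) \<partial>lborel)"
      using lborel_nn_integral_affine[of "\<lambda>\<xi>::'a. ennreal (exp (- (norm \<xi> powr \<sigma> * t / 2)))" c 0] c by simp
    also have "\<dots> = ennreal (c ^ DIM('a)) * J"
      using c t unfolding J_def by (simp add: powr_mult c\<sigma>)
    also have "\<dots> = ennreal (c ^ DIM('a) * I)" using I c by (simp add: ennreal_mult)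
    also have "c ^ DIM('a) = (t powr (- (?n / (2 * \<sigma>))))\<^sup>2"
    proof -
      have "c ^ DIM('a) = c powr ?n" by (rule powr_realpow[OF c, symmetric])
      also have "\<dots> = t powr (- (1 / \<sigma>) * ?n)" unfolding c_def by (rule powr_powr)
      also have "- (1 / \<sigma>) * ?n = - (?n / (2 * \<sigma>)) + - (?n / (2 * \<sigma>))"
        using assms by (simp add: field_simps)
      finally show ?thesis by (simp only: powr_add power2_eq_square)
    qed
    also have "(t powr (- (?n / (2 * \<sigma>))))\<^sup>2 * I = (sqrt I * t powr (- (?n / (2 * \<sigma>))))\<^sup>2"
      using I(2) by (simp add: power_mult_distrib)
    finally have le: "(\<integral>\<^sup>+\<xi>. ennreal ((norm (complex_of_real (damping \<sigma> t (\<xi>::'a))))\<^sup>2) \<partial>lebesgue)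
        \<le> ennreal ((sqrt I * t powr (- (?n / (2 * \<sigma>))))\<^sup>2)" by simp
    have m: "(\<lambda>\<xi>::'a. complex_of_real (damping \<sigma> t \<xi>)) \<in> borel_measurable lebesgue"
      by (rule borel_imp_lebesgue_measurable) simp
    have "0 \<le> sqrt I * t powr (- (?n / (2 * \<sigma>)))" using I(2) by simp
    from Lp2_nn_integralI[OF m this le] show ?thesis by blast
  qed
  then show ?thesis using I(2) by (intro exI[of _ "sqrt I"]) auto
qed

text \<open>Interpolation by truncation. The part of \<open>f\<close> above the height \<open>h\<close> is integrable, so its transform
  is bounded; the part below is controlled in \<open>L\<^sup>2\<close>. Both steps map into \<open>L\<^sup>2\<close>, so one good
  choice of \<open>h\<close> gives the \<open>L\<^sup>m\<close> bound.\<close>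

lemma damping_fourier_split:
  fixes f :: "'a::euclidean_space \<Rightarrow> complex"
  assumes m: "1 \<le> m" "m < 2" and f: "f \<in> Lp m" "f \<in> Lp 2" and h: "h > 0" and t: "t \<ge> 0"
    and d: "(\<lambda>\<xi>::'a. complex_of_real (damping \<sigma> t \<xi>)) \<in> Lp 2"
  defines "P \<equiv> integral\<^sup>L lebesgue (\<lambda>x. norm (f x) powr m)"
  shows "Lp_norm 2 (\<lambda>\<xi>. damping \<sigma> t \<xi> * fourier_L2 f \<xi>)
    \<le> fourier_const DIM('a) * (h powr (1 - m) * P) * Lp_norm 2 (\<lambda>\<xi>::'a. complex_of_real (damping \<sigma> t \<xi>))
      + h powr (1 - m / 2) * P powr (1 / 2)"
proof -
  have [measurable]: "f \<in> borel_measurable lebesgue" using f(2) by (rule Lp2_measurable)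
  have fm: "integrable lebesgue (\<lambda>x. norm (f x) powr m)" using f(1) by (simp add: Lp_def)
  have P0: "P \<ge> 0" unfolding P_def by (rule integral_nonneg_AE) auto
  define A where "A = {x. norm (f x) > h}"
  have [measurable]: "A \<in> sets lebesgue"
  proof -
    have "{x \<in> space lebesgue. norm (f x) > h} \<in> sets lebesgue" by measurable
    then show ?thesis by (simp add: A_def)
  qed
  define u where "u x = indicator A x * f x" for x
  define v where "v x = indicator (- A) x * f x" for x
  have um [measurable]: "u \<in> borel_measurable lebesgue" unfolding u_def by measurable
  have "- A \<in> sets lebesgue" using \<open>A \<in> sets lebesgue\<close> by (simp add: Compl_in_sets_lebesgue)
  then have vm [measurable]: "v \<in> borel_measurable lebesgue"
    unfolding v_def by (intro borel_measurable_times borel_measurable_indicator) auto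
  have uL: "u \<in> Lp 2"
    by (rule Lp2_bound(1)[OF f(2) um, of 1]) (auto simp: u_def indicator_def)
  have vL: "v \<in> Lp 2"
    by (rule Lp2_bound(1)[OF f(2) vm, of 1]) (auto simp: v_def indicator_def)
  have fuv: "f = (\<lambda>x. 1 * u x + 1 * v x)" by (auto simp: u_def v_def indicator_def)
  have ub: "norm (u x) \<le> h powr (1 - m) * norm (f x) powr m" for x
  proof (cases "x \<in> A")
    case True
    then have xh: "norm (f x) > h" by (simp add: A_def)
    then have "norm (f x) powr (1 - m) \<le> h powr (1 - m)" using h m by (intro powr_mono2') auto
    then have "norm (f x) powr (1 - m) * norm (f x) powr m \<le> h powr (1 - m) * norm (f x) powr m"
      by (intro mult_right_mono) auto
    moreover have "norm (f x) powr (1 - m) * norm (f x) powr m = norm (f x)"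
      using xh h by (simp flip: powr_add)
    ultimately show ?thesis using True by (simp add: u_def)
  qed (simp add: u_def)
  have ui: "integrable lebesgue u"
    by (rule Bochner_Integration.integrable_bound[of _ "\<lambda>x. h powr (1 - m) * norm (f x) powr m"])
       (use fm ub in \<open>auto\<close>)
  have uI: "(\<integral>x. norm (u x) \<partial>lebesgue) \<le> h powr (1 - m) * P"
    unfolding P_def integral_mult_right_zero[symmetric]
    by (rule integral_mono) (use ui fm ub in auto)
  have vb: "(norm (v x))\<^sup>2 \<le> h powr (2 - m) * norm (f x) powr m" for x
  proof (cases "x \<in> A \<or> f x = 0")
    case False
    then have xh: "0 < norm (f x)" "norm (f x) \<le> h" by (auto simp: A_def)
    then have "norm (f x) powr (2 - m) \<le> h powr (2 - m)" using m by (intro powr_mono2) auto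
    then have "norm (f x) powr (2 - m) * norm (f x) powr m \<le> h powr (2 - m) * norm (f x) powr m"
      by (intro mult_right_mono) auto
    moreover have "norm (f x) powr (2 - m) * norm (f x) powr m = (norm (f x))\<^sup>2"
      using xh by (simp flip: powr_add)
    ultimately show ?thesis using False by (simp add: v_def)
  qed (auto simp: v_def)
  have "(Lp_norm 2 v)\<^sup>2 \<le> h powr (2 - m) * P"
    unfolding P_def integral_mult_right_zero[symmetric] Lp_norm2_sq
    by (rule integral_mono) (use vL fm vb in \<open>auto simp: Lp2_iff\<close>)
  also have "\<dots> = (h powr (1 - m / 2) * P powr (1 / 2))\<^sup>2"
  proof -
    have "(h powr (1 - m / 2))\<^sup>2 = h powr (2 - m)"
      by (simp add: power2_eq_square flip: powr_add)
    then show ?thesis using P0 by (simp add: power_mult_distrib powr_half_sqrt)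
  qed
  finally have vN: "Lp_norm 2 v \<le> h powr (1 - m / 2) * P powr (1 / 2)"
    by (rule power2_le_imp_le) simp
  have dm: "(\<lambda>\<xi>::'a. complex_of_real (damping \<sigma> t \<xi>)) \<in> borel_measurable lebesgue"
    using d by (rule Lp2_measurable)
  let ?du = "\<lambda>\<xi>. damping \<sigma> t \<xi> * fourier_integral u \<xi>"
  let ?dv = "\<lambda>\<xi>. damping \<sigma> t \<xi> * fourier_L2 v \<xi>"
  have dum: "?du \<in> borel_measurable lebesgue"
    using dm fourier_integral_measurable_lebesgue[OF um] by (rule borel_measurable_times)
  have dvm: "?dv \<in> borel_measurable lebesgue"
    using dm Lp2_measurable[OF fourier_L2_spec(1)[OF vL]] by (rule borel_measurable_times)
  have B0: "0 \<le> fourier_const DIM('a) * (h powr (1 - m) * P)"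
    using P0 fourier_const_pos[of "DIM('a)"] by simp
  have "norm (fourier_integral u \<xi>) \<le> fourier_const DIM('a) * (h powr (1 - m) * P)" for \<xi>
    using fourier_integral_bound[of u \<xi>] mult_left_mono[OF uI, of "fourier_const DIM('a)"]
      fourier_const_pos[of "DIM('a)"] by linarith
  then have "norm (?du \<xi>) \<le> fourier_const DIM('a) * (h powr (1 - m) * P) * norm (complex_of_real (damping \<sigma> t \<xi>))" for \<xi>
    unfolding norm_mult by (subst mult.commute) (rule mult_right_mono[OF _ norm_ge_zero])
  then have duN: "?du \<in> Lp 2" "Lp_norm 2 ?du \<le> fourier_const DIM('a) * (h powr (1 - m) * P) * Lp_norm 2 (\<lambda>\<xi>::'a. complex_of_real (damping \<sigma> t \<xi>))"
    using Lp2_bound[OF d dum B0] by auto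
  have "norm (?dv \<xi>) \<le> 1 * norm (fourier_L2 v \<xi>)" for \<xi>
    using damping_pos[of \<sigma> t \<xi>] damping_le_1[OF t, of \<sigma> \<xi>] by (simp add: norm_mult mult_left_le_one_le)
  then have dvN: "?dv \<in> Lp 2" "Lp_norm 2 ?dv \<le> Lp_norm 2 v"
    using Lp2_bound[OF fourier_L2_spec(1)[OF vL] dvm, of 1] fourier_L2_norm[OF vL] by auto
  have "AE \<xi> in lebesgue. fourier_L2 f \<xi> = 1 * fourier_L2 u \<xi> + 1 * fourier_L2 v \<xi>"
    by (subst fuv) (rule fourier_L2_lincomb[OF uL vL])
  with fourier_L2_eq_integral[OF ui uL]
  have AE: "AE \<xi> in lebesgue. damping \<sigma> t \<xi> * fourier_L2 f \<xi> = ?du \<xi> + ?dv \<xi>"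
    by eventually_elim (simp add: algebra_simps)
  have "(\<lambda>\<xi>. damping \<sigma> t \<xi> * fourier_L2 f \<xi>) \<in> borel_measurable lebesgue"
    using dm Lp2_measurable[OF fourier_L2_spec(1)[OF f(2)]] by (rule borel_measurable_times)
  then have "Lp_norm 2 (\<lambda>\<xi>. damping \<sigma> t \<xi> * fourier_L2 f \<xi>) = Lp_norm 2 (\<lambda>\<xi>. ?du \<xi> + ?dv \<xi>)"
    by (rule Lp2_cong_AE(2)[OF Lp2_add_mem[OF duN(1) dvN(1)] _ AE])
  also have "\<dots> \<le> Lp_norm 2 ?du + Lp_norm 2 ?dv" by (rule Lp_norm2_triangle[OF duN(1) dvN(1)])
  finally show ?thesis using duN(2) dvN(2) vN by linarith
qed

text \<open>The height \<open>h\<close> in the splitting makes both terms equal up to a constant, and then each has the claimed power of \<open>t\<close>.\<close>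

lemma damping_fourier_Lm:
  fixes \<sigma> m :: real
  assumes \<sigma>: "\<sigma> \<ge> 1" and m: "1 \<le> m" "m < 2"
  shows "\<exists>C>0. \<forall>f::'a::euclidean_space \<Rightarrow> complex. \<forall>t>0. f \<in> Lp m \<longrightarrow> f \<in> Lp 2 \<longrightarrow>
    Lp_norm 2 (\<lambda>\<xi>. damping \<sigma> t \<xi> * fourier_L2 f \<xi>)
      \<le> C * t powr (- (real DIM('a) / \<sigma> * (1 / m - 1 / 2))) * Lp_norm m f"
proof -
  let ?n = "real DIM('a)" and ?c = "fourier_const DIM('a)"
  define \<kappa> where "\<kappa> = ?n / \<sigma> * (1 / m - 1 / 2)"
  obtain I where I: "I \<ge> 0" and d: "\<And>t. t > 0 \<Longrightarrow> (\<lambda>\<xi>::'a. complex_of_real (damping \<sigma> t \<xi>)) \<in> Lp 2"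
    and dN: "\<And>t. t > 0 \<Longrightarrow> Lp_norm 2 (\<lambda>\<xi>::'a. complex_of_real (damping \<sigma> t \<xi>)) \<le> I * t powr (- (?n / (2 * \<sigma>)))"
    using damping_L2_norm[OF \<sigma>, where 'a='a] by blast
  define C where "C = ?c * I + 1"
  have C: "C > 0" using I fourier_const_pos[of "DIM('a)"] by (simp add: C_def add_nonneg_pos)
  have "Lp_norm 2 (\<lambda>\<xi>. damping \<sigma> t \<xi> * fourier_L2 f \<xi>) \<le> C * t powr (- \<kappa>) * Lp_norm m f"
    if t: "t > 0" and f: "f \<in> Lp m" "f \<in> Lp 2" for f :: "'a \<Rightarrow> complex" and t
  proof -
    define P where "P = integral\<^sup>L lebesgue (\<lambda>x. norm (f x) powr m)"
    have P0: "P \<ge> 0" unfolding P_def by (rule integral_nonneg_AE) auto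
    have split: "Lp_norm 2 (\<lambda>\<xi>. damping \<sigma> t \<xi> * fourier_L2 f \<xi>)
        \<le> ?c * (h powr (1 - m) * P) * (I * t powr (- (?n / (2 * \<sigma>)))) + h powr (1 - m / 2) * P powr (1 / 2)" if "h > 0" for h
    proof -
      have "?c * (h powr (1 - m) * P) * Lp_norm 2 (\<lambda>\<xi>::'a. complex_of_real (damping \<sigma> t \<xi>))
          \<le> ?c * (h powr (1 - m) * P) * (I * t powr (- (?n / (2 * \<sigma>))))"
        using dN[OF t] P0 fourier_const_pos[of "DIM('a)"] by (intro mult_left_mono) auto
      then show ?thesis
        using damping_fourier_split[OF m f that less_imp_le[OF t] d[OF t]] by (simp add: P_def)
    qed
    show ?thesis
    proof (cases "P = 0")
      case True
      then show ?thesis using split[of 1] C by (simp add: Lp_norm_def P_def)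
    next
      case False
      then have P: "P > 0" using P0 by simp
      \<comment> \<open>the height at which the two contributions balance\<close>
      define h where "h = P powr (1 / m) * t powr (- (?n / (\<sigma> * m)))"
      have h: "h > 0" using P t by (simp add: h_def)
      have e1: "h powr (1 - m) * P * t powr (- (?n / (2 * \<sigma>))) = P powr (1 / m) * t powr (- \<kappa>)"
      proof -
        have "h powr (1 - m) * P * t powr (- (?n / (2 * \<sigma>)))
            = (P powr (1 / m * (1 - m)) * P powr 1) * (t powr (- (?n / (\<sigma> * m)) * (1 - m)) * t powr (- (?n / (2 * \<sigma>))))"
          using P t by (simp add: h_def powr_mult powr_powr)
        also have "\<dots> = P powr (1 / m * (1 - m) + 1) * t powr (- (?n / (\<sigma> * m)) * (1 - m) + - (?n / (2 * \<sigma>)))"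
          by (simp only: powr_add)
        also have "1 / m * (1 - m) + 1 = 1 / m" using m by (simp add: field_simps)
        also have "- (?n / (\<sigma> * m)) * (1 - m) + - (?n / (2 * \<sigma>)) = - \<kappa>"
          using m \<sigma> by (simp add: \<kappa>_def field_simps)
        finally show ?thesis .
      qed
      have e2: "h powr (1 - m / 2) * P powr (1 / 2) = P powr (1 / m) * t powr (- \<kappa>)"
      proof -
        have "h powr (1 - m / 2) * P powr (1 / 2)
            = (P powr (1 / m * (1 - m / 2)) * P powr (1 / 2)) * t powr (- (?n / (\<sigma> * m)) * (1 - m / 2))"
          using P t by (simp add: h_def powr_mult powr_powr)
        also have "\<dots> = P powr (1 / m * (1 - m / 2) + 1 / 2) * t powr (- (?n / (\<sigma> * m)) * (1 - m / 2))"
          by (simp only: powr_add)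
        also have "1 / m * (1 - m / 2) + 1 / 2 = 1 / m" using m by (simp add: field_simps)
        also have "- (?n / (\<sigma> * m)) * (1 - m / 2) = - \<kappa>"
          using m \<sigma> by (simp add: \<kappa>_def field_simps)
        finally show ?thesis .
      qed
      have "?c * (h powr (1 - m) * P) * (I * t powr (- (?n / (2 * \<sigma>)))) + h powr (1 - m / 2) * P powr (1 / 2)
          = ?c * I * (h powr (1 - m) * P * t powr (- (?n / (2 * \<sigma>)))) + h powr (1 - m / 2) * P powr (1 / 2)"
        by (simp add: mult_ac)
      also have "\<dots> = C * t powr (- \<kappa>) * Lp_norm m f"
        unfolding e1 e2 by (simp add: C_def Lp_norm_def P_def algebra_simps)
      finally show ?thesis using split[OF h] by simp
    qed
  qed
  with C show ?thesis unfolding \<kappa>_def by blast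
qed

lemma Sobolev_norm_bessel:
  "Sobolev_norm b f = Lp_norm 2 (\<lambda>\<xi>. complex_of_real (bessel b \<xi>) * fourier_L2 f \<xi>)"
  by (simp add: Sobolev_norm_def bessel_def)

lemma Sobolev_bessel:
  "f \<in> Sobolev b \<longleftrightarrow> f \<in> Lp 2 \<and> (\<lambda>\<xi>. complex_of_real (bessel b \<xi>) * fourier_L2 f \<xi>) \<in> Lp 2"
  by (simp add: Sobolev_def bessel_def)

lemma bessel_measurable [measurable]: "bessel b \<in> borel_measurable borel"
  unfolding bessel_def by measurable

text \<open>Up to a constant and a power of \<open>1 + t\<close>, each term of the solution is dominated by such a function: the
  transform of the datum with the Sobolev weight of its space and the remaining damping.\<close>

definition weighted :: "real \<Rightarrow> real \<Rightarrow> real \<Rightarrow> ('a::euclidean_space \<Rightarrow> complex) \<Rightarrow> 'a \<Rightarrow> complex" where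
  "weighted \<sigma> t b f \<xi> = of_real (bessel b \<xi> * damping \<sigma> t \<xi>) * fourier_L2 f \<xi>"

lemma weighted_mem:
  fixes f :: "'a::euclidean_space \<Rightarrow> complex"
  assumes f: "f \<in> Sobolev b" and t: "t \<ge> 0"
  shows "weighted \<sigma> t b f \<in> Lp 2" "Lp_norm 2 (weighted \<sigma> t b f) \<le> Sobolev_norm b f"
proof -
  have fL: "f \<in> Lp 2" and bf: "(\<lambda>\<xi>. complex_of_real (bessel b \<xi>) * fourier_L2 f \<xi>) \<in> Lp 2"
    using f by (auto simp: Sobolev_bessel)
  have wm: "weighted \<sigma> t b f \<in> borel_measurable lebesgue"
    unfolding weighted_def[abs_def]
    by (rule borel_measurable_times[OF borel_imp_lebesgue_measurable Lp2_measurable[OF fourier_L2_spec(1)[OF fL]]])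
       measurable
  have "norm (weighted \<sigma> t b f \<xi>) \<le> 1 * norm (complex_of_real (bessel b \<xi>) * fourier_L2 f \<xi>)" for \<xi>
  proof -
    have "bessel b \<xi> * damping \<sigma> t \<xi> \<le> bessel b \<xi> * 1"
      using damping_le_1[OF t, of \<sigma> \<xi>] bessel_pos[of b \<xi>] by (intro mult_left_mono) auto
    then show ?thesis
      using bessel_pos[of b \<xi>] damping_pos[of \<sigma> t \<xi>]
      by (simp add: weighted_def norm_mult abs_mult mult_right_mono)
  qed
  then show "weighted \<sigma> t b f \<in> Lp 2" "Lp_norm 2 (weighted \<sigma> t b f) \<le> Sobolev_norm b f"
    using Lp2_bound[OF bf wm, of 1] by (auto simp: Sobolev_norm_bessel)
qed

text \<open>For \<open>t \<ge> 1\<close>, on the unit ball the weight is bounded and the low-frequency estimate applies; outside it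
  the damping is at most \<open>exp (- t / 4)\<close>. For small \<open>t\<close> there is no decay to prove and the Sobolev norm alone suffices.\<close>

lemma weighted_Lm_Sobolev:
  fixes \<sigma> m b :: real
  assumes \<sigma>: "\<sigma> \<ge> 1" and m: "1 \<le> m" "m < 2" and b: "b \<ge> 0"
  shows "\<exists>C>0. \<forall>f::'a::euclidean_space \<Rightarrow> complex. \<forall>t\<ge>0. f \<in> Lp m \<longrightarrow> f \<in> Sobolev b \<longrightarrow>
    Lp_norm 2 (weighted \<sigma> t b f)
      \<le> C * (1 + t) powr (- (real DIM('a) / \<sigma> * (1 / m - 1 / 2))) * Lp_Sobolev_norm m b f"
proof -
  define \<kappa> where "\<kappa> = real DIM('a) / \<sigma> * (1 / m - 1 / 2)"
  have \<kappa>: "\<kappa> \<ge> 0" using m \<sigma> by (simp add: \<kappa>_def field_simps)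
  obtain C where C: "C > 0" and low: "\<And>f :: 'a \<Rightarrow> complex. \<And>t. t > 0 \<Longrightarrow> f \<in> Lp m \<Longrightarrow> f \<in> Lp 2 \<Longrightarrow>
      Lp_norm 2 (\<lambda>\<xi>. damping \<sigma> t \<xi> * fourier_L2 f \<xi>) \<le> C * t powr (- \<kappa>) * Lp_norm m f"
    using damping_fourier_Lm[OF \<sigma> m, where 'a='a] unfolding \<kappa>_def by blast
  define E where "E = (1 / 2) powr (- \<kappa>) * ((4 * (\<kappa> + 1)) powr \<kappa> * (3 / 2) powr \<kappa>)"
  have E: "exp (- (t / 4)) \<le> E * (1 + t) powr (- \<kappa>)" if t: "t \<ge> 0" for t
  proof -
    \<comment> \<open>the decay lemma with \<open>r = 1 / 2\<close>\<close>
    have "(1 / 2) powr \<kappa> * exp (- (t / 4))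
        \<le> (4 * (\<kappa> + 1)) powr \<kappa> * (1 + t) powr (- \<kappa>) * (3 / 2) powr \<kappa> * exp (- (t / 8))"
      using power_times_exp_decay[OF \<kappa> _ t, of "1 / 2"] by simp
    also have "\<dots> \<le> (4 * (\<kappa> + 1)) powr \<kappa> * (1 + t) powr (- \<kappa>) * (3 / 2) powr \<kappa> * 1"
      using t by (intro mult_left_mono) auto
    finally have "(1 / 2) powr (- \<kappa>) * ((1 / 2) powr \<kappa> * exp (- (t / 4)))
        \<le> (1 / 2) powr (- \<kappa>) * ((4 * (\<kappa> + 1)) powr \<kappa> * (1 + t) powr (- \<kappa>) * (3 / 2) powr \<kappa>)"
      by (intro mult_left_mono) auto
    also have "\<dots> = E * (1 + t) powr (- \<kappa>)" by (simp add: E_def)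
    also have "(1 / 2) powr (- \<kappa>) * ((1 / 2) powr \<kappa> * exp (- (t / 4))) = exp (- (t / 4))"
      by (simp add: mult.assoc[symmetric] flip: powr_add)
    finally show ?thesis .
  qed
  have E0: "E > 0" using \<kappa> by (simp add: E_def)
  define K where "K = 2 powr (b / 2) * C * 2 powr \<kappa> + E + 2 powr \<kappa>"
  have K: "K > 0" using C E0 by (simp add: K_def add_pos_pos)
  have "Lp_norm 2 (weighted \<sigma> t b f) \<le> K * (1 + t) powr (- \<kappa>) * Lp_Sobolev_norm m b f"
    if t: "t \<ge> 0" and fm: "f \<in> Lp m" and fb: "f \<in> Sobolev b" for f :: "'a \<Rightarrow> complex" and t
  proof -
    have fL: "f \<in> Lp 2" and bf: "(\<lambda>\<xi>. complex_of_real (bessel b \<xi>) * fourier_L2 f \<xi>) \<in> Lp 2"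
      using fb by (auto simp: Sobolev_bessel)
    define X Y where "X = Lp_norm m f" and "Y = Sobolev_norm b f"
    have X: "X \<ge> 0" and Y: "Y \<ge> 0" by (auto simp: X_def Y_def Lp_norm_nonneg Sobolev_norm_def)
    define T where "T = (1 + t) powr (- \<kappa>)"
    have T: "T \<ge> 0" by (simp add: T_def)
    have "Lp_norm 2 (weighted \<sigma> t b f) \<le> K * T * (X + Y)"
    proof (cases "t \<le> 1")
      case True
      have "2 powr (- \<kappa>) \<le> T" unfolding T_def using True t \<kappa> by (intro powr_mono2') auto
      then have "2 powr \<kappa> * 2 powr (- \<kappa>) \<le> 2 powr \<kappa> * T" by (intro mult_left_mono) auto
      then have 1: "1 \<le> 2 powr \<kappa> * T" by (simp flip: powr_add)
      have "Lp_norm 2 (weighted \<sigma> t b f) \<le> 1 * Y" using weighted_mem(2)[OF fb t] by (simp add: Y_def)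
      also have "\<dots> \<le> (2 powr \<kappa> * T) * Y" using 1 Y by (intro mult_right_mono) auto
      also have "\<dots> \<le> (K * T) * (X + Y)"
        using X Y T C E0 by (intro mult_mono mult_right_mono) (auto simp: K_def)
      finally show ?thesis .
    next
      case False
      then have t1: "t \<ge> 1" "t > 0" by auto
      let ?S = "cball 0 1 :: 'a set"
      let ?w = "weighted \<sigma> t b f"
      have wm: "?w \<in> borel_measurable lebesgue" using weighted_mem(1)[OF fb t] by (rule Lp2_measurable)
      define p where "p \<xi> = indicator ?S \<xi> * ?w \<xi>" for \<xi>
      define q where "q \<xi> = indicator (- ?S) \<xi> * ?w \<xi>" for \<xi>
      have pm: "p \<in> borel_measurable lebesgue" unfolding p_def[abs_def]
        using wm by (intro borel_measurable_times borel_measurable_indicator) auto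
      have qm: "q \<in> borel_measurable lebesgue" unfolding q_def[abs_def]
        using wm by (intro borel_measurable_times borel_measurable_indicator) auto
      have dfm: "(\<lambda>\<xi>. damping \<sigma> t \<xi> * fourier_L2 f \<xi>) \<in> borel_measurable lebesgue"
        by (rule borel_measurable_times[OF borel_imp_lebesgue_measurable Lp2_measurable[OF fourier_L2_spec(1)[OF fL]]])
           measurable
      have "norm (damping \<sigma> t \<xi> * fourier_L2 f \<xi>) \<le> 1 * norm (fourier_L2 f \<xi>)" for \<xi>
        using damping_pos[of \<sigma> t \<xi>] damping_le_1[OF t, of \<sigma> \<xi>] by (simp add: norm_mult mult_left_le_one_le)
      then have df: "(\<lambda>\<xi>. damping \<sigma> t \<xi> * fourier_L2 f \<xi>) \<in> Lp 2"
        using Lp2_bound(1)[OF fourier_L2_spec(1)[OF fL] dfm, of 1] by auto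
      have "norm (p \<xi>) \<le> 2 powr (b / 2) * norm (damping \<sigma> t \<xi> * fourier_L2 f \<xi>)" for \<xi>
      proof (cases "norm \<xi> \<le> 1")
        case True
        then have "bessel b \<xi> \<le> 2 powr (b / 2)"
          unfolding bessel_def using b power_mono[of "norm \<xi>" 1 2] by (intro powr_mono2) auto
        then have "bessel b \<xi> * norm (damping \<sigma> t \<xi> * fourier_L2 f \<xi>) \<le> 2 powr (b / 2) * norm (damping \<sigma> t \<xi> * fourier_L2 f \<xi>)"
          by (intro mult_right_mono) auto
        then show ?thesis
          using True bessel_pos[of b \<xi>] by (simp add: p_def weighted_def norm_mult abs_mult mult.assoc)
      qed (simp add: p_def)
      then have p: "p \<in> Lp 2" "Lp_norm 2 p \<le> 2 powr (b / 2) * (C * t powr (- \<kappa>) * X)"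
      proof -
        assume *: "\<And>\<xi>. norm (p \<xi>) \<le> 2 powr (b / 2) * norm (damping \<sigma> t \<xi> * fourier_L2 f \<xi>)"
        show "p \<in> Lp 2" using Lp2_bound(1)[OF df pm, of "2 powr (b / 2)"] * by simp
        have "Lp_norm 2 p \<le> 2 powr (b / 2) * Lp_norm 2 (\<lambda>\<xi>. damping \<sigma> t \<xi> * fourier_L2 f \<xi>)"
          using Lp2_bound(2)[OF df pm, of "2 powr (b / 2)"] * by simp
        also have "\<dots> \<le> 2 powr (b / 2) * (C * t powr (- \<kappa>) * X)"
          using low[OF t1(2) fm fL] by (intro mult_left_mono) (auto simp: X_def)
        finally show "Lp_norm 2 p \<le> 2 powr (b / 2) * (C * t powr (- \<kappa>) * X)" .
      qed
      have *: "norm (q \<xi>) \<le> exp (- (t / 4)) * norm (complex_of_real (bessel b \<xi>) * fourier_L2 f \<xi>)" for \<xi>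
      proof (cases "norm \<xi> \<le> 1")
        case False
        then have "1 \<le> norm \<xi> powr \<sigma>" using \<sigma> by (intro ge_one_powr_ge_zero) auto
        then have "1 * t \<le> norm \<xi> powr \<sigma> * t" using t by (intro mult_right_mono) auto
        then have "damping \<sigma> t \<xi> \<le> exp (- (t / 4))" by (simp add: damping_def)
        then have "damping \<sigma> t \<xi> * norm (complex_of_real (bessel b \<xi>) * fourier_L2 f \<xi>)
            \<le> exp (- (t / 4)) * norm (complex_of_real (bessel b \<xi>) * fourier_L2 f \<xi>)"
          by (intro mult_right_mono) auto
        then show ?thesis
          using False damping_pos[of \<sigma> t \<xi>] by (simp add: q_def weighted_def norm_mult abs_mult mult_ac)
      qed (simp add: q_def)
      have q: "q \<in> Lp 2" "Lp_norm 2 q \<le> exp (- (t / 4)) * Y"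
        using Lp2_bound[OF bf qm, of "exp (- (t / 4))"] * by (auto simp: Y_def Sobolev_norm_bessel)
      have "?w = (\<lambda>\<xi>. p \<xi> + q \<xi>)" by (auto simp: p_def q_def indicator_def)
      then have "Lp_norm 2 ?w \<le> Lp_norm 2 p + Lp_norm 2 q" using Lp_norm2_triangle[OF p(1) q(1)] by simp
      also have "\<dots> \<le> 2 powr (b / 2) * (C * t powr (- \<kappa>) * X) + exp (- (t / 4)) * Y" using p q by simp
      also have "\<dots> \<le> 2 powr (b / 2) * (C * (2 powr \<kappa> * T) * X) + (E * T) * Y"
      proof -
        have "((1 + t) / 2) powr (- \<kappa>) \<ge> t powr (- \<kappa>)" using t1 \<kappa> by (intro powr_mono2') auto
        then have "t powr (- \<kappa>) \<le> 2 powr \<kappa> * T"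
          using t1 by (simp add: T_def powr_divide powr_minus field_simps)
        then have "2 powr (b / 2) * (C * t powr (- \<kappa>) * X) \<le> 2 powr (b / 2) * (C * (2 powr \<kappa> * T) * X)"
          using C X by (intro mult_left_mono mult_right_mono) auto
        moreover have "exp (- (t / 4)) * Y \<le> (E * T) * Y"
          using E[OF t] Y by (intro mult_right_mono) (auto simp: T_def)
        ultimately show ?thesis by (rule add_mono)
      qed
      also have "\<dots> = (2 powr (b / 2) * C * 2 powr \<kappa>) * T * X + E * T * Y" by (simp add: mult_ac)
      also have "\<dots> \<le> K * T * X + K * T * Y"
        using X Y T C E0 by (intro add_mono mult_right_mono) (auto simp: K_def)
      also have "\<dots> = K * T * (X + Y)" by (simp add: algebra_simps)
      finally show ?thesis .
    qed
    then show ?thesis by (simp add: T_def X_def Y_def Lp_Sobolev_norm_def)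
  qed
  with K show ?thesis unfolding \<kappa>_def by blast
qed

section \<open>The solution and its derivatives\<close>

lemma mult_measurable [measurable]:
  "(\<lambda>\<xi>::'a::euclidean_space. complex_of_real (mult0 \<sigma> j a t \<xi>)) \<in> borel_measurable borel"
  "(\<lambda>\<xi>::'a::euclidean_space. complex_of_real (mult1 \<sigma> j a t \<xi>)) \<in> borel_measurable borel"
  unfolding mult0_def mult1_def osc0_def osc0'_def osc1_def osc1'_def
  by (cases "j = 0"; simp)+

lemma AE_lebesgue_nonzero: "AE \<xi>::'a::euclidean_space in lebesgue. \<xi> \<noteq> 0"
  by (rule AE_completion[OF AE_lborel_singleton])

text \<open>The Fourier transform of \<open>\<partial>\<^sub>t\<^sup>j |D|\<^sup>a w\<close>.\<close>

definition solution_hat ::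
  "real \<Rightarrow> nat \<Rightarrow> real \<Rightarrow> ('a::euclidean_space \<Rightarrow> complex) \<Rightarrow> ('a \<Rightarrow> complex) \<Rightarrow> real \<Rightarrow> 'a \<Rightarrow> complex" where
  "solution_hat \<sigma> j a w0 w1 t \<xi> =
     of_real (mult0 \<sigma> j a t \<xi>) * fourier_L2 w0 \<xi> + of_real (mult1 \<sigma> j a t \<xi>) * fourier_L2 w1 \<xi>"

lemma Sobolev_mono:
  assumes "f \<in> Sobolev s" "s' \<le> s"
  shows "f \<in> Sobolev s'"
proof -
  have f: "f \<in> Lp 2" and bf: "(\<lambda>\<xi>. complex_of_real (bessel s \<xi>) * fourier_L2 f \<xi>) \<in> Lp 2"
    using assms(1) by (auto simp: Sobolev_bessel)
  have m: "(\<lambda>\<xi>. complex_of_real (bessel s' \<xi>) * fourier_L2 f \<xi>) \<in> borel_measurable lebesgue"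
    by (rule borel_measurable_times[OF borel_imp_lebesgue_measurable Lp2_measurable[OF fourier_L2_spec(1)[OF f]]])
       measurable
  have "norm (complex_of_real (bessel s' \<xi>) * fourier_L2 f \<xi>) \<le> 1 * norm (complex_of_real (bessel s \<xi>) * fourier_L2 f \<xi>)" for \<xi>
  proof -
    have "bessel s' \<xi> \<le> bessel s \<xi>" unfolding bessel_def using assms(2) by (intro powr_mono) auto
    then show ?thesis
      using bessel_pos[of s \<xi>] bessel_pos[of s' \<xi>] by (simp add: norm_mult mult_right_mono)
  qed
  then have "(\<lambda>\<xi>. complex_of_real (bessel s' \<xi>) * fourier_L2 f \<xi>) \<in> Lp 2"
    using Lp2_bound(1)[OF bf m, of 1] by auto
  with f show ?thesis by (simp add: Sobolev_bessel)
qed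

lemma Sobolev_Lp2: "f \<in> Sobolev s \<Longrightarrow> f \<in> Lp 2"
  by (simp add: Sobolev_def)

lemma multiplier_weighted_bound:
  fixes f :: "'a::euclidean_space \<Rightarrow> complex"
  assumes f: "f \<in> Sobolev b" and t: "t \<ge> 0" and c: "c \<ge> 0"
    and M: "(\<lambda>\<xi>. complex_of_real (M \<xi>)) \<in> borel_measurable borel"
    and bound: "\<And>\<xi>. \<xi> \<noteq> 0 \<Longrightarrow> \<bar>M \<xi>\<bar> \<le> c * bessel b \<xi> * damping \<sigma> t \<xi>"
  shows "(\<lambda>\<xi>. of_real (M \<xi>) * fourier_L2 f \<xi>) \<in> Lp 2"
    "Lp_norm 2 (\<lambda>\<xi>. of_real (M \<xi>) * fourier_L2 f \<xi>) \<le> c * Lp_norm 2 (weighted \<sigma> t b f)"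
proof -
  have m: "(\<lambda>\<xi>. of_real (M \<xi>) * fourier_L2 f \<xi>) \<in> borel_measurable lebesgue"
    by (rule borel_measurable_times[OF borel_imp_lebesgue_measurable[OF M] Lp2_measurable[OF fourier_L2_spec(1)[OF Sobolev_Lp2[OF f]]]])
  have AE: "AE \<xi> in lebesgue. norm (of_real (M \<xi>) * fourier_L2 f \<xi>) \<le> c * norm (weighted \<sigma> t b f \<xi>)"
    using AE_lebesgue_nonzero
  proof eventually_elim
    case (elim \<xi>)
    have "\<bar>M \<xi>\<bar> * norm (fourier_L2 f \<xi>) \<le> (c * bessel b \<xi> * damping \<sigma> t \<xi>) * norm (fourier_L2 f \<xi>)"
      by (rule mult_right_mono[OF bound[OF elim] norm_ge_zero])
    then show ?case
      using bessel_pos[of b \<xi>] damping_pos[of \<sigma> t \<xi>] by (simp add: weighted_def norm_mult abs_mult mult.assoc)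
  qed
  show "(\<lambda>\<xi>. of_real (M \<xi>) * fourier_L2 f \<xi>) \<in> Lp 2"
    "Lp_norm 2 (\<lambda>\<xi>. of_real (M \<xi>) * fourier_L2 f \<xi>) \<le> c * Lp_norm 2 (weighted \<sigma> t b f)"
    using Lp2_bound[OF weighted_mem(1)[OF f t] m c AE] by auto
qed

lemma solution_hat_bound:
  fixes \<sigma> a :: real and j :: nat
  assumes \<sigma>: "\<sigma> > 0" and a: "a \<ge> 0" and j: "j \<in> {0, 1}"
  shows "\<exists>C>0. \<forall>w0 w1 :: 'a::euclidean_space \<Rightarrow> complex. \<forall>t\<ge>0.
    w0 \<in> Sobolev (a + j * \<sigma>) \<longrightarrow> w1 \<in> Sobolev (max (a + (real j - 1) * \<sigma>) 0) \<longrightarrow>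
    solution_hat \<sigma> j a w0 w1 t \<in> Lp 2 \<and>
    Lp_norm 2 (solution_hat \<sigma> j a w0 w1 t)
      \<le> C * ((1 + t) powr (- a / \<sigma> - j) * Lp_norm 2 (weighted \<sigma> t (a + j * \<sigma>) w0)
           + (1 + t) powr (1 - a / \<sigma> - j) * Lp_norm 2 (weighted \<sigma> t (max (a + (real j - 1) * \<sigma>) 0) w1))"
proof -
  let ?s0 = "a + j * \<sigma>" and ?s1 = "max (a + (real j - 1) * \<sigma>) 0"
  obtain C0 where C0: "C0 > 0" and M0: "\<And>(\<xi>::'a) t. \<xi> \<noteq> 0 \<Longrightarrow> t \<ge> 0 \<Longrightarrow>
      \<bar>mult0 \<sigma> j a t \<xi>\<bar> \<le> C0 * (1 + t) powr (- a / \<sigma> - j) * bessel ?s0 \<xi> * damping \<sigma> t \<xi>"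
    using mult0_bound[OF \<sigma> a j, where 'a='a] by blast
  obtain C1 where C1: "C1 > 0" and M1: "\<And>(\<xi>::'a) t. \<xi> \<noteq> 0 \<Longrightarrow> t \<ge> 0 \<Longrightarrow>
      \<bar>mult1 \<sigma> j a t \<xi>\<bar> \<le> C1 * (1 + t) powr (1 - a / \<sigma> - j) * bessel ?s1 \<xi> * damping \<sigma> t \<xi>"
    using mult1_bound[OF \<sigma> a j, where 'a='a] by blast
  define C where "C = C0 + C1"
  have "solution_hat \<sigma> j a w0 w1 t \<in> Lp 2 \<and> Lp_norm 2 (solution_hat \<sigma> j a w0 w1 t)
      \<le> C * ((1 + t) powr (- a / \<sigma> - j) * Lp_norm 2 (weighted \<sigma> t ?s0 w0)
           + (1 + t) powr (1 - a / \<sigma> - j) * Lp_norm 2 (weighted \<sigma> t ?s1 w1))"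
    if t: "t \<ge> 0" and w0: "w0 \<in> Sobolev ?s0" and w1: "w1 \<in> Sobolev ?s1"
    for w0 w1 :: "'a \<Rightarrow> complex" and t
  proof -
    define A where "A = (1 + t) powr (- a / \<sigma> - j) * Lp_norm 2 (weighted \<sigma> t ?s0 w0)"
    define B where "B = (1 + t) powr (1 - a / \<sigma> - j) * Lp_norm 2 (weighted \<sigma> t ?s1 w1)"
    have AB: "A \<ge> 0" "B \<ge> 0" by (auto simp: A_def B_def Lp_norm_nonneg)
    have "0 \<le> C0 * (1 + t) powr (- a / \<sigma> - j)" using C0 by simp
    note 0 = multiplier_weighted_bound[OF w0 t this mult_measurable(1) M0[OF _ t]]
    have "0 \<le> C1 * (1 + t) powr (1 - a / \<sigma> - j)" using C1 by simp
    note 1 = multiplier_weighted_bound[OF w1 t this mult_measurable(2) M1[OF _ t]]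
    have "Lp_norm 2 (solution_hat \<sigma> j a w0 w1 t) \<le> C0 * A + C1 * B"
      using Lp_norm2_triangle[OF 0(1) 1(1)] 0(2) 1(2)
      unfolding solution_hat_def[abs_def] A_def B_def by (simp add: mult.assoc)
    also have "\<dots> \<le> C * A + C * B"
      using AB C0 C1 by (intro add_mono mult_right_mono) (auto simp: C_def)
    finally have "Lp_norm 2 (solution_hat \<sigma> j a w0 w1 t) \<le> C * (A + B)" by (simp add: distrib_left)
    moreover have "solution_hat \<sigma> j a w0 w1 t \<in> Lp 2"
      using Lp2_add_mem[OF 0(1) 1(1)] unfolding solution_hat_def[abs_def] .
    ultimately show ?thesis by (simp add: A_def B_def)
  qed
  moreover have "C > 0" using C0 C1 by (simp add: C_def)
  ultimately show ?thesis by blast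
qed

lemma difference_quotient_bound:
  fixes f f' :: "real \<Rightarrow> real"
  assumes "\<And>t. t \<ge> 0 \<Longrightarrow> (f has_real_derivative f' t) (at t within {0..})"
    and "\<And>t. t \<ge> 0 \<Longrightarrow> \<bar>f' t\<bar> \<le> B" and "s \<ge> 0" "t \<ge> 0" "s \<noteq> t"
  shows "\<bar>(f s - f t) / (s - t)\<bar> \<le> B"
proof -
  have "norm (f s - f t) \<le> B * norm (s - t)"
    by (rule field_differentiable_bound[of "{0..}" f f']) (use assms in auto)
  then show ?thesis using assms(5) by (simp add: abs_divide pos_divide_le_eq)
qed

text \<open>The difference quotients of the multipliers are bounded uniformly in \<open>s\<close> by the weight of the data
  spaces and converge pointwise, so they converge in \<open>L\<^sup>2\<close> on the Fourier side.\<close>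

lemma solution_hat_time_derivative:
  fixes w0 w1 :: "'a::euclidean_space \<Rightarrow> complex"
  assumes \<sigma>: "\<sigma> > 0" and a: "a \<ge> 0" and w0: "w0 \<in> Sobolev (a + \<sigma>)" and w1: "w1 \<in> Sobolev a" and t: "t \<ge> 0"
  shows "((\<lambda>s. Lp_norm 2 (\<lambda>\<xi>. (solution_hat \<sigma> 0 a w0 w1 s \<xi> - solution_hat \<sigma> 0 a w0 w1 t \<xi>) / of_real (s - t)
      - solution_hat \<sigma> 1 a w0 w1 t \<xi>)) \<longlongrightarrow> 0) (at t within {0..})"
  unfolding tendsto_at_iff_sequentially comp_def
proof (intro allI impI)
  fix X :: "nat \<Rightarrow> real"
  assume X: "\<forall>i. X i \<in> {0..} - {t}" and Xt: "X \<longlonglongrightarrow> t"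
  have X0: "X n \<ge> 0" "X n \<noteq> t" for n using X by auto
  obtain C0 where C0: "C0 > 0" and M0: "\<And>(\<xi>::'a) t. \<xi> \<noteq> 0 \<Longrightarrow> t \<ge> 0 \<Longrightarrow>
      \<bar>mult0 \<sigma> 1 a t \<xi>\<bar> \<le> C0 * (1 + t) powr (- a / \<sigma> - 1) * bessel (a + \<sigma>) \<xi> * damping \<sigma> t \<xi>"
    using mult0_bound[OF \<sigma> a, of 1, where 'a='a] by auto
  obtain C1 where C1: "C1 > 0" and M1: "\<And>(\<xi>::'a) t. \<xi> \<noteq> 0 \<Longrightarrow> t \<ge> 0 \<Longrightarrow>
      \<bar>mult1 \<sigma> 1 a t \<xi>\<bar> \<le> C1 * (1 + t) powr (- a / \<sigma>) * bessel a \<xi> * damping \<sigma> t \<xi>"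
    using mult1_bound[OF \<sigma> a, of 1, where 'a='a] a by auto
  have simple: "c * (1 + t) powr (- p) * B * D \<le> c * B" if "c > 0" "t \<ge> 0" "p \<ge> 0" "B > 0" "0 < D" "D \<le> 1" for c t p B D :: real
  proof -
    have "(1 + t) powr (- p) * D \<le> 1 * 1"
    proof (rule mult_mono)
      show "(1 + t) powr (- p) \<le> 1" using that powr_mono[of "- p" 0 "1 + t"] by simp
    qed (use that in auto)
    then have "(c * B) * ((1 + t) powr (- p) * D) \<le> (c * B) * 1" using that by (intro mult_left_mono) auto
    then show ?thesis by (simp add: mult_ac)
  qed
  have as: "a / \<sigma> \<ge> 0" using a \<sigma> by simp
  have B0: "\<bar>mult0 \<sigma> 1 a s \<xi>\<bar> \<le> C0 * bessel (a + \<sigma>) \<xi>" if "\<xi> \<noteq> 0" "s \<ge> 0" for s and \<xi> :: 'a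
  proof -
    have e: "- a / \<sigma> - 1 = - (a / \<sigma> + 1)" and p: "0 \<le> a / \<sigma> + 1" using as by simp_all
    show ?thesis
      by (rule order_trans[OF M0[OF that, unfolded e]
            simple[OF C0 that(2) p bessel_pos damping_pos damping_le_1[OF that(2)]]])
  qed
  have B1: "\<bar>mult1 \<sigma> 1 a s \<xi>\<bar> \<le> C1 * bessel a \<xi>" if "\<xi> \<noteq> 0" "s \<ge> 0" for s and \<xi> :: 'a
    by (rule order_trans[OF M1[OF that, folded minus_divide_left]
          simple[OF C1 that(2) as bessel_pos damping_pos damping_le_1[OF that(2)]]])
  have D0: "((\<lambda>s. mult0 \<sigma> 0 a s \<xi>) has_real_derivative mult0 \<sigma> 1 a s \<xi>) (at s within {0..})" if "\<xi> \<noteq> 0" for s and \<xi> :: 'a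
    unfolding mult0_def using that by (auto intro!: DERIV_cmult osc_deriv)
  have D1: "((\<lambda>s. mult1 \<sigma> 0 a s \<xi>) has_real_derivative mult1 \<sigma> 1 a s \<xi>) (at s within {0..})" if "\<xi> \<noteq> 0" for s and \<xi> :: 'a
    unfolding mult1_def using that by (auto intro!: DERIV_cmult osc_deriv)
  define q0 where "q0 n \<xi> = (mult0 \<sigma> 0 a (X n) \<xi> - mult0 \<sigma> 0 a t \<xi>) / (X n - t)" for n and \<xi> :: 'a
  define q1 where "q1 n \<xi> = (mult1 \<sigma> 0 a (X n) \<xi> - mult1 \<sigma> 0 a t \<xi>) / (X n - t)" for n and \<xi> :: 'a
  define G where "G n \<xi> = of_real (q0 n \<xi>) * fourier_L2 w0 \<xi> + of_real (q1 n \<xi>) * fourier_L2 w1 \<xi>" for n \<xi>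
  \<comment> \<open>the dominating function, independent of \<open>n\<close>\<close>
  define h where "h \<xi> = complex_of_real (C0 * norm (complex_of_real (bessel (a + \<sigma>) \<xi>) * fourier_L2 w0 \<xi>)
      + C1 * norm (complex_of_real (bessel a \<xi>) * fourier_L2 w1 \<xi>))" for \<xi>
  have F [measurable]: "fourier_L2 w0 \<in> borel_measurable lebesgue" "fourier_L2 w1 \<in> borel_measurable lebesgue"
    using w0 w1 by (auto intro!: Lp2_measurable fourier_L2_spec Sobolev_Lp2)
  have mm: "(\<lambda>\<xi>::'a. complex_of_real (mult0 \<sigma> j a s \<xi>)) \<in> borel_measurable lebesgue"
    "(\<lambda>\<xi>::'a. complex_of_real (mult1 \<sigma> j a s \<xi>)) \<in> borel_measurable lebesgue" for j s
    by (auto intro!: borel_imp_lebesgue_measurable)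
  have Zm: "solution_hat \<sigma> j a w0 w1 s \<in> borel_measurable lebesgue" for j s
    unfolding solution_hat_def[abs_def] by (intro borel_measurable_add borel_measurable_times mm F)
  have Geq: "G n \<xi> = (solution_hat \<sigma> 0 a w0 w1 (X n) \<xi> - solution_hat \<sigma> 0 a w0 w1 t \<xi>) / of_real (X n - t)" for n \<xi>
    unfolding G_def q0_def q1_def solution_hat_def of_real_divide of_real_diff
    by (simp add: diff_divide_distrib add_divide_distrib left_diff_distrib)
  have Gm: "G n \<in> borel_measurable lebesgue" for n
    unfolding Geq by (intro borel_measurable_divide borel_measurable_diff Zm borel_measurable_const)
  have n: "(\<lambda>\<xi>. complex_of_real (norm (g \<xi>))) \<in> Lp 2" if "g \<in> Lp 2" for g :: "'a \<Rightarrow> complex"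
    using that by (auto simp: Lp2_iff)
  have hL: "h \<in> Lp 2"
    using Lp2_lincomb(1)[OF n n, of "\<lambda>\<xi>. complex_of_real (bessel (a + \<sigma>) \<xi>) * fourier_L2 w0 \<xi>"
        "\<lambda>\<xi>. complex_of_real (bessel a \<xi>) * fourier_L2 w1 \<xi>" "of_real C0" "of_real C1"] w0 w1
    unfolding h_def[abs_def] Sobolev_bessel by simp
  have "AE \<xi> in lebesgue. norm (G n \<xi>) \<le> norm (h \<xi>)" for n
    using AE_lebesgue_nonzero
  proof eventually_elim
    case (elim \<xi>)
    have "\<bar>q0 n \<xi>\<bar> \<le> C0 * bessel (a + \<sigma>) \<xi>"
      unfolding q0_def
      by (rule difference_quotient_bound[OF D0 B0]) (use elim X0 t in auto)
    then have 0: "\<bar>q0 n \<xi>\<bar> * norm (fourier_L2 w0 \<xi>) \<le> C0 * bessel (a + \<sigma>) \<xi> * norm (fourier_L2 w0 \<xi>)"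
      by (rule mult_right_mono) simp
    have "\<bar>q1 n \<xi>\<bar> \<le> C1 * bessel a \<xi>"
      unfolding q1_def
      by (rule difference_quotient_bound[OF D1 B1]) (use elim X0 t in auto)
    then have 1: "\<bar>q1 n \<xi>\<bar> * norm (fourier_L2 w1 \<xi>) \<le> C1 * bessel a \<xi> * norm (fourier_L2 w1 \<xi>)"
      by (rule mult_right_mono) simp
    have "norm (G n \<xi>) \<le> \<bar>q0 n \<xi>\<bar> * norm (fourier_L2 w0 \<xi>) + \<bar>q1 n \<xi>\<bar> * norm (fourier_L2 w1 \<xi>)"
      unfolding G_def by (rule order_trans[OF norm_triangle_ineq]) (simp add: norm_mult)
    also have "\<dots> \<le> C0 * bessel (a + \<sigma>) \<xi> * norm (fourier_L2 w0 \<xi>) + C1 * bessel a \<xi> * norm (fourier_L2 w1 \<xi>)"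
      using 0 1 by (rule add_mono)
    also have "\<dots> = C0 * norm (complex_of_real (bessel (a + \<sigma>) \<xi>) * fourier_L2 w0 \<xi>)
        + C1 * norm (complex_of_real (bessel a \<xi>) * fourier_L2 w1 \<xi>)"
      using bessel_pos[of "a + \<sigma>" \<xi>] bessel_pos[of a \<xi>] by (simp add: norm_mult mult.assoc)
    also have "\<dots> \<le> norm (h \<xi>)" unfolding h_def norm_of_real by (rule abs_ge_self)
    finally show ?case .
  qed
  moreover have "AE \<xi> in lebesgue. (\<lambda>n. G n \<xi>) \<longlonglongrightarrow> solution_hat \<sigma> 1 a w0 w1 t \<xi>"
    using AE_lebesgue_nonzero
  proof eventually_elim
    case (elim \<xi>)
    have seq: "filterlim X (at t within {0..}) sequentially"
      using Xt X by (auto simp: filterlim_at intro!: always_eventually)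
    have "(\<lambda>n. q0 n \<xi>) \<longlonglongrightarrow> mult0 \<sigma> 1 a t \<xi>"
      unfolding q0_def
      using filterlim_compose[OF D0[OF elim, of t, unfolded has_field_derivative_iff] seq] .
    moreover have "(\<lambda>n. q1 n \<xi>) \<longlonglongrightarrow> mult1 \<sigma> 1 a t \<xi>"
      unfolding q1_def
      using filterlim_compose[OF D1[OF elim, of t, unfolded has_field_derivative_iff] seq] .
    ultimately show ?case
      unfolding G_def solution_hat_def by (intro tendsto_intros)
  qed
  ultimately have "(\<lambda>n. Lp_norm 2 (\<lambda>\<xi>. G n \<xi> - solution_hat \<sigma> 1 a w0 w1 t \<xi>)) \<longlonglongrightarrow> 0"
    by (rule Lp2_dominated_convergence(2)[OF Gm Zm hL])
  then show "(\<lambda>n. Lp_norm 2 (\<lambda>\<xi>. (solution_hat \<sigma> 0 a w0 w1 (X n) \<xi> - solution_hat \<sigma> 0 a w0 w1 t \<xi>) / of_real (X n - t)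
      - solution_hat \<sigma> 1 a w0 w1 t \<xi>)) \<longlonglongrightarrow> 0"
    unfolding Geq .
qed

text \<open>The inverse transform is linear up to null sets, which is why the difference quotient is compared on
  the Fourier side.\<close>

lemma solution_time_derivative:
  fixes w0 w1 :: "'a::euclidean_space \<Rightarrow> complex"
  assumes \<sigma>: "\<sigma> > 0" and a: "a \<ge> 0" and w0: "w0 \<in> Sobolev (a + \<sigma>)" and w1: "w1 \<in> Sobolev a" and t: "t \<ge> 0"
    and L: "\<And>s. s \<ge> 0 \<Longrightarrow> solution_hat \<sigma> 0 a w0 w1 s \<in> Lp 2" "solution_hat \<sigma> 1 a w0 w1 t \<in> Lp 2"
  shows "tendsto_Lp 2 (\<lambda>s x. (inverse_fourier_L2 (solution_hat \<sigma> 0 a w0 w1 s) x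
      - inverse_fourier_L2 (solution_hat \<sigma> 0 a w0 w1 t) x) / complex_of_real (s - t))
      (inverse_fourier_L2 (solution_hat \<sigma> 1 a w0 w1 t)) (at t within {0..})"
proof -
  define v where "v s = inverse_fourier_L2 (solution_hat \<sigma> 0 a w0 w1 s)" for s
  define z where "z = inverse_fourier_L2 (solution_hat \<sigma> 1 a w0 w1 t)"
  have v: "v s \<in> Lp 2" and Fv: "AE \<xi> in lebesgue. fourier_L2 (v s) \<xi> = solution_hat \<sigma> 0 a w0 w1 s \<xi>" if "s \<ge> 0" for s
    unfolding v_def using fourier_L2_inverse[OF L(1)[OF that]] by auto
  have z: "z \<in> Lp 2" and Fz: "AE \<xi> in lebesgue. fourier_L2 z \<xi> = solution_hat \<sigma> 1 a w0 w1 t \<xi>"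
    unfolding z_def using fourier_L2_inverse[OF L(2)] by auto
  have key: "(\<lambda>x. (v s x - v t x) / complex_of_real (s - t) - z x) \<in> Lp 2 \<and>
      Lp_norm 2 (\<lambda>x. (v s x - v t x) / complex_of_real (s - t) - z x)
      = Lp_norm 2 (\<lambda>\<xi>. (solution_hat \<sigma> 0 a w0 w1 s \<xi> - solution_hat \<sigma> 0 a w0 w1 t \<xi>) / of_real (s - t)
          - solution_hat \<sigma> 1 a w0 w1 t \<xi>)" if s: "s \<ge> 0" for s
  proof -
    define c where "c = 1 / complex_of_real (s - t)"
    define q where "q = (\<lambda>x. c * v s x + (- c) * v t x)"
    have q: "q \<in> Lp 2" unfolding q_def by (rule Lp2_lincomb(1)[OF v[OF s] v[OF t]])
    have eq: "(\<lambda>x. (v s x - v t x) / complex_of_real (s - t) - z x) = (\<lambda>x. 1 * q x + (- 1) * z x)"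
      by (auto simp: q_def c_def diff_divide_distrib)
    have qz: "(\<lambda>x. 1 * q x + (- 1) * z x) \<in> Lp 2" by (rule Lp2_lincomb(1)[OF q z])
    have "AE \<xi> in lebesgue. fourier_L2 q \<xi> = c * fourier_L2 (v s) \<xi> + (- c) * fourier_L2 (v t) \<xi>"
      unfolding q_def by (rule fourier_L2_lincomb[OF v[OF s] v[OF t]])
    with fourier_L2_lincomb[OF q z, of 1 "- 1"] Fv[OF s] Fv[OF t] Fz
    have AE: "AE \<xi> in lebesgue. (solution_hat \<sigma> 0 a w0 w1 s \<xi> - solution_hat \<sigma> 0 a w0 w1 t \<xi>) / of_real (s - t)
          - solution_hat \<sigma> 1 a w0 w1 t \<xi> = fourier_L2 (\<lambda>x. 1 * q x + (- 1) * z x) \<xi>"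
      by eventually_elim (simp add: c_def diff_divide_distrib)
    have "(\<lambda>\<xi>. (solution_hat \<sigma> 0 a w0 w1 s \<xi> - solution_hat \<sigma> 0 a w0 w1 t \<xi>) / of_real (s - t)
          - solution_hat \<sigma> 1 a w0 w1 t \<xi>) \<in> borel_measurable lebesgue"
      using Lp2_measurable[OF L(1)[OF s]] Lp2_measurable[OF L(1)[OF t]] Lp2_measurable[OF L(2)]
      by (intro borel_measurable_divide borel_measurable_diff borel_measurable_const)
    from Lp2_cong_AE(2)[OF fourier_L2_spec(1)[OF qz] this AE] fourier_L2_norm[OF qz] qz
    show ?thesis unfolding eq by simp
  qed
  have ev: "\<forall>\<^sub>F s in at t within {0..}. s \<ge> 0"
    by (simp add: eventually_at_filter)
  show ?thesis
    unfolding tendsto_Lp_def v_def[symmetric] z_def[symmetric]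
  proof
    show "\<forall>\<^sub>F s in at t within {0..}. (\<lambda>x. (v s x - v t x) / complex_of_real (s - t) - z x) \<in> Lp 2"
      using ev by eventually_elim (use key in blast)
    show "((\<lambda>s. Lp_norm 2 (\<lambda>x. (v s x - v t x) / complex_of_real (s - t) - z x)) \<longlongrightarrow> 0) (at t within {0..})"
    proof (rule Lim_transform_eventually[OF solution_hat_time_derivative[OF \<sigma> a w0 w1 t]])
      show "\<forall>\<^sub>F s in at t within {0..}. Lp_norm 2 (\<lambda>\<xi>. (solution_hat \<sigma> 0 a w0 w1 s \<xi> - solution_hat \<sigma> 0 a w0 w1 t \<xi>) / of_real (s - t)
          - solution_hat \<sigma> 1 a w0 w1 t \<xi>) = Lp_norm 2 (\<lambda>x. (v s x - v t x) / complex_of_real (s - t) - z x)"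
        using ev by eventually_elim (use key in simp)
    qed
  qed
qed

text \<open>The inverse transforms of the two families on the Fourier side serve as \<open>|D|\<^sup>a w\<close> and \<open>\<partial>\<^sub>t\<^sup>j |D|\<^sup>a w\<close>; the regularity
  assumed of the data for \<open>j = 1\<close> covers what \<open>j = 0\<close> needs.\<close>

lemma solution_derivative_exists:
  fixes w0 w1 :: "'a::euclidean_space \<Rightarrow> complex"
  assumes \<sigma>: "\<sigma> > 0" and \<delta>: "\<delta> = \<sigma> / 2" and a: "a \<ge> 0" and j: "j \<in> {0, 1}"
    and w0: "w0 \<in> Sobolev (a + j * \<sigma>)" and w1: "w1 \<in> Sobolev (max (a + (real j - 1) * \<sigma>) 0)"
    and w: "Sobolev_solution \<sigma> \<delta> w0 w1 w"
  shows "\<exists>z. is_dt_abs_D j a w z \<and>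
    (\<forall>t\<ge>0. Lp_norm 2 (z t) = Lp_norm 2 (solution_hat \<sigma> j a w0 w1 t))"
proof -
  have L: "solution_hat \<sigma> j a w0 w1 t \<in> Lp 2" if "t \<ge> 0" for t
    using solution_hat_bound[OF \<sigma> a j, where 'a='a] w0 w1 that by blast
  have w0': "w0 \<in> Sobolev (a + real 0 * \<sigma>)"
    by (rule Sobolev_mono[OF w0]) (use \<sigma> in simp)
  have w1': "w1 \<in> Sobolev (max (a + (real 0 - 1) * \<sigma>) 0)"
    by (rule Sobolev_mono[OF w1]) (use \<sigma> j in auto)
  have L0: "solution_hat \<sigma> 0 a w0 w1 t \<in> Lp 2" if "t \<ge> 0" for t
    using solution_hat_bound[OF \<sigma> a, of 0, where 'a='a] w0' w1' that by blast
  define v where "v t = inverse_fourier_L2 (solution_hat \<sigma> 0 a w0 w1 t)" for t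
  define z where "z t = inverse_fourier_L2 (solution_hat \<sigma> j a w0 w1 t)" for t
  have zL: "z t \<in> Lp 2" and zN: "Lp_norm 2 (z t) = Lp_norm 2 (solution_hat \<sigma> j a w0 w1 t)" if "t \<ge> 0" for t
    unfolding z_def using fourier_L2_inverse[OF L[OF that]] by auto
  have abs_D: "abs_D a (w t) (v t)" if t: "t \<ge> 0" for t
    unfolding abs_D_def
  proof (intro conjI)
    show "w t \<in> Lp 2" using w t by (simp add: Sobolev_solution_def)
    show "v t \<in> Lp 2" unfolding v_def by (rule fourier_L2_inverse(1)[OF L0[OF t]])
    have Fv: "AE \<xi> in lebesgue. fourier_L2 (v t) \<xi> = solution_hat \<sigma> 0 a w0 w1 t \<xi>"
      unfolding v_def by (rule fourier_L2_inverse(3)[OF L0[OF t]])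
    have "AE \<xi> in lebesgue. fourier_L2 (w t) \<xi> =
        kernel0 \<sigma> \<delta> t \<xi> * fourier_L2 w0 \<xi> + kernel1 \<sigma> \<delta> t \<xi> * fourier_L2 w1 \<xi>"
      using w t by (simp add: Sobolev_solution_def)
    with Fv AE_lebesgue_nonzero
    show "AE \<xi> in lebesgue. fourier_L2 (v t) \<xi> = complex_of_real (norm \<xi> powr a) * fourier_L2 (w t) \<xi>"
    proof eventually_elim
      case (elim \<xi>)
      then show ?case
        by (simp add: kernel_eq[OF \<delta>] solution_hat_def mult0_def mult1_def distrib_left mult.assoc)
    qed
  qed
  have "L2_time_deriv j v z"
  proof (cases "j = 0")
    case True
    then show ?thesis using zL by (simp add: v_def z_def)
  next
    case False
    then have j1: "j = Suc 0" using j by auto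
    have "L2_time_deriv 0 v v" using fourier_L2_inverse(1)[OF L0] by (simp add: v_def)
    moreover have "tendsto_Lp 2 (\<lambda>s x. (v s x - v t x) / complex_of_real (s - t)) (z t) (at t within {0..})"
      if t: "t \<ge> 0" for t
      unfolding v_def z_def using solution_time_derivative[OF \<sigma> a _ _ t, of w0 w1] w0 w1 a L0 L[OF t] j1
      by simp
    ultimately show ?thesis using zL unfolding j1 by auto
  qed
  then have "is_dt_abs_D j a w z" unfolding is_dt_abs_D_def using abs_D by blast
  then show ?thesis using zN by blast
qed

theorem proposition2p1:
  fixes \<sigma> \<delta> m a :: real and j :: nat
  assumes "\<sigma> \<ge> 1" and "\<delta> = \<sigma> / 2" and "1 \<le> m" and "m < 2" and "a \<ge> 0" and "j \<in> {0, 1}"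
  shows
    "(\<exists>C>0. \<forall>w0 \<in> Lp m \<inter> Sobolev (a + j * \<sigma>).
        \<forall>w1 \<in> Lp m \<inter> Sobolev (max (a + (real j - 1) * \<sigma>) 0).
        \<forall>w :: real \<Rightarrow> real ^ 'n \<Rightarrow> complex. Sobolev_solution \<sigma> \<delta> w0 w1 w \<longrightarrow>
          (\<exists>z. is_dt_abs_D j a w z \<and>
            (\<forall>t\<ge>0. Lp_norm 2 (z t) \<le>
               C * ((1 + t) powr (- (real CARD('n) / \<sigma>) * (1 / m - 1 / 2) - a / \<sigma> - j)
                      * Lp_Sobolev_norm m (a + j * \<sigma>) w0
                  + (1 + t) powr (1 - (real CARD('n) / \<sigma>) * (1 / m - 1 / 2) - a / \<sigma> - j)
                      * Lp_Sobolev_norm m (max (a + (real j - 1) * \<sigma>) 0) w1))))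
     \<and>
     (\<exists>C>0. \<forall>w0 \<in> Sobolev (a + j * \<sigma>).
        \<forall>w1 \<in> Sobolev (max (a + (real j - 1) * \<sigma>) 0).
        \<forall>w :: real \<Rightarrow> real ^ 'n \<Rightarrow> complex. Sobolev_solution \<sigma> \<delta> w0 w1 w \<longrightarrow>
          (\<exists>z. is_dt_abs_D j a w z \<and>
            (\<forall>t\<ge>0. Lp_norm 2 (z t) \<le>
               C * ((1 + t) powr (- a / \<sigma> - j) * Sobolev_norm (a + j * \<sigma>) w0
                  + (1 + t) powr (1 - a / \<sigma> - j)
                      * Sobolev_norm (max (a + (real j - 1) * \<sigma>) 0) w1))))"
proof -
  have \<sigma>: "\<sigma> > 0" using assms(1) by simp
  define s0 s1 where "s0 = a + j * \<sigma>" and "s1 = max (a + (real j - 1) * \<sigma>) 0"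
  define \<kappa> where "\<kappa> = real CARD('n) / \<sigma> * (1 / m - 1 / 2)"
  have s: "s0 \<ge> 0" "s1 \<ge> 0" using assms(5) \<sigma> by (simp_all add: s0_def s1_def)
  obtain C where C: "C > 0" and hat: "\<And>(w0 :: real ^ 'n \<Rightarrow> complex) w1 t. t \<ge> 0 \<Longrightarrow> w0 \<in> Sobolev s0 \<Longrightarrow> w1 \<in> Sobolev s1 \<Longrightarrow>
      Lp_norm 2 (solution_hat \<sigma> j a w0 w1 t)
        \<le> C * ((1 + t) powr (- a / \<sigma> - j) * Lp_norm 2 (weighted \<sigma> t s0 w0)
             + (1 + t) powr (1 - a / \<sigma> - j) * Lp_norm 2 (weighted \<sigma> t s1 w1))"
    using solution_hat_bound[OF \<sigma> assms(5,6), where 'a="real ^ 'n"] unfolding s0_def s1_def by blast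
  note ex = solution_derivative_exists[OF \<sigma> assms(2,5,6), folded s0_def s1_def]
  obtain K0 where K0: "K0 > 0" and low0: "\<And>(f :: real ^ 'n \<Rightarrow> complex) t. t \<ge> 0 \<Longrightarrow> f \<in> Lp m \<Longrightarrow> f \<in> Sobolev s0 \<Longrightarrow>
      Lp_norm 2 (weighted \<sigma> t s0 f) \<le> K0 * (1 + t) powr (- \<kappa>) * Lp_Sobolev_norm m s0 f"
    using weighted_Lm_Sobolev[OF assms(1,3,4) s(1), where 'a="real ^ 'n"] unfolding \<kappa>_def by auto
  obtain K1 where K1: "K1 > 0" and low1: "\<And>(f :: real ^ 'n \<Rightarrow> complex) t. t \<ge> 0 \<Longrightarrow> f \<in> Lp m \<Longrightarrow> f \<in> Sobolev s1 \<Longrightarrow>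
      Lp_norm 2 (weighted \<sigma> t s1 f) \<le> K1 * (1 + t) powr (- \<kappa>) * Lp_Sobolev_norm m s1 f"
    using weighted_Lm_Sobolev[OF assms(1,3,4) s(2), where 'a="real ^ 'n"] unfolding \<kappa>_def by auto
  define K where "K = K0 + K1"
  have K: "K > 0" using K0 K1 by (simp add: K_def)
  have LS: "Lp_Sobolev_norm m b f \<ge> 0" for b and f :: "real ^ 'n \<Rightarrow> complex"
    by (simp add: Lp_Sobolev_norm_def Lp_norm_nonneg Sobolev_norm_def)
  have first: "Lp_norm 2 (solution_hat \<sigma> j a w0 w1 t)
      \<le> (C * K) * ((1 + t) powr (- \<kappa> - a / \<sigma> - j) * Lp_Sobolev_norm m s0 w0
           + (1 + t) powr (1 - \<kappa> - a / \<sigma> - j) * Lp_Sobolev_norm m s1 w1)"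
    if t: "t \<ge> 0" and w0: "w0 \<in> Lp m" "w0 \<in> Sobolev s0" and w1: "w1 \<in> Lp m" "w1 \<in> Sobolev s1"
    for w0 w1 :: "real ^ 'n \<Rightarrow> complex" and t
  proof -
    define E where "E = (1 + t) powr (- \<kappa>)"
    have "Lp_norm 2 (weighted \<sigma> t s0 w0) \<le> K0 * E * Lp_Sobolev_norm m s0 w0"
      using low0[OF t w0] by (simp add: E_def)
    also have "\<dots> \<le> K * E * Lp_Sobolev_norm m s0 w0"
      using K1 LS by (intro mult_right_mono) (auto simp: K_def E_def)
    finally have 0: "Lp_norm 2 (weighted \<sigma> t s0 w0) \<le> K * E * Lp_Sobolev_norm m s0 w0" .
    have "Lp_norm 2 (weighted \<sigma> t s1 w1) \<le> K1 * E * Lp_Sobolev_norm m s1 w1"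
      using low1[OF t w1] by (simp add: E_def)
    also have "\<dots> \<le> K * E * Lp_Sobolev_norm m s1 w1"
      using K0 LS by (intro mult_right_mono) (auto simp: K_def E_def)
    finally have 1: "Lp_norm 2 (weighted \<sigma> t s1 w1) \<le> K * E * Lp_Sobolev_norm m s1 w1" .
    have "Lp_norm 2 (solution_hat \<sigma> j a w0 w1 t)
        \<le> C * ((1 + t) powr (- a / \<sigma> - j) * (K * E * Lp_Sobolev_norm m s0 w0)
             + (1 + t) powr (1 - a / \<sigma> - j) * (K * E * Lp_Sobolev_norm m s1 w1))"
      by (rule order_trans[OF hat[OF t w0(2) w1(2)]])
         (use C 0 1 in \<open>intro mult_left_mono add_mono, auto\<close>)
    also have "\<dots> = (C * K) * ((E * (1 + t) powr (- a / \<sigma> - j)) * Lp_Sobolev_norm m s0 w0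
           + (E * (1 + t) powr (1 - a / \<sigma> - j)) * Lp_Sobolev_norm m s1 w1)"
      by (simp add: algebra_simps)
    also have "E * (1 + t) powr (- a / \<sigma> - j) = (1 + t) powr (- \<kappa> - a / \<sigma> - j)"
      unfolding E_def powr_add[symmetric] by (simp add: algebra_simps)
    also have "E * (1 + t) powr (1 - a / \<sigma> - j) = (1 + t) powr (1 - \<kappa> - a / \<sigma> - j)"
      unfolding E_def powr_add[symmetric] by (simp add: algebra_simps)
    finally show ?thesis .
  qed
  have second: "Lp_norm 2 (solution_hat \<sigma> j a w0 w1 t)
      \<le> C * ((1 + t) powr (- a / \<sigma> - j) * Sobolev_norm s0 w0 + (1 + t) powr (1 - a / \<sigma> - j) * Sobolev_norm s1 w1)"
    if t: "t \<ge> 0" and w0: "w0 \<in> Sobolev s0" and w1: "w1 \<in> Sobolev s1"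
    for w0 w1 :: "real ^ 'n \<Rightarrow> complex" and t
    by (rule order_trans[OF hat[OF t w0 w1]])
       (use C weighted_mem(2)[OF w0 t] weighted_mem(2)[OF w1 t] in \<open>intro mult_left_mono add_mono, auto\<close>)
  have CK: "C * K > 0" using C K by simp
  have \<kappa>': "- (real CARD('n) / \<sigma>) * (1 / m - 1 / 2) = - \<kappa>" "real CARD('n) / \<sigma> * (1 / m - 1 / 2) = \<kappa>"
    by (simp_all add: \<kappa>_def)
  show ?thesis
    unfolding \<kappa>' s0_def[symmetric] s1_def[symmetric]
  proof (intro conjI)
    show "\<exists>C>0. \<forall>w0 \<in> Lp m \<inter> Sobolev s0. \<forall>w1 \<in> Lp m \<inter> Sobolev s1.
        \<forall>w :: real \<Rightarrow> real ^ 'n \<Rightarrow> complex. Sobolev_solution \<sigma> \<delta> w0 w1 w \<longrightarrow>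
          (\<exists>z. is_dt_abs_D j a w z \<and>
            (\<forall>t\<ge>0. Lp_norm 2 (z t) \<le>
               C * ((1 + t) powr (- \<kappa> - a / \<sigma> - j) * Lp_Sobolev_norm m s0 w0
                  + (1 + t) powr (1 - \<kappa> - a / \<sigma> - j) * Lp_Sobolev_norm m s1 w1)))"
    proof (intro exI[of _ "C * K"] conjI CK ballI allI impI)
      fix w0 w1 :: "real ^ 'n \<Rightarrow> complex" and w
      assume w0: "w0 \<in> Lp m \<inter> Sobolev s0" and w1: "w1 \<in> Lp m \<inter> Sobolev s1" and w: "Sobolev_solution \<sigma> \<delta> w0 w1 w"
      obtain z where "is_dt_abs_D j a w z" "\<forall>t\<ge>0. Lp_norm 2 (z t) = Lp_norm 2 (solution_hat \<sigma> j a w0 w1 t)"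
        using ex[OF _ _ w] w0 w1 by blast
      with first w0 w1 show "\<exists>z. is_dt_abs_D j a w z \<and> (\<forall>t\<ge>0. Lp_norm 2 (z t) \<le>
               (C * K) * ((1 + t) powr (- \<kappa> - a / \<sigma> - j) * Lp_Sobolev_norm m s0 w0
                  + (1 + t) powr (1 - \<kappa> - a / \<sigma> - j) * Lp_Sobolev_norm m s1 w1))"
        by (intro exI[of _ z]) auto
    qed
    show "\<exists>C>0. \<forall>w0 \<in> Sobolev s0. \<forall>w1 \<in> Sobolev s1.
        \<forall>w :: real \<Rightarrow> real ^ 'n \<Rightarrow> complex. Sobolev_solution \<sigma> \<delta> w0 w1 w \<longrightarrow>
          (\<exists>z. is_dt_abs_D j a w z \<and>
            (\<forall>t\<ge>0. Lp_norm 2 (z t) \<le>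
               C * ((1 + t) powr (- a / \<sigma> - j) * Sobolev_norm s0 w0
                  + (1 + t) powr (1 - a / \<sigma> - j) * Sobolev_norm s1 w1)))"
    proof (intro exI[of _ C] conjI C ballI allI impI)
      fix w0 w1 :: "real ^ 'n \<Rightarrow> complex" and w
      assume w0: "w0 \<in> Sobolev s0" and w1: "w1 \<in> Sobolev s1" and w: "Sobolev_solution \<sigma> \<delta> w0 w1 w"
      obtain z where "is_dt_abs_D j a w z" "\<forall>t\<ge>0. Lp_norm 2 (z t) = Lp_norm 2 (solution_hat \<sigma> j a w0 w1 t)"
        using ex[OF w0 w1 w] by blast
      with second w0 w1 show "\<exists>z. is_dt_abs_D j a w z \<and> (\<forall>t\<ge>0. Lp_norm 2 (z t) \<le>
               C * ((1 + t) powr (- a / \<sigma> - j) * Sobolev_norm s0 w0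
                  + (1 + t) powr (1 - a / \<sigma> - j) * Sobolev_norm s1 w1))"
        by (intro exI[of _ z]) auto
    qed
  qed
qed

end
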